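(* Let $n\ge 1$ be an integer, let $r:P_n(S^2)\to\mathbb{R}$ be a quasimorphism on the spherical pure braid group $P_n(S^2)=\pi_1(X_n(S^2),m)$, and let $\Phi:\widetilde{\mathcal{G}}\to\mathbb{R}$ be the quasimorphism induced by $r$ as described in the context. For every real $p>2$ there exists a constant $C>0$ such that for every path $\{\phi_t\}_{t\in[0,1]}$ in $\mathcal{G}$ with $\phi_0=\mathrm{Id}$, \[|\Phi([\{\phi_t\}])|\le C\cdot\bigl(l_p(\{\phi_t\})+1\bigr).\]
   Context: Sphere. $S^2=\mathbb{C}P^1$ carries the standard Fubini-Study Riemannian metric, which in the affine chart $u_0:\mathbb{C}\to U_0=\mathbb{C}P^1\setminus\{[1,0]\}$, $z\mapsto[z,1]$, is $(1+|z|^2)^{-1}$ times the Euclidean metric (as a norm on tangent vectors), and the area form $dV$ of total area $2\pi$, which in the chart is $2(1+|z|^2)^{-2}$ times Lebesgue measure. Group and $L^p$-length. $\mathcal{G}=\mathrm{Diff}(S^2,dV)$ is the group of smooth area-preserving diffeomorphisms of $S^2$, and $\widetilde{\mathcal{G}}$ is its universal cover, whose elements are homotopy classes rel endpoints $[\{\phi_t\}]$ of (smooth) paths with $\phi_0=\mathrm{Id}$. For a path $\{\phi_t\}_{t\in[0,1]}$ in $\mathcal{G}$ generated by the time-dependent vector field $X_t=\frac{d}{dt'}\big|_{t'=t}\phi_{t'}\circ\phi_t^{-1}$, put $l_p(\{\phi_t\})=\int_0^1\bigl(\int_{S^2}|X_t|^p\,dV\bigr)^{1/p}dt$. Quasimorphisms.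 A quasimorphism on a group $G$ is a function $r:G\to\mathbb{R}$ with $\sup_{x,y\in G}|r(xy)-r(x)-r(y)|<\infty$. Configuration space. $X=X_n(S^2)$ is the space of ordered $n$-tuples of distinct points of $S^2$, with the finite measure $\nu$ obtained by restricting the $n$-fold product of the measure $dV$. The basepoint is $m=(m_1,\dots,m_n)$ with distinct points $m_k\in\mathbb{C}\cong U_0$, e.g. $m_k=\varepsilon e^{2\pi i k/n}$ with $\varepsilon>0$ small. $X_n(U_0)=X\cap(U_0)^n\cong X_n(\mathbb{C})$. Short paths. For $y=(y_1,\dots,y_n)\in X_n(U_0)$ (in the affine coordinate) let $\gamma(y)$ be the path $t\mapsto(m_j+t(y_j-m_j))_{1\le j\le n}$, $t\in[0,1]$, from $m$ to $y$. It lies in $X$ for all $y$ in a full-measure subset $X'\subset X_n(U_0)$; for $y\in X\setminus X'$ a smooth path from $m$ to $y$ in $X$ is chosen measurably and arbitrarily (the choice is irrelevant). Induced quasimorphism. For a path $\{\phi_t\}$ in $\mathcal{G}$ with $\phi_0=\mathrm{Id}$ and $x\in X$, let $\phi_t\cdot x$ be the diagonal action, $y=\phi_1\cdot x$, and let $l(x)=\gamma(x)\#\{\phi_t\cdot x\}\#\gamma(y)^{-1}$ be the concatenated loop in $X$ based at $m$ ($\gamma^{-1}$ denotes time reversal). Define $\Phi([\{\phi_t\}])=\int_X r([l(x)])\,d\nu(x)$. The integrand is absolutely integrable, and $\Phi$ is a well-defined quasimorphism on $\widetilde{\mathcal{G}}$. *)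

theory Defs
  imports "HOL-Analysis.Analysis" "HOL-Algebra.Group"
begin

section \<open>The sphere as the complex projective line\<close>

text \<open>
  A point of the projective line is represented by the orthogonal projection of the complex
  plane C^2 onto the corresponding line.  The projection onto the line through
  (a, b) has the matrix with entries |a|^2, a cnj(b), cnj(a) b, |b|^2, divided by
  |a|^2 + |b|^2.  It is Hermitian of trace 1, so it is determined by its off-diagonal entry
  (complex) and its upper left entry (real).  The image is the round sphere of radius 1/2 and
  the Euclidean structure of the ambient space induces exactly the Fubini-Study metric
  (lemmas \<open>CP1_eq_sphere\<close>, \<open>hpt_eq_iff\<close>, \<open>u0_has_vector_derivative_norm\<close> below).
\<close>

type_synonym ambient = "complex \<times> real"

definition hpt :: "complex \<Rightarrow> complex \<Rightarrow> ambient" where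
  "hpt a b = (a * cnj b / of_real ((cmod a)\<^sup>2 + (cmod b)\<^sup>2),
              (cmod a)\<^sup>2 / ((cmod a)\<^sup>2 + (cmod b)\<^sup>2))"

definition CP1 :: "ambient set" where
  "CP1 = {hpt a b | a b. (a, b) \<noteq> (0, 0)}"

definition u0 :: "complex \<Rightarrow> ambient" where
  "u0 z = hpt z 1"

definition U0 :: "ambient set" where
  "U0 = CP1 - {hpt 1 0}"

text \<open>The measure of the area form; the underlying space of the measure is \<open>CP1\<close>.\<close>

definition dV :: "ambient measure" where
  "dV = restrict_space
          (distr (density lborel (\<lambda>z. ennreal (2 / (1 + (cmod z)\<^sup>2)\<^sup>2))) borel u0) CP1"

subsection \<open>Consistency of the model\<close>

lemma u0_eq: "u0 z = (z / of_real (1 + (cmod z)\<^sup>2), (cmod z)\<^sup>2 / (1 + (cmod z)\<^sup>2))"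
  by (simp add: u0_def hpt_def add.commute)

lemma hpt_eq_u0: "b \<noteq> 0 \<Longrightarrow> hpt a b = u0 (a / b)"
proof -
  assume b: "b \<noteq> 0"
  have n: "(cmod b)\<^sup>2 \<noteq> 0" "(cmod a)\<^sup>2 + (cmod b)\<^sup>2 \<noteq> 0" using b by (auto simp: add_nonneg_eq_0_iff)
  have e: "1 + (cmod (a/b))\<^sup>2 = ((cmod a)\<^sup>2 + (cmod b)\<^sup>2) / (cmod b)\<^sup>2"
    using n by (simp add: norm_divide power_divide field_simps)
  have c: "complex_of_real ((cmod b)\<^sup>2) = b * cnj b" by (rule complex_norm_square)
  have "(a/b) / of_real (1 + (cmod (a/b))\<^sup>2) = a * cnj b / of_real ((cmod a)\<^sup>2 + (cmod b)\<^sup>2)"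
    unfolding e of_real_divide c using b by simp
  moreover have "(cmod (a/b))\<^sup>2 / (1 + (cmod (a/b))\<^sup>2) = (cmod a)\<^sup>2 / ((cmod a)\<^sup>2 + (cmod b)\<^sup>2)"
    unfolding e using n by (simp add: norm_divide power_divide)
  ultimately show ?thesis unfolding u0_eq hpt_def by simp
qed

lemma hpt_inf: "a \<noteq> 0 \<Longrightarrow> hpt a 0 = (0, 1)"
  by (simp add: hpt_def)

lemma u0_ne: "u0 z \<noteq> (0,1)"
proof
  assume "u0 z = (0,1)"
  then have a: "(cmod z)\<^sup>2 / (1 + (cmod z)\<^sup>2) = 1" unfolding u0_eq by simp
  have "1 + (cmod z)\<^sup>2 \<noteq> 0" by (simp add: add_nonneg_eq_0_iff)
  then show False using a by (simp add: field_simps)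
qed

lemma u0_recover: "fst (u0 z) / of_real (1 - snd (u0 z)) = z"
proof -
  have n: "1 + (cmod z)\<^sup>2 \<noteq> 0" by (simp add: add_nonneg_eq_0_iff)
  have "1 - snd (u0 z) = 1 / (1 + (cmod z)\<^sup>2)" unfolding u0_eq using n by (simp add: field_simps)
  moreover have "complex_of_real (1 + (cmod z)\<^sup>2) \<noteq> 0" using n by (metis of_real_eq_0_iff)
  ultimately show ?thesis unfolding u0_eq by (simp del: of_real_add)
qed

lemma inj_u0: "inj u0" by (metis injI u0_recover)

lemma hpt_eq_iff:
  assumes "(a, b) \<noteq> (0, 0)" "(c, d) \<noteq> (0, 0)"
  shows "hpt a b = hpt c d \<longleftrightarrow> a * d = b * c"
proof (cases "b = 0"; cases "d = 0")
  assume "b \<noteq> 0" "d \<noteq> 0"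
  then show ?thesis by (simp add: hpt_eq_u0 inj_eq[OF inj_u0] field_simps)
next
  assume "b = 0" "d \<noteq> 0"
  then show ?thesis using assms u0_ne[of "c/d"] by (simp add: hpt_inf) (metis hpt_eq_u0)
next
  assume "b \<noteq> 0" "d = 0"
  then show ?thesis using assms u0_ne[of "a/b"] by (simp add: hpt_inf hpt_eq_u0)
qed (use assms in \<open>auto simp: hpt_inf\<close>)

lemma CP1_eq_insert: "CP1 = insert (0,1) (range u0)"
proof -
  have "hpt a b \<in> insert (0,1) (range u0)" if "(a,b) \<noteq> (0,0)" for a b
    using that by (cases "b = 0") (auto simp: hpt_inf hpt_eq_u0)
  moreover have "(0,1) \<in> CP1" unfolding CP1_def mem_Collect_eq by (intro exI[of _ 1] exI[of _ 0]) (simp add: hpt_inf)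
  moreover have "u0 z \<in> CP1" for z unfolding CP1_def u0_def mem_Collect_eq by (intro exI[of _ z] exI[of _ 1]) simp
  ultimately show ?thesis unfolding CP1_def by blast
qed

lemma mem_sphere_iff: "(w, s) \<in> sphere (0::complex, 1/2::real) (1/2) \<longleftrightarrow> (cmod w)\<^sup>2 = s * (1 - s)"
proof -
  have "dist (0::complex, 1/2::real) (w, s) = sqrt ((cmod w)\<^sup>2 + (s - 1/2)\<^sup>2)"
    by (simp only: dist_Pair_Pair) (simp add: dist_real_def power2_commute)
  then have "(w, s) \<in> sphere (0::complex, 1/2::real) (1/2) \<longleftrightarrow>
      sqrt ((cmod w)\<^sup>2 + (s - 1/2)\<^sup>2) = sqrt ((1/2)\<^sup>2)"
    unfolding mem_sphere by simp
  also have "\<dots> \<longleftrightarrow> (cmod w)\<^sup>2 + (s - 1/2)\<^sup>2 = (1/2)\<^sup>2" by (simp only: real_sqrt_eq_iff)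
  also have "\<dots> \<longleftrightarrow> (cmod w)\<^sup>2 = s * (1 - s)" by (auto simp: power2_eq_square algebra_simps)
  finally show ?thesis .
qed

lemma CP1_eq_sphere: "CP1 = sphere (0, 1/2) (1/2)"
proof (intro equalityI subsetI)
  fix q assume "q \<in> CP1"
  then consider "q = (0,1)" | z where "q = u0 z" unfolding CP1_eq_insert by blast
  then show "q \<in> sphere (0, 1/2) (1/2)"
  proof cases
    case 1 then show ?thesis by (simp only: mem_sphere_iff) simp
  next
    case 2
    have n: "1 + (cmod z)\<^sup>2 \<noteq> 0" "1 + (cmod z)\<^sup>2 > 0" by (simp_all add: add_nonneg_eq_0_iff add_pos_nonneg)
    have "cmod (complex_of_real (1 + (cmod z)\<^sup>2)) = 1 + (cmod z)\<^sup>2"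
      using n by (metis norm_of_real abs_of_pos)
    then show ?thesis unfolding 2 u0_eq mem_sphere_iff norm_divide using n by (simp add: power2_eq_square divide_simps)
  qed
next
  fix q :: ambient assume q: "q \<in> sphere (0, 1/2) (1/2)"
  obtain w s where ws: "q = (w, s)" by fastforce
  have e: "(cmod w)\<^sup>2 = s * (1 - s)" using q unfolding ws mem_sphere_iff .
  show "q \<in> CP1"
  proof (cases "s = 1")
    case True then show ?thesis using e ws by (simp add: CP1_eq_insert)
  next
    case False
    define z where "z = w / of_real (1 - s)"
    have "(cmod z)\<^sup>2 = s * (1 - s) / (1 - s)\<^sup>2"
      by (simp add: z_def norm_divide power_divide e norm_of_real del: of_real_diff)
    then have z: "(cmod z)\<^sup>2 = s / (1 - s)" using False by (simp add: power2_eq_square)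
    have "1 + (cmod z)\<^sup>2 = 1 / (1 - s)" using False unfolding z by (simp add: field_simps)
    then have "u0 z = (z * of_real (1-s), (s / (1 - s)) * (1 - s))" unfolding u0_eq z by (simp del: of_real_diff)
    then have "u0 z = (w, s)" using False unfolding z_def by (simp del: of_real_diff)
    then show ?thesis unfolding ws CP1_eq_insert by (metis insertCI rangeI)
  qed
qed

lemma bij_betw_u0: "bij_betw u0 UNIV U0"
  unfolding bij_betw_def U0_def CP1_eq_insert using inj_u0 u0_ne u0_ne[symmetric] by (auto simp: hpt_inf)

lemma u0_has_vector_derivative_norm:
  assumes "(c has_vector_derivative w) (at t within T)"
  shows "\<exists>v. ((\<lambda>s. u0 (c s)) has_vector_derivative v) (at t within T) \<and>
             norm v = cmod w / (1 + (cmod (c t))\<^sup>2)"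
proof -
  define a where "a = 1 + (cmod (c t))\<^sup>2"
  have a: "a > 0" by (simp add: a_def add_pos_nonneg)
  define k where "k = 2 * (c t \<bullet> w)"
  have N: "((\<lambda>s. (cmod (c s))\<^sup>2) has_real_derivative k) (at t within T)"
    unfolding k_def dot_square_norm[symmetric]
    by (rule derivative_eq_intros assms[unfolded has_vector_derivative_def]  has_derivative_imp_has_field_derivative refl)+
       (auto simp: inner_commute algebra_simps)
  have I: "((\<lambda>s. 1 / (1 + (cmod (c s))\<^sup>2)) has_real_derivative (- k / a\<^sup>2)) (at t within T)"
  proof -
    have G: "((\<lambda>s. 1 + (cmod (c s))\<^sup>2) has_real_derivative k) (at t within T)"
      using DERIV_add[OF DERIV_const N] by simp
    have "1 + (cmod (c t))\<^sup>2 \<noteq> 0" using a by (simp add: a_def)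
    from DERIV_inverse'[OF G this] show ?thesis
      by (simp add: a_def inverse_eq_divide power2_eq_square)
  qed
  define v1 where "v1 = (1/a) *\<^sub>R w + (- k / a\<^sup>2) *\<^sub>R c t"
  have V1: "((\<lambda>s. (1 / (1 + (cmod (c s))\<^sup>2)) *\<^sub>R c s) has_vector_derivative v1) (at t within T)"
    using has_vector_derivative_scaleR[OF I assms] by (simp add: v1_def a_def)
  have u: "u0 z = ((1 / (1 + (cmod z)\<^sup>2)) *\<^sub>R z, 1 - 1 / (1 + (cmod z)\<^sup>2))" for z
  proof -
    have "1 + (cmod z)\<^sup>2 \<noteq> 0" by (simp add: add_nonneg_eq_0_iff)
    then show ?thesis unfolding u0_eq by (simp add: scaleR_conv_of_real field_simps del: of_real_add)
  qed
  have V2: "((\<lambda>s. 1 - 1 / (1 + (cmod (c s))\<^sup>2)) has_vector_derivative (k / a\<^sup>2)) (at t within T)"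
    unfolding has_real_derivative_iff_has_vector_derivative[symmetric]
    by (rule derivative_eq_intros I refl)+ simp
  have "((\<lambda>s. u0 (c s)) has_vector_derivative (v1, k / a\<^sup>2)) (at t within T)"
    unfolding u by (rule has_vector_derivative_Pair[OF V1 V2])
  moreover have "norm (v1, k / a\<^sup>2) = cmod w / a"
  proof -
    define K where "K = (k / a\<^sup>2)\<^sup>2"
    have "(norm (v1, x))\<^sup>2 = (norm v1)\<^sup>2 + x\<^sup>2" for x :: real by (simp add: norm_Pair)
    then have "(norm (v1, k / a\<^sup>2))\<^sup>2 = (norm v1)\<^sup>2 + (k / a\<^sup>2)\<^sup>2" .
    also have "(norm v1)\<^sup>2 = (1/a)\<^sup>2 * (norm w)\<^sup>2 + 2 * (1/a) * (- k / a\<^sup>2) * (c t \<bullet> w) + (k / a\<^sup>2)\<^sup>2 * (cmod (c t))\<^sup>2"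
    proof -
      have "(norm (x *\<^sub>R w + y *\<^sub>R c t))\<^sup>2 = x\<^sup>2 * (norm w)\<^sup>2 + 2 * x * y * (c t \<bullet> w) + y\<^sup>2 * (norm (c t))\<^sup>2" for x y
        unfolding power2_norm_eq_inner
        by (simp add: inner_add_left inner_add_right inner_commute power2_eq_square algebra_simps)
      from this[of "1/a" "- k / a\<^sup>2"] show ?thesis unfolding v1_def by simp
    qed
    also have "2 * (1/a) * (- k / a\<^sup>2) * (c t \<bullet> w) = - ((k / a\<^sup>2)\<^sup>2 * a)"
      using a by (simp add: k_def power2_eq_square)
    also have "(cmod (c t))\<^sup>2 = a - 1" by (simp add: a_def)
    finally have "(norm (v1, k / a\<^sup>2))\<^sup>2 = (1/a)\<^sup>2 * (norm w)\<^sup>2 + - (K * a) + K * (a - 1) + K"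
      unfolding K_def .
    then have "(norm (v1, k / a\<^sup>2))\<^sup>2 = (norm w / a)\<^sup>2"
      by (simp add: right_diff_distrib power_divide)
    then show ?thesis using a by (simp add: power2_eq_iff_nonneg)
  qed
  ultimately show ?thesis unfolding a_def by blast
qed

section \<open>Smooth maps\<close>

primrec Ck_on :: "nat \<Rightarrow> 'a::real_normed_vector set \<Rightarrow> ('a \<Rightarrow> 'b::real_normed_vector) \<Rightarrow> bool" where
  "Ck_on 0 U f \<longleftrightarrow> continuous_on U f"
| "Ck_on (Suc k) U f \<longleftrightarrow>
     (\<forall>x\<in>U. f differentiable (at x)) \<and> (\<forall>v. Ck_on k U (\<lambda>x. frechet_derivative f (at x) v))"

text \<open>
  Smoothness on an arbitrary subset: locally the map extends to a smooth map on an open subset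
  of the ambient space.  On (products of) embedded submanifolds and closed intervals this is the
  usual notion of smoothness.
\<close>

definition smooth_map_on :: "'a::real_normed_vector set \<Rightarrow> ('a \<Rightarrow> 'b::real_normed_vector) \<Rightarrow> bool" where
  "smooth_map_on A f \<longleftrightarrow>
     (\<forall>x\<in>A. \<exists>U g. open U \<and> x \<in> U \<and> (\<forall>k. Ck_on k U g) \<and> (\<forall>y\<in>A \<inter> U. f y = g y))"

section \<open>Area-preserving diffeomorphisms and homotopy classes of paths\<close>

text \<open>
  Maps of the sphere are functions on the ambient space of which only the values on \<open>CP1\<close> matter.
  Preserving the measure means preserving the area form up to sign; along a
  path starting at the identity the sign is 1.
\<close>

definition area_diffeos :: "(ambient \<Rightarrow> ambient) set" where
  "area_diffeos = {f. bij_betw f CP1 CP1 \<and> smooth_map_on CP1 f \<and>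
                      smooth_map_on CP1 (inv_into CP1 f) \<and> distr dV dV f = dV}"

definition diffeo_path :: "(real \<Rightarrow> ambient \<Rightarrow> ambient) \<Rightarrow> bool" where
  "diffeo_path \<phi> \<longleftrightarrow>
     (\<forall>t\<in>{0..1}. \<phi> t \<in> area_diffeos) \<and>
     smooth_map_on ({0..1} \<times> CP1) (\<lambda>(t, x). \<phi> t x) \<and>
     (\<forall>x\<in>CP1. \<phi> 0 x = x)"

definition diffeo_path_homotopic ::
  "(real \<Rightarrow> ambient \<Rightarrow> ambient) \<Rightarrow> (real \<Rightarrow> ambient \<Rightarrow> ambient) \<Rightarrow> bool" where
  "diffeo_path_homotopic \<phi> \<psi> \<longleftrightarrow>
     (\<exists>H :: real \<Rightarrow> real \<Rightarrow> ambient \<Rightarrow> ambient.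
          smooth_map_on ({0..1} \<times> {0..1} \<times> CP1) (\<lambda>(s, t, x). H s t x) \<and>
          (\<forall>s\<in>{0..1}. \<forall>t\<in>{0..1}. H s t \<in> area_diffeos) \<and>
          (\<forall>t\<in>{0..1}. \<forall>x\<in>CP1. H 0 t x = \<phi> t x \<and> H 1 t x = \<psi> t x) \<and>
          (\<forall>s\<in>{0..1}. \<forall>x\<in>CP1. H s 0 x = x \<and> H s 1 x = \<phi> 1 x))"

definition diffeo_path_class ::
  "(real \<Rightarrow> ambient \<Rightarrow> ambient) \<Rightarrow> (real \<Rightarrow> ambient \<Rightarrow> ambient) set" where
  "diffeo_path_class \<phi> = {\<psi>. diffeo_path \<psi> \<and> diffeo_path_homotopic \<phi> \<psi>}"

definition generating_field :: "(real \<Rightarrow> ambient \<Rightarrow> ambient) \<Rightarrow> real \<Rightarrow> ambient \<Rightarrow> ambient" where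
  "generating_field \<phi> t x =
     vector_derivative (\<lambda>t'. \<phi> t' (inv_into CP1 (\<phi> t) x)) (at t within {0..1})"

definition Lp_length :: "real \<Rightarrow> (real \<Rightarrow> ambient \<Rightarrow> ambient) \<Rightarrow> real" where
  "Lp_length p \<phi> =
     integral {0..1} (\<lambda>t. (LINT x|dV. norm (generating_field \<phi> t x) powr p) powr (1 / p))"

section \<open>Quasimorphisms and the fundamental group\<close>

definition quasimorphism :: "('g, 'b) monoid_scheme \<Rightarrow> ('g \<Rightarrow> real) \<Rightarrow> bool" where
  "quasimorphism G r \<longleftrightarrow>
     (\<exists>D. \<forall>x\<in>carrier G. \<forall>y\<in>carrier G. \<bar>r (x \<otimes>\<^bsub>G\<^esub> y) - r x - r y\<bar> \<le> D)"

definition path_class ::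
  "'a::real_normed_vector set \<Rightarrow> (real \<Rightarrow> 'a) \<Rightarrow> (real \<Rightarrow> 'a) set" where
  "path_class S p = {q. homotopic_paths S p q}"

definition fundamental_group ::
  "'a::real_normed_vector set \<Rightarrow> 'a \<Rightarrow> (real \<Rightarrow> 'a) set monoid" where
  "fundamental_group S a =
     \<lparr>carrier = {path_class S p | p. path p \<and> path_image p \<subseteq> S \<and> pathstart p = a \<and> pathfinish p = a},
      mult = (\<lambda>A B. {q. \<exists>p1\<in>A. \<exists>p2\<in>B. homotopic_paths S (p1 +++ p2) q}),
      one = path_class S (linepath a a)\<rparr>"

lemma path_class_eq:
  assumes "homotopic_paths S p q"
  shows "path_class S p = path_class S q"
  unfolding path_class_def using assms homotopic_paths_sym homotopic_paths_trans by blast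

lemma fundamental_group_mult:
  assumes "path p" "path_image p \<subseteq> S" "path q" "path_image q \<subseteq> S" "pathfinish p = pathstart q"
  shows "path_class S p \<otimes>\<^bsub>fundamental_group S a\<^esub> path_class S q = path_class S (p +++ q)"
proof -
  have "homotopic_paths S (p +++ q) s"
    if "homotopic_paths S p p'" "homotopic_paths S q q'" "homotopic_paths S (p' +++ q') s" for p' q' s
    using homotopic_paths_trans[OF homotopic_paths_join[OF that(1,2) assms(5)] that(3)] .
  moreover have "homotopic_paths S p p" "homotopic_paths S q q" using assms by auto
  ultimately have "{s. \<exists>p'\<in>path_class S p. \<exists>q'\<in>path_class S q. homotopic_paths S (p' +++ q') s}
      = {s. homotopic_paths S (p +++ q) s}"
    unfolding path_class_def by blast
  then show ?thesis by (simp add: fundamental_group_def path_class_def)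
qed

lemma group_fundamental_group:
  assumes "a \<in> S"
  shows "group (fundamental_group S a)"
proof -
  let ?G = "fundamental_group S a"
  define L where "L = {p. path p \<and> path_image p \<subseteq> S \<and> pathstart p = a \<and> pathfinish p = a}"
  have car: "carrier ?G = path_class S ` L" by (auto simp: fundamental_group_def L_def)
  have one: "\<one>\<^bsub>?G\<^esub> = path_class S (linepath a a)" by (simp add: fundamental_group_def)
  have c: "linepath a a \<in> L" using assms by (auto simp: L_def)
  have m: "path_class S p \<otimes>\<^bsub>?G\<^esub> path_class S q = path_class S (p +++ q)" if "p \<in> L" "q \<in> L" for p q
    using that by (intro fundamental_group_mult) (auto simp: L_def)
  have j: "p +++ q \<in> L" if "p \<in> L" "q \<in> L" for p q
    using that by (auto simp: L_def path_image_join)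
  have rv: "reversepath p \<in> L" if "p \<in> L" for p using that by (auto simp: L_def)
  show ?thesis
  proof (rule groupI)
    fix x y assume "x \<in> carrier ?G" "y \<in> carrier ?G"
    then show "x \<otimes>\<^bsub>?G\<^esub> y \<in> carrier ?G" unfolding car using m j by auto
  next
    show "\<one>\<^bsub>?G\<^esub> \<in> carrier ?G" unfolding car one using c by blast
  next
    fix x y z assume "x \<in> carrier ?G" "y \<in> carrier ?G" "z \<in> carrier ?G"
    then obtain p q s where *: "p \<in> L" "q \<in> L" "s \<in> L"
      and e: "x = path_class S p" "y = path_class S q" "z = path_class S s" unfolding car by blast
    have "homotopic_paths S (p +++ (q +++ s)) ((p +++ q) +++ s)"
      using * by (intro homotopic_paths_assoc) (auto simp: L_def)
    then have "path_class S ((p +++ q) +++ s) = path_class S (p +++ (q +++ s))"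
      by (metis path_class_eq)
    then show "x \<otimes>\<^bsub>?G\<^esub> y \<otimes>\<^bsub>?G\<^esub> z = x \<otimes>\<^bsub>?G\<^esub> (y \<otimes>\<^bsub>?G\<^esub> z)" unfolding e using * m j by simp
  next
    fix x assume "x \<in> carrier ?G"
    then obtain p where p: "p \<in> L" "x = path_class S p" unfolding car by blast
    have "homotopic_paths S (linepath a a +++ p) p"
      using p by (intro homotopic_paths_lid') (auto simp: L_def)
    then show "\<one>\<^bsub>?G\<^esub> \<otimes>\<^bsub>?G\<^esub> x = x" unfolding one p(2) m[OF c p(1)] by (rule path_class_eq)
    have "homotopic_paths S (reversepath p +++ p) (linepath a a)"
      using p homotopic_paths_linv[of p S] by (auto simp: L_def)
    then have "path_class S (reversepath p) \<otimes>\<^bsub>?G\<^esub> x = \<one>\<^bsub>?G\<^esub>"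
      unfolding one p(2) m[OF rv[OF p(1)] p(1)] by (rule path_class_eq)
    then show "\<exists>y\<in>carrier ?G. y \<otimes>\<^bsub>?G\<^esub> x = \<one>\<^bsub>?G\<^esub>" unfolding car using rv p by blast
  qed
qed

section \<open>Configuration space\<close>

definition conf_space :: "(ambient ^ 'n) set" where
  "conf_space = {x. (\<forall>i. x $ i \<in> CP1) \<and> inj (($) x)}"

definition conf_space_U0 :: "(ambient ^ 'n) set" where
  "conf_space_U0 = {x \<in> conf_space. \<forall>i. x $ i \<in> U0}"

definition conf_measure :: "(ambient ^ 'n) measure" where
  "conf_measure =
     restrict_space (distr (Pi\<^sub>M UNIV (\<lambda>_. dV)) borel (\<lambda>f. \<chi> i. f i)) conf_space"

lemma measurable_vec_dV: "(\<lambda>f. \<chi> i. f i) \<in> measurable (Pi\<^sub>M UNIV (\<lambda>_::'n::finite. dV)) borel"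
proof (subst borel_measurable_euclidean_space, intro ballI)
  fix b :: "ambient^'n" assume "b \<in> Basis"
  then obtain i u where b: "b = axis i u" by (auto simp: Basis_vec_def)
  have s: "sets dV = sets (restrict_space borel CP1)" unfolding dV_def by (rule sets_restrict_space_cong) simp
  have "(\<lambda>f::'n\<Rightarrow>ambient. f i) \<in> measurable (Pi\<^sub>M UNIV (\<lambda>_. dV)) dV" by simp
  then have "(\<lambda>f::'n\<Rightarrow>ambient. f i) \<in> measurable (Pi\<^sub>M UNIV (\<lambda>_. dV)) (restrict_space borel CP1)"
    using s measurable_cong_sets by blast
  then have [measurable]: "(\<lambda>f::'n\<Rightarrow>ambient. f i) \<in> borel_measurable (Pi\<^sub>M UNIV (\<lambda>_. dV))"
    by (simp add: measurable_restrict_space2_iff)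
  show "(\<lambda>f. (\<chi> i. f i) \<bullet> b) \<in> borel_measurable (Pi\<^sub>M UNIV (\<lambda>_. dV))"
    unfolding b by (simp add: inner_axis)
qed

definition basepoint :: "complex ^ 'n \<Rightarrow> ambient ^ 'n" where
  "basepoint m = (\<chi> i. u0 (m $ i))"

definition pure_braid_group :: "complex ^ 'n \<Rightarrow> (real \<Rightarrow> ambient ^ 'n) set monoid" where
  "pure_braid_group m = fundamental_group conf_space (basepoint m)"

definition diag_action :: "(ambient \<Rightarrow> ambient) \<Rightarrow> ambient ^ 'n \<Rightarrow> ambient ^ 'n" where
  "diag_action f x = (\<chi> i. f (x $ i))"

subsection \<open>Short paths\<close>

definition affine_coord :: "ambient \<Rightarrow> complex" where
  "affine_coord = the_inv_into UNIV u0"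

definition affine_path :: "complex ^ 'n \<Rightarrow> ambient ^ 'n \<Rightarrow> real \<Rightarrow> ambient ^ 'n" where
  "affine_path m y t = (\<chi> j. u0 (m $ j + of_real t * (affine_coord (y $ j) - m $ j)))"

definition straight_set :: "complex ^ 'n \<Rightarrow> (ambient ^ 'n) set" where
  "straight_set m = {y \<in> conf_space_U0. \<forall>t\<in>{0..1}. affine_path m y t \<in> conf_space}"

definition short_paths :: "complex ^ 'n \<Rightarrow> (ambient ^ 'n \<Rightarrow> real \<Rightarrow> ambient ^ 'n) \<Rightarrow> bool" where
  "short_paths m \<gamma> \<longleftrightarrow>
     (\<forall>y\<in>straight_set m. \<forall>t\<in>{0..1}. \<gamma> y t = affine_path m y t) \<and>
     (\<forall>y\<in>conf_space - straight_set m.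
        smooth_map_on {0..1} (\<gamma> y) \<and> \<gamma> y ` {0..1} \<subseteq> conf_space \<and>
        \<gamma> y 0 = basepoint m \<and> \<gamma> y 1 = y) \<and>
     (\<forall>t\<in>{0..1}. (\<lambda>y. \<gamma> y t) \<in> borel_measurable (restrict_space borel (conf_space - straight_set m)))"

section \<open>The induced quasimorphism\<close>

definition braid_loop ::
  "(ambient ^ 'n \<Rightarrow> real \<Rightarrow> ambient ^ 'n) \<Rightarrow> (real \<Rightarrow> ambient \<Rightarrow> ambient) \<Rightarrow> ambient ^ 'n \<Rightarrow>
     real \<Rightarrow> ambient ^ 'n" where
  "braid_loop \<gamma> \<phi> x =
     (\<gamma> x +++ (\<lambda>t. diag_action (\<phi> t) x)) +++ reversepath (\<gamma> (diag_action (\<phi> 1) x))"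

text \<open>
  The completion makes the integral independent of the values of the integrand on null sets,
  hence of the paths chosen outside the set \<open>straight_set\<close>.
\<close>

definition induced_on_path ::
  "((real \<Rightarrow> ambient ^ 'n) set \<Rightarrow> real) \<Rightarrow> (ambient ^ 'n \<Rightarrow> real \<Rightarrow> ambient ^ 'n) \<Rightarrow>
     (real \<Rightarrow> ambient \<Rightarrow> ambient) \<Rightarrow> real" where
  "induced_on_path r \<gamma> \<phi> =
     (LINT x|completion conf_measure. r (path_class conf_space (braid_loop \<gamma> \<phi> x)))"

text \<open>
  The function induced on homotopy classes: the common value of \<open>induced_on_path\<close> on all
  representatives.
\<close>

definition induced_qm ::
  "((real \<Rightarrow> ambient ^ 'n) set \<Rightarrow> real) \<Rightarrow> (ambient ^ 'n \<Rightarrow> real \<Rightarrow> ambient ^ 'n) \<Rightarrow>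
     (real \<Rightarrow> ambient \<Rightarrow> ambient) set \<Rightarrow> real" where
  "induced_qm r \<gamma> c = the_elem (induced_on_path r \<gamma> ` c)"

end

theory Submission
  imports Defs
begin

text \<open>
  For almost every configuration no trajectory meets the point at infinity, so the braid lives in the
  configuration space of the plane.  This space is a finite union of open convex cells, a cell
  prescribing for each pair of points one of four half planes that contains their difference.  A loop
  cut into k paths that stay in cells is a product of k loops out of a finite set of classes, up to
  fixed paths at the ends, so a quasimorphism is at most linear in k on it.  A straight path needs at
  most one piece per cell, and the moving points need at most
  \<open>3 * V + 1\<close> pieces, where V integrates \<open>\<bar>z_i' - z_j'\<bar> / \<bar>z_i - z_j\<bar>\<close> over time and sums over pairs.
  Area preservation turns the average of V into the integral of
  \<open>(1 + \<bar>z\<bar>\<^sup>2) * \<bar>X_t z\<bar> / \<bar>z - w\<bar>\<close> over pairs of points of the sphere.  Integrating out w leaves a constant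
  multiple of \<open>(1 + \<bar>z\<bar>) * \<bar>X_t z\<bar>\<close>.  The weight \<open>1 + \<bar>z\<bar>\<close> has a finite q-norm exactly for q < 2, and the
  conjugate exponent satisfies q < 2 because p > 2.
\<close>

section \<open>Bounding a quasimorphism on loops by the number of convex pieces\<close>

text \<open>The values of \<open>r\<close> are taken on spherical braids, but the counting happens
  among planar loops: \<open>basepoint\<close> carries the planar configuration space into the
  spherical one, and \<open>r\<close> pulled back along it is still additive up to a bounded error.
  Finiteness of the cell cover stands in for a choice of generators, so the bound per piece depends
  on \<open>m\<close> and \<open>r\<close> and never on the isotopy. The relative velocity of two
  points involves the field at both of them. The triangle inequality splits it into two one-sided
  terms, each with the field at a single point; only then can the other point be integrated out
  against \<open>1 / cmod (z - w)\<close> with the field left untouched. Avoiding infinity for all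
  times at once is an uncountable family of null conditions. It follows from a uniform speed bound
  together with caps whose area shrinks faster than their radius. The braid integrand itself is only
  compared with a majorant: the integral of a non-integrable function is 0 by convention, and 0
  satisfies the same bound.\<close>

inductive convex_chain :: "'b::real_normed_vector set set \<Rightarrow> nat \<Rightarrow> (real \<Rightarrow> 'b) \<Rightarrow> bool"
  for \<C> where
  piece: "C \<in> \<C> \<Longrightarrow> path p \<Longrightarrow> path_image p \<subseteq> C \<Longrightarrow> convex_chain \<C> 1 p"
| join: "convex_chain \<C> j p \<Longrightarrow> convex_chain \<C> k q \<Longrightarrow> pathfinish p = pathstart q \<Longrightarrow>
    convex_chain \<C> (j + k) (p +++ q)"
| homotopic: "convex_chain \<C> k p \<Longrightarrow> homotopic_paths (\<Union>\<C>) p q \<Longrightarrow> convex_chain \<C> k q"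

lemma convex_chain_path:
  assumes "convex_chain \<C> k p"
  shows "path p" "path_image p \<subseteq> \<Union>\<C>" "k \<ge> 1"
proof -
  have "path p \<and> path_image p \<subseteq> \<Union>\<C> \<and> k \<ge> 1"
    using assms
  proof induction
    case (join j p k q)
    then show ?case by (auto simp: path_image_join)
  qed (auto dest: homotopic_paths_imp_path homotopic_paths_imp_subset)
  then show "path p" "path_image p \<subseteq> \<Union>\<C>" "k \<ge> 1" by auto
qed

lemma convex_chain_reversepath:
  assumes "convex_chain \<C> k p"
  shows "convex_chain \<C> k (reversepath p)"
  using assms
proof induction
  case (piece C p)
  then show ?case by (intro convex_chain.piece) auto
next
  case (join j p k q)
  then have "convex_chain \<C> (k + j) (reversepath q +++ reversepath p)"
    by (intro convex_chain.join) auto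
  then show ?case using join by (simp add: reversepath_joinpaths add.commute)
next
  case (homotopic k p q)
  then show ?case by (metis convex_chain.homotopic homotopic_paths_reversepath)
qed

lemma convex_homotopic_paths:
  fixes C :: "'b::real_normed_vector set"
  assumes "convex C" "C \<subseteq> S" "path p" "path q" "path_image p \<subseteq> C" "path_image q \<subseteq> C"
    "pathstart p = pathstart q" "pathfinish p = pathfinish q"
  shows "homotopic_paths S p q"
proof (rule homotopic_paths_linear[OF assms(3,4)])
  fix t :: real assume "t \<in> {0..1}"
  then have "p t \<in> C" "q t \<in> C" using assms by (auto simp: path_image_def)
  then show "closed_segment (p t) (q t) \<subseteq> S"
    using assms(1,2) closed_segment_subset by blast
qed (use assms in auto)

lemma path_image_linepath_subset_convex:
  "convex C \<Longrightarrow> a \<in> C \<Longrightarrow> b \<in> C \<Longrightarrow> path_image (linepath a b) \<subseteq> C"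
  by (simp add: closed_segment_subset)

text \<open>Composing two closed pieces leaves a reference path run backwards and then forwards.
  With \<open>f\<close> as that path, this removes it in \<open>closing_join\<close>.\<close>

lemma homotopic_paths_cancel_middle:
  fixes u :: "real \<Rightarrow> 'b::real_normed_vector"
  assumes "path u" "path_image u \<subseteq> S" "path f" "path_image f \<subseteq> S" "path v" "path_image v \<subseteq> S"
    "pathfinish u = pathfinish f" "pathfinish f = pathstart v"
  shows "homotopic_paths S ((u +++ reversepath f) +++ (f +++ v)) (u +++ v)"
proof -
  have "homotopic_paths S ((u +++ reversepath f) +++ (f +++ v)) (u +++ (reversepath f +++ (f +++ v)))"
    using assms by (intro homotopic_paths_sym[OF homotopic_paths_assoc]) (auto simp: path_image_join)
  also have "homotopic_paths S \<dots> (u +++ ((reversepath f +++ f) +++ v))"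
    using assms by (intro homotopic_paths_join homotopic_paths_assoc) (auto simp: path_image_join)
  also have "homotopic_paths S \<dots> (u +++ (linepath (pathfinish f) (pathfinish f) +++ v))"
    using assms by (intro homotopic_paths_join homotopic_paths_linv) (auto simp: path_image_join)
  also have "homotopic_paths S \<dots> (u +++ v)"
    using assms by (intro homotopic_paths_join homotopic_paths_lid') (auto simp: path_image_join)
  finally show ?thesis .
qed

text \<open>
  A path inside one convex piece, closed up by the reference paths to its end points, is determined up
  to homotopy by the piece and by the cells chosen for its end points.  Hence only finitely many
  classes of loops arise.
\<close>

locale loop_functional =
  fixes \<C> :: "'b::real_normed_vector set set" and m :: 'b and R :: "(real \<Rightarrow> 'b) \<Rightarrow> real" and D :: real
  assumes fin: "finite \<C>" and conv: "C \<in> \<C> \<Longrightarrow> convex C" and m: "m \<in> \<Union>\<C>"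
    and hom: "homotopic_paths (\<Union>\<C>) p q \<Longrightarrow> pathstart p = m \<Longrightarrow> pathfinish p = m \<Longrightarrow> R p = R q"
    and defect: "path p \<Longrightarrow> path_image p \<subseteq> \<Union>\<C> \<Longrightarrow> pathstart p = m \<Longrightarrow> pathfinish p = m \<Longrightarrow>
        path q \<Longrightarrow> path_image q \<subseteq> \<Union>\<C> \<Longrightarrow> pathstart q = m \<Longrightarrow> pathfinish q = m \<Longrightarrow>
        \<bar>R (p +++ q) - R p - R q\<bar> \<le> D"
begin

abbreviation "Y \<equiv> \<Union>\<C>"
abbreviation "PC \<equiv> path_component_set Y m"

definition cell :: "'b \<Rightarrow> 'b set" where "cell x = (SOME C. C \<in> \<C> \<and> x \<in> C)"
text \<open>Centre and spoke depend on the cell alone, so the reference paths to two points with the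
  same chosen cell differ only by a segment inside that cell. Picking the centre in
  \<open>PC\<close> guarantees that a spoke from \<open>m\<close> exists.\<close>

definition centre :: "'b set \<Rightarrow> 'b" where "centre C = (SOME c. c \<in> C \<inter> PC)"
definition spoke :: "'b set \<Rightarrow> real \<Rightarrow> 'b" where
  "spoke C = (SOME g. path g \<and> path_image g \<subseteq> Y \<and> pathstart g = m \<and> pathfinish g = centre C)"
definition ref_path :: "'b \<Rightarrow> real \<Rightarrow> 'b" where
  "ref_path x = spoke (cell x) +++ linepath (centre (cell x)) x"
definition closing :: "(real \<Rightarrow> 'b) \<Rightarrow> real \<Rightarrow> 'b" where
  "closing p = (ref_path (pathstart p) +++ p) +++ reversepath (ref_path (pathfinish p))"

lemma cell: assumes "x \<in> Y" shows "cell x \<in> \<C>" "x \<in> cell x"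
  using someI_ex[of "\<lambda>C. C \<in> \<C> \<and> x \<in> C"] assms unfolding cell_def by auto

lemma PC_subset: "x \<in> PC \<Longrightarrow> x \<in> Y" using path_component_mem(2) by fastforce

lemma centre: assumes "x \<in> PC" shows "centre (cell x) \<in> cell x" "centre (cell x) \<in> PC"
proof -
  have "\<exists>c. c \<in> cell x \<inter> PC" using assms cell(2) PC_subset by blast
  from someI_ex[OF this] show "centre (cell x) \<in> cell x" "centre (cell x) \<in> PC"
    unfolding centre_def by auto
qed

lemma spoke: assumes "x \<in> PC"
  shows "path (spoke (cell x))" "path_image (spoke (cell x)) \<subseteq> Y"
    "pathstart (spoke (cell x)) = m" "pathfinish (spoke (cell x)) = centre (cell x)"
proof -
  have "\<exists>g. path g \<and> path_image g \<subseteq> Y \<and> pathstart g = m \<and> pathfinish g = centre (cell x)"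
    using centre(2)[OF assms] by (auto simp: path_component_def)
  from someI_ex[OF this] show "path (spoke (cell x))" "path_image (spoke (cell x)) \<subseteq> Y"
    "pathstart (spoke (cell x)) = m" "pathfinish (spoke (cell x)) = centre (cell x)"
    unfolding spoke_def by auto
qed

lemma cell_subset: "x \<in> PC \<Longrightarrow> cell x \<subseteq> Y"
  using cell(1) PC_subset by blast

lemma ref_path: assumes "x \<in> PC"
  shows "path (ref_path x)" "path_image (ref_path x) \<subseteq> Y" "pathstart (ref_path x) = m"
    "pathfinish (ref_path x) = x"
proof -
  have "path_image (linepath (centre (cell x)) x) \<subseteq> cell x"
    using assms by (intro path_image_linepath_subset_convex conv cell centre PC_subset)
  then show "path (ref_path x)" "path_image (ref_path x) \<subseteq> Y" "pathstart (ref_path x) = m"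
    "pathfinish (ref_path x) = x"
    unfolding ref_path_def using spoke[OF assms] cell_subset[OF assms] by (auto simp: path_image_join)
qed

lemma PC_finish: assumes "path p" "path_image p \<subseteq> Y" "pathstart p \<in> PC" shows "pathfinish p \<in> PC"
proof -
  have "path_component Y (pathstart p) (pathfinish p)" using assms by (auto simp: path_component_def)
  then show ?thesis using assms(3) path_component_trans by (metis mem_Collect_eq)
qed

text \<open>Both reference paths run along the same spoke; what remains is a triangle inside one
  convex cell.\<close>

lemma ref_path_shift:
  assumes "x \<in> PC" "y \<in> PC" "cell x = cell y"
  shows "homotopic_paths Y (ref_path x +++ linepath x y) (ref_path y)"
proof -
  have *: "centre (cell x) \<in> cell x" "x \<in> cell x" "y \<in> cell x" "convex (cell x)" "cell x \<subseteq> Y"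
    using assms centre cell conv PC_subset cell_subset by auto
  then have s: "closed_segment (centre (cell x)) x \<subseteq> cell x" "closed_segment x y \<subseteq> cell x"
    "closed_segment (centre (cell x)) y \<subseteq> cell x"
    by (simp_all add: closed_segment_subset)
  have "homotopic_paths Y (ref_path x +++ linepath x y)
      (spoke (cell x) +++ (linepath (centre (cell x)) x +++ linepath x y))"
    unfolding ref_path_def using spoke[OF assms(1)] s *
    by (intro homotopic_paths_sym[OF homotopic_paths_assoc]) (simp_all add: subset_trans)
  also have "homotopic_paths Y \<dots> (ref_path y)"
  proof -
    have "homotopic_paths Y (linepath (centre (cell x)) x +++ linepath x y) (linepath (centre (cell x)) y)"
      using s * by (intro convex_homotopic_paths[of "cell x"]) (simp_all add: subset_path_image_join)
    then show ?thesis
      unfolding ref_path_def assms(3)[symmetric] using spoke[OF assms(1)]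
      by (intro homotopic_paths_join) simp_all
  qed
  finally show ?thesis .
qed

lemma closing: assumes "path p" "path_image p \<subseteq> Y" "pathstart p \<in> PC"
  shows "path (closing p)" "path_image (closing p) \<subseteq> Y" "pathstart (closing p) = m"
    "pathfinish (closing p) = m"
  unfolding closing_def using ref_path[OF assms(3)] ref_path[OF PC_finish[OF assms]] assms
  by (auto simp: path_image_join)

lemma closing_homotopic:
  assumes "homotopic_paths Y p q" "pathstart p \<in> PC"
  shows "homotopic_paths Y (closing p) (closing q)"
proof -
  have p: "path p" "path_image p \<subseteq> Y" using assms(1) homotopic_paths_imp_path homotopic_paths_imp_subset by blast+
  have "pathstart q = pathstart p" "pathfinish q = pathfinish p"
    using assms homotopic_paths_imp_pathstart homotopic_paths_imp_pathfinish by metis+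
  then show ?thesis
    unfolding closing_def using ref_path[OF assms(2)] ref_path[OF PC_finish[OF p assms(2)]] assms p
    by (auto intro!: homotopic_paths_join)
qed

lemma closing_join:
  assumes "path p" "path_image p \<subseteq> Y" "pathstart p \<in> PC" "path q" "path_image q \<subseteq> Y"
    "pathfinish p = pathstart q"
  shows "homotopic_paths Y (closing (p +++ q)) (closing p +++ closing q)"
proof -
  have b: "pathstart q \<in> PC" using PC_finish[OF assms(1-3)] assms(6) by simp
  have c: "pathfinish q \<in> PC" using PC_finish[OF assms(4,5) b] .
  note R = ref_path[OF assms(3)] ref_path[OF b] ref_path[OF c] assms
  let ?a = "ref_path (pathstart p)" and ?b = "ref_path (pathstart q)" and ?c = "ref_path (pathfinish q)"
  have "homotopic_paths Y (closing p +++ closing q)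
      (((?a +++ p) +++ reversepath ?b) +++ (?b +++ (q +++ reversepath ?c)))"
    unfolding closing_def assms(6) using R
    by (intro homotopic_paths_join homotopic_paths_sym[OF homotopic_paths_assoc])
       (auto simp: path_image_join)
  also have "homotopic_paths Y \<dots> ((?a +++ p) +++ (q +++ reversepath ?c))"
    using R by (intro homotopic_paths_cancel_middle) (auto simp: path_image_join)
  also have "homotopic_paths Y \<dots> (((?a +++ p) +++ q) +++ reversepath ?c)"
    using R by (intro homotopic_paths_assoc) (auto simp: path_image_join)
  also have "homotopic_paths Y \<dots> ((?a +++ (p +++ q)) +++ reversepath ?c)"
    using R by (intro homotopic_paths_join homotopic_paths_sym[OF homotopic_paths_assoc])
      (auto simp: path_image_join)
  finally show ?thesis by (simp add: closing_def homotopic_paths_sym)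
qed

text \<open>Inside \<open>C\<close>, the path \<open>p\<close> is homotopic to a detour: the segment
  to the start of \<open>q\<close>, then \<open>q\<close>, then the segment to the end of
  \<open>p\<close>. These segments also lie in the cells chosen for the end points, which agree for
  \<open>p\<close> and \<open>q\<close>, so \<open>ref_path_shift\<close> absorbs them into the
  reference paths.\<close>

lemma closing_piece_unique:
  assumes "C \<in> \<C>" "path p" "path_image p \<subseteq> C" "path q" "path_image q \<subseteq> C"
    "pathstart p \<in> PC" "pathstart q \<in> PC"
    "cell (pathstart p) = cell (pathstart q)" "cell (pathfinish p) = cell (pathfinish q)"
  shows "homotopic_paths Y (closing p) (closing q)"
proof -
  have C: "C \<subseteq> Y" "convex C" using assms conv by auto
  define a b a' b' where "a = pathstart p" "b = pathfinish p" "a' = pathstart q" "b' = pathfinish q"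
  note ab = a_b_a'_b'_def
  have PC: "a \<in> PC" "b \<in> PC" "a' \<in> PC" "b' \<in> PC"
    unfolding ab using PC_finish[of p] PC_finish[of q] assms C by auto
  have inC: "a \<in> C" "b \<in> C" "a' \<in> C" "b' \<in> C" using assms unfolding ab by auto
  have s: "closed_segment a a' \<subseteq> C" "closed_segment b' b \<subseteq> C" "closed_segment b b' \<subseteq> C"
    using inC C by (auto simp: closed_segment_subset)
  have sY: "closed_segment a a' \<subseteq> Y" "closed_segment b' b \<subseteq> Y" "closed_segment b b' \<subseteq> Y" using s C by auto
  note R = ref_path[OF PC(1)] ref_path[OF PC(2)] ref_path[OF PC(3)] ref_path[OF PC(4)]
  have pq: "path_image p \<subseteq> Y" "path_image q \<subseteq> Y" using assms C by auto
  have p': "pathstart p = a" "pathfinish p = b" "pathstart q = a'" "pathfinish q = b'" unfolding ab by auto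
  have 1: "homotopic_paths Y p (linepath a a' +++ (q +++ linepath b' b))"
    using assms C s p' by (intro convex_homotopic_paths[of C]) (auto simp: path_image_join)
  have sh: "homotopic_paths Y (ref_path a +++ linepath a a') (ref_path a')"
    using PC assms(8) p' by (intro ref_path_shift) auto
  have "homotopic_paths Y (ref_path b +++ linepath b b') (ref_path b')"
    using PC assms(9) p' by (intro ref_path_shift) auto
  then have "homotopic_paths Y (reversepath (ref_path b +++ linepath b b')) (reversepath (ref_path b'))"
    by (simp add: homotopic_paths_reversepath)
  then have sh': "homotopic_paths Y (linepath b' b +++ reversepath (ref_path b)) (reversepath (ref_path b'))"
    using R by (simp add: reversepath_joinpaths)
  have "homotopic_paths Y ((ref_path a +++ p) +++ reversepath (ref_path b))
      ((ref_path a +++ (linepath a a' +++ (q +++ linepath b' b))) +++ reversepath (ref_path b))"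
    using R 1 p' by (intro homotopic_paths_join) (auto simp: path_image_join)
  also have "homotopic_paths Y \<dots> (((ref_path a +++ linepath a a') +++ (q +++ linepath b' b)) +++ reversepath (ref_path b))"
    using R p' assms sY pq by (intro homotopic_paths_join homotopic_paths_assoc) (auto simp: path_image_join)
  also have "homotopic_paths Y \<dots> ((ref_path a' +++ (q +++ linepath b' b)) +++ reversepath (ref_path b))"
    using R p' assms sY pq by (intro homotopic_paths_join sh) (auto simp: path_image_join)
  also have "homotopic_paths Y \<dots> (((ref_path a' +++ q) +++ linepath b' b) +++ reversepath (ref_path b))"
    using R p' assms sY pq by (intro homotopic_paths_join homotopic_paths_assoc) (auto simp: path_image_join)
  also have "homotopic_paths Y \<dots> ((ref_path a' +++ q) +++ (linepath b' b +++ reversepath (ref_path b)))"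
    using R p' assms sY pq by (intro homotopic_paths_sym[OF homotopic_paths_assoc]) (auto simp: path_image_join)
  also have "homotopic_paths Y \<dots> ((ref_path a' +++ q) +++ reversepath (ref_path b'))"
    using R p' assms sY pq by (intro homotopic_paths_join sh') (auto simp: path_image_join)
  finally show ?thesis by (simp add: closing_def p')
qed

lemma closing_piece_bounded:
  "\<exists>A\<ge>0. \<forall>C\<in>\<C>. \<forall>p. path p \<longrightarrow> path_image p \<subseteq> C \<longrightarrow> pathstart p \<in> PC \<longrightarrow> \<bar>R (closing p)\<bar> \<le> A"
proof -
  define P where "P = (\<lambda>(C, K, L) p. path p \<and> path_image p \<subseteq> C \<and> pathstart p \<in> PC \<and>
    cell (pathstart p) = K \<and> cell (pathfinish p) = L)"
  \<comment> \<open>For a triple realised by no path the representative is arbitrary, but its term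
    is nonnegative. The sum over all triples therefore dominates every realised one.\<close>
  define B where "B T = \<bar>R (closing (SOME p. P T p))\<bar>" for T
  have B: "\<bar>R (closing p)\<bar> \<le> B (C, cell (pathstart p), cell (pathfinish p))"
    if "C \<in> \<C>" "path p" "path_image p \<subseteq> C" "pathstart p \<in> PC" for C p
  proof -
    let ?T = "(C, cell (pathstart p), cell (pathfinish p))"
    define q where "q = (SOME p. P ?T p)"
    have p: "P ?T p" using that by (simp add: P_def)
    then have q: "P ?T q" unfolding q_def by (rule someI[where P = "P ?T"])
    have "homotopic_paths Y (closing p) (closing q)"
      using p q that(1) unfolding P_def by (intro closing_piece_unique[of C]) auto
    moreover have "path_image p \<subseteq> Y" using that by blast
    ultimately have "R (closing p) = R (closing q)"
      using that closing[of p] by (intro hom) auto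
    then show ?thesis by (simp add: B_def q_def)
  qed
  have "\<bar>R (closing p)\<bar> \<le> (\<Sum>T\<in>\<C>\<times>\<C>\<times>\<C>. B T)"
    if *: "C \<in> \<C>" "path p" "path_image p \<subseteq> C" "pathstart p \<in> PC" for C p
  proof -
    have "pathfinish p \<in> PC" using * by (intro PC_finish) auto
    then have "(C, cell (pathstart p), cell (pathfinish p)) \<in> \<C>\<times>\<C>\<times>\<C>"
      using * cell(1) PC_subset by auto
    then have "B (C, cell (pathstart p), cell (pathfinish p)) \<le> (\<Sum>T\<in>\<C>\<times>\<C>\<times>\<C>. B T)"
      using fin by (intro member_le_sum) (auto simp: B_def)
    then show ?thesis using B[OF *] by simp
  qed
  moreover have "0 \<le> (\<Sum>T\<in>\<C>\<times>\<C>\<times>\<C>. B T)" by (intro sum_nonneg) (simp add: B_def)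
  ultimately show ?thesis by blast
qed

lemma chain_bound:
  "\<exists>A\<ge>0. \<forall>k p. convex_chain \<C> k p \<longrightarrow> pathstart p = m \<longrightarrow> pathfinish p = m \<longrightarrow> \<bar>R p\<bar> \<le> A * real k"
proof -
  obtain A where A: "A \<ge> 0"
    "\<And>C p. C \<in> \<C> \<Longrightarrow> path p \<Longrightarrow> path_image p \<subseteq> C \<Longrightarrow> pathstart p \<in> PC \<Longrightarrow> \<bar>R (closing p)\<bar> \<le> A"
    using closing_piece_bounded by blast
  have lin: "path (linepath m m)" "path_image (linepath m m) \<subseteq> Y" using m by auto
  have D: "D \<ge> 0" using defect[of "linepath m m" "linepath m m"] m by auto
  \<comment> \<open>A chain of \<open>k\<close> pieces has \<open>k - 1\<close> joins, each costing
    one defect. The term \<open>- D\<close> makes the bound reproduce itself exactly under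
    \<open>join\<close>.\<close>
  have main: "\<bar>R (closing p)\<bar> \<le> real k * (A + D) - D" if "convex_chain \<C> k p" "pathstart p \<in> PC" for k p
    using that
  proof induction
    case (piece C p)
    then show ?case using A(2)[of C p] by simp
  next
    case (join j p k q)
    note c = convex_chain_path[OF join(1)] convex_chain_path[OF join(2)]
    have p: "pathstart p \<in> PC" using join by simp
    have q: "pathstart q \<in> PC" using PC_finish[OF c(1,2) p] join by simp
    have "R (closing p +++ closing q) = R (closing (p +++ q))"
      using closing[OF c(1,2) p] closing[OF c(4,5) q]
      by (intro hom homotopic_paths_sym[OF closing_join]) (use c join p in auto)
    moreover have "\<bar>R (closing p +++ closing q) - R (closing p) - R (closing q)\<bar> \<le> D"
      using closing[OF c(1,2) p] closing[OF c(4,5) q] by (intro defect)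
    ultimately have "\<bar>R (closing (p +++ q))\<bar> \<le> \<bar>R (closing p)\<bar> + \<bar>R (closing q)\<bar> + D" by linarith
    then show ?case using join.IH(1)[OF p] join.IH(2)[OF q] by (simp add: algebra_simps)
  next
    case (homotopic k p q)
    have s: "pathstart p \<in> PC" using homotopic homotopic_paths_imp_pathstart by metis
    have "R (closing p) = R (closing q)"
      using closing[of p] convex_chain_path[OF homotopic(1)] s homotopic closing_homotopic
      by (intro hom) auto
    then show ?case using homotopic s by simp
  qed
  have mPC: "m \<in> PC" using m by (simp add: path_component_refl)
  let ?e = "ref_path m"
  note e = ref_path[OF mPC]
  \<comment> \<open>\<open>ref_path m\<close> is itself a loop at \<open>m\<close>, so
    \<open>closing p\<close> is \<open>p\<close> conjugated by it. Undoing the conjugation costs two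
    defects and two fixed values of \<open>R\<close>, which \<open>k \<ge> 1\<close> absorbs into
    the linear bound.\<close>
  define A' where "A' = (A + D) + 2 * D + \<bar>R ?e\<bar> + \<bar>R (reversepath ?e)\<bar>"
  have "\<bar>R p\<bar> \<le> A' * real k" if p: "convex_chain \<C> k p" "pathstart p = m" "pathfinish p = m" for k p
  proof -
    note c = convex_chain_path[OF p(1)]
    have "\<bar>R (?e +++ p) - R ?e - R p\<bar> \<le> D" using e c p by (intro defect) auto
    moreover have "\<bar>R (closing p) - R (?e +++ p) - R (reversepath ?e)\<bar> \<le> D"
      unfolding closing_def p using e c p by (intro defect) (auto simp: path_image_join)
    ultimately have "\<bar>R p\<bar> \<le> \<bar>R (closing p)\<bar> + (2 * D + \<bar>R ?e\<bar> + \<bar>R (reversepath ?e)\<bar>)" by linarith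
    also have "\<dots> \<le> real k * (A + D) - D + (2 * D + \<bar>R ?e\<bar> + \<bar>R (reversepath ?e)\<bar>)"
      using main[OF p(1)] p mPC by simp
    also have "\<dots> \<le> real k * (A + D) + real k * (2 * D + \<bar>R ?e\<bar> + \<bar>R (reversepath ?e)\<bar>)"
      using c(3) D mult_right_mono[of 1 "real k" "2 * D + \<bar>R ?e\<bar> + \<bar>R (reversepath ?e)\<bar>"] by simp
    also have "\<dots> = A' * real k" by (simp add: A'_def algebra_simps)
    finally show ?thesis .
  qed
  moreover have "A' \<ge> 0" unfolding A'_def using A D by simp
  ultimately show ?thesis by blast
qed

end

section \<open>Convex cells of the planar configuration space\<close>

definition quarter_turn :: "bool \<times> bool \<Rightarrow> complex" where
  "quarter_turn d = (if fst d then 1 else -1) * (if snd d then 1 else \<i>)"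

text \<open>The directions for \<open>(i, j)\<close> and \<open>(j, i)\<close> are chosen
  independently; incompatible choices just give the empty cell. Different cells may overlap, as a
  cover by open sets must if paths are to be cut along it.\<close>

definition conf_cell :: "('n \<Rightarrow> 'n \<Rightarrow> bool \<times> bool) \<Rightarrow> (complex ^ 'n) set" where
  "conf_cell \<alpha> = {z. \<forall>i j. i \<noteq> j \<longrightarrow> 0 < Re (quarter_turn (\<alpha> i j) * (z $ i - z $ j))}"

text \<open>One of the four units turns \<open>w\<close> to within 45 degrees of the positive real
  axis, where the real part is at least \<open>cmod w / sqrt 2\<close>. The bound
  \<open>cmod w / 2\<close> is the displacement that \<open>quarter_turn_stays\<close> has to
  tolerate.\<close>

lemma quarter_turn_large_Re:
  assumes "w \<noteq> 0" shows "\<exists>d. cmod w / 2 < Re (quarter_turn d * w)"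
proof (rule ccontr)
  assume "\<not> ?thesis"
  then have *: "Re (quarter_turn d * w) \<le> cmod w / 2" for d by (meson not_less)
  have "\<bar>Re w\<bar> \<le> cmod w / 2"
    using *[of "(True, True)"] *[of "(False, True)"] by (simp add: quarter_turn_def)
  moreover have "\<bar>Im w\<bar> \<le> cmod w / 2"
    using *[of "(True, False)"] *[of "(False, False)"] by (simp add: quarter_turn_def)
  ultimately have "(Re w)\<^sup>2 \<le> (cmod w / 2)\<^sup>2" "(Im w)\<^sup>2 \<le> (cmod w / 2)\<^sup>2"
    by (simp_all add: abs_le_square_iff[symmetric])
  then have "(cmod w)\<^sup>2 \<le> 2 * (cmod w / 2)\<^sup>2" unfolding cmod_power2 by linarith
  then show False using assms by (simp add: power2_eq_square)
qed

lemma norm_quarter_turn: "cmod (quarter_turn d) = 1"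
  by (simp add: quarter_turn_def norm_mult)

lemma conf_cell_pairwise:
  fixes Z :: "(complex ^ 'n) set"
  assumes "\<And>i j. i \<noteq> j \<Longrightarrow> \<exists>d. \<forall>z\<in>Z. 0 < Re (quarter_turn d * (z $ i - z $ j))"
  shows "\<exists>\<alpha>. Z \<subseteq> conf_cell \<alpha>"
proof -
  have "\<forall>i j. \<exists>d. i \<noteq> j \<longrightarrow> (\<forall>z\<in>Z. 0 < Re (quarter_turn d * (z $ i - z $ j)))" using assms by blast
  then obtain \<alpha> where "\<And>i j. i \<noteq> j \<Longrightarrow> \<forall>z\<in>Z. 0 < Re (quarter_turn (\<alpha> i j) * (z $ i - z $ j))"
    by metis
  then show ?thesis unfolding conf_cell_def by blast
qed

lemma Union_conf_cells: "\<Union>(range conf_cell) = {z :: complex ^ 'n. inj (($) z)}"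
proof (intro equalityI subsetI)
  fix z :: "complex ^ 'n" assume "z \<in> \<Union>(range conf_cell)"
  then obtain \<alpha> where \<alpha>: "z \<in> conf_cell \<alpha>" by blast
  have "z $ i \<noteq> z $ j" if "i \<noteq> j" for i j
    using \<alpha> that unfolding conf_cell_def by fastforce
  then show "z \<in> {z. inj (($) z)}" by (auto simp: inj_def)
next
  fix z :: "complex ^ 'n" assume "z \<in> {z. inj (($) z)}"
  then have "\<exists>d. 0 < Re (quarter_turn d * (z $ i - z $ j))" if "i \<noteq> j" for i j
  proof -
    have "z $ i - z $ j \<noteq> 0" using \<open>z \<in> _\<close> that by (auto simp: inj_def)
    from quarter_turn_large_Re[OF this] obtain d
      where d: "cmod (z $ i - z $ j) / 2 < Re (quarter_turn d * (z $ i - z $ j))" by blast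
    moreover have "0 \<le> cmod (z $ i - z $ j) / 2" by simp
    ultimately show ?thesis by (meson le_less_trans)
  qed
  then have "\<exists>\<alpha>. {z} \<subseteq> conf_cell \<alpha>" by (intro conf_cell_pairwise) auto
  then show "z \<in> \<Union>(range conf_cell)" by auto
qed

lemma conf_cell_Inter:
  "conf_cell \<alpha> = (\<Inter>i. \<Inter>j\<in>-{i}. {z. 0 < Re (quarter_turn (\<alpha> i j) * (z $ i - z $ j))})"
  by (auto simp: conf_cell_def)

lemma open_conf_cell: "open (conf_cell \<alpha>)"
  unfolding conf_cell_Inter
  by (intro open_INT finite_class.finite ballI finite_subset[OF subset_UNIV] open_Collect_less continuous_intros)

lemma convex_conf_cell:
  fixes \<alpha> :: "'n::finite \<Rightarrow> 'n \<Rightarrow> bool \<times> bool"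
  shows "convex (conf_cell \<alpha>)"
proof (rule convexI)
  fix x y :: "complex ^ 'n" and u v :: real
  assume *: "x \<in> conf_cell \<alpha>" "y \<in> conf_cell \<alpha>" and uv: "0 \<le> u" "0 \<le> v" "u + v = 1"
  show "u *\<^sub>R x + v *\<^sub>R y \<in> conf_cell \<alpha>"
    unfolding conf_cell_def
  proof (intro CollectI allI impI)
    fix i j :: 'n assume "i \<noteq> j"
    define q where "q = quarter_turn (\<alpha> i j)"
    have p: "0 < Re (q * (x $ i - x $ j))" "0 < Re (q * (y $ i - y $ j))"
      using * \<open>i \<noteq> j\<close> by (auto simp: conf_cell_def q_def)
    have "q * ((u *\<^sub>R x + v *\<^sub>R y) $ i - (u *\<^sub>R x + v *\<^sub>R y) $ j)
        = u *\<^sub>R (q * (x $ i - x $ j)) + v *\<^sub>R (q * (y $ i - y $ j))"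
      by (simp add: algebra_simps)
    moreover have "0 < u * Re (q * (x $ i - x $ j)) + v * Re (q * (y $ i - y $ j))"
      using p uv by (cases "u = 0") (auto intro: add_pos_nonneg)
    ultimately show "0 < Re (q * ((u *\<^sub>R x + v *\<^sub>R y) $ i - (u *\<^sub>R x + v *\<^sub>R y) $ j))" by simp
  qed
qed

section \<open>Cutting paths into convex pieces\<close>

text \<open>Joined subpaths agree with the longer subpath only up to reparametrisation; the rule
  \<open>homotopic\<close> of \<open>convex_chain\<close> absorbs the difference.\<close>

lemma convex_chain_subpath_join:
  assumes "path g" "path_image g \<subseteq> \<Union>\<C>" "a \<in> {0..1}" "b \<in> {0..1}" "c \<in> {0..1}"
    "convex_chain \<C> j (subpath a b g)" "convex_chain \<C> k (subpath b c g)"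
  shows "convex_chain \<C> (j + k) (subpath a c g)"
proof -
  have "convex_chain \<C> (j + k) (subpath a b g +++ subpath b c g)"
    using assms by (intro convex_chain.join) auto
  then show ?thesis
    using homotopic_join_subpaths[OF assms(1-5)] convex_chain.homotopic by blast
qed

lemma convex_chain_subpath_piece:
  assumes "path g" "C \<in> \<C>" "0 \<le> a" "a \<le> b" "b \<le> 1" "g ` {a..b} \<subseteq> C"
  shows "convex_chain \<C> 1 (subpath a b g)"
  using assms by (intro convex_chain.piece[of C]) (auto simp: path_image_subpath)

text \<open>The times that an affine motion spends in a convex cell form an interval, so a segment
  never returns to a cell that it has left. Each cut strikes one cell off the list of those still to
  be visited, and the induction is on the length of that list.\<close>

lemma linepath_convex_chain:
  fixes x y :: "'b::real_normed_vector"
  assumes F: "finite \<F>" "\<F> \<subseteq> \<C>" and C: "\<And>C. C \<in> \<C> \<Longrightarrow> open C \<and> convex C"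
    and image: "closed_segment x y \<subseteq> \<Union>\<C>"
    and a: "0 \<le> a" "a \<le> 1" and cover: "linepath x y ` {a..1} \<subseteq> \<Union>\<F>"
  shows "\<exists>k\<le>card \<F>. convex_chain \<C> k (subpath a 1 (linepath x y))"
  using F a cover
proof (induction "card \<F>" arbitrary: \<F> a rule: less_induct)
  case less
  define g where "g = linepath x y"
  have g: "path g" "path_image g \<subseteq> \<Union>\<C>" using image by (auto simp: g_def)
  define T where "T C = g -` C" for C
  have openT: "open (T C)" if "C \<in> \<C>" for C
    unfolding T_def g_def linepath_def using C[OF that]
    by (intro open_vimage) (auto intro!: continuous_intros)
  have intT: "t \<in> T C" if "C \<in> \<C>" "u \<in> T C" "v \<in> T C" "u \<le> t" "t \<le> v" for C u v t
  proof (cases "u = v")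
    case False
    define s where "s = (t - u) / (v - u)"
    have uv: "v - u > 0" using that False by simp
    then have "s * (v - u) = t - u" by (simp add: s_def)
    then have st: "t = (1 - s) * u + s * v" by (simp add: algebra_simps)
    have s: "0 \<le> s" "s \<le> 1" unfolding s_def using that uv by simp_all
    have "g ((1 - s) * u + s * v) = (1 - s) *\<^sub>R g u + s *\<^sub>R g v"
      unfolding g_def linepath_def by (simp add: algebra_simps)
    then have "g t = (1 - s) *\<^sub>R g u + s *\<^sub>R g v" unfolding st[symmetric] .
    then show ?thesis
      using C[OF that(1)] that(2,3) s by (auto simp: T_def convex_alt)
  qed (use that in auto)
  obtain A where A: "A \<in> \<F>" "a \<in> T A"
  proof -
    have "linepath x y a \<in> \<Union>\<F>" using less.prems by (intro subsetD[OF less.prems(5)] imageI) auto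
    then show ?thesis using that by (auto simp: T_def g_def)
  qed
  have AC: "A \<in> \<C>" using A less.prems by auto
  show ?case
  proof (cases "1 \<in> T A")
    case True
    then have "convex_chain \<C> 1 (subpath a 1 g)"
      using intT[OF AC A(2)] A less.prems
      by (intro convex_chain_subpath_piece[of _ A]) (auto simp: T_def g_def)
    moreover have "1 \<le> card \<F>" using A less.prems by (simp add: Suc_le_eq card_gt_0_iff) blast
    ultimately show ?thesis unfolding g_def by blast
  next
    case False
    define S where "S = {t\<in>T A. a \<le> t}"
    \<comment> \<open>\<open>T A\<close> is an interval of the whole real line. It contains
      \<open>a\<close> but not 1, so it cannot reach beyond 1.\<close>
    have bS: "t \<le> 1" if "t \<in> S" for t
      using intT[OF AC A(2), of t 1] that False less.prems unfolding S_def by force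
    then have bdd: "bdd_above S" by (rule bdd_aboveI)
    have aS: "a \<in> S" using A by (simp add: S_def)
    define b where "b = Sup S"
    have ab: "a \<le> b" unfolding b_def using aS bdd by (intro cSup_upper)
    have b1: "b \<le> 1" unfolding b_def using aS bS by (intro cSup_least) auto
    have upper: "t \<le> b" if "t \<in> S" for t unfolding b_def using that bdd by (intro cSup_upper)
    have bA: "b \<notin> T A"
    proof
      assume "b \<in> T A"
      then obtain e where e: "e > 0" "ball b e \<subseteq> T A" using openT[OF AC] open_contains_ball by blast
      then have "b + e/2 \<in> S" using ab by (auto simp: S_def dist_real_def subset_eq)
      then show False using upper e by fastforce
    qed
    obtain B where B: "B \<in> \<F>" "b \<in> T B" 
    proof -
      have "linepath x y b \<in> \<Union>\<F>" using ab b1 by (intro subsetD[OF less.prems(5)] imageI) auto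
      then show ?thesis using that by (auto simp: T_def g_def)
    qed
    then have BC: "B \<in> \<C>" using less.prems by auto
    have BA: "B \<noteq> A" using bA B by auto
    obtain e where e: "e > 0" "ball b e \<subseteq> T B" using openT[OF BC] B open_contains_ball by blast
    \<comment> \<open>The cut is made slightly before the exit time \<open>b\<close>, at a time
      \<open>c\<close> that still belongs to \<open>A\<close> and from which \<open>B\<close> covers
      everything up to \<open>b\<close>. After \<open>b\<close> the segment is outside
      \<open>A\<close>, so the other cells cover all of it from \<open>c\<close> on.\<close>
    have "b - e < Sup S" using e by (simp add: b_def)
    then obtain c where c: "c \<in> S" "b - e < c" using less_cSup_iff[OF _ bdd] aS by blast
    have cb: "c \<le> b" "a \<le> c" "c \<in> T A" using upper c by (auto simp: S_def)
    have "g ` {c..1} \<subseteq> \<Union>(\<F> - {A})"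
    proof
      fix w assume "w \<in> g ` {c..1}"
      then obtain t where t: "w = g t" "c \<le> t" "t \<le> 1" by auto
      show "w \<in> \<Union>(\<F> - {A})"
      proof (cases "t \<le> b")
        case True
        then have "t \<in> T B" using e c t by (auto simp: dist_real_def subset_eq)
        then show ?thesis using t BA B by (auto simp: T_def)
      next
        case False
        then have "t \<notin> T A" using upper[of t] ab by (auto simp: S_def)
        moreover have "g t \<in> \<Union>\<F>" unfolding g_def using t cb by (intro subsetD[OF less.prems(5)] imageI) auto
        ultimately show ?thesis using t by (auto simp: T_def)
      qed
    qed
    moreover have "card (\<F> - {A}) < card \<F>" by (rule card_Diff1_less[OF less.prems(1) A(1)])
    ultimately obtain k where k: "k \<le> card (\<F> - {A})" "convex_chain \<C> k (subpath c 1 g)"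
      using less.hyps[of "\<F> - {A}" c] less.prems cb b1 by (auto simp: g_def)
    have "convex_chain \<C> 1 (subpath a c g)"
      using intT[OF AC A(2) cb(3)] AC less.prems cb b1 g
      by (intro convex_chain_subpath_piece[of _ A]) (auto simp: T_def)
    then have "convex_chain \<C> (1 + k) (subpath a 1 g)"
      using k g less.prems cb b1 by (intro convex_chain_subpath_join[of _ _ a c 1]) auto
    moreover have "1 + k \<le> card \<F>" using k \<open>card (\<F> - {A}) < card \<F>\<close> by linarith
    ultimately show ?thesis unfolding g_def by blast
  qed
qed

text \<open>By the intermediate value theorem a cut can be placed each time the integral has grown
  by another third. With total integral \<open>V\<close> this leaves at most
  \<open>floor (3 * V) + 1\<close> intervals.\<close>

lemma integral_cut_convex_chain:
  fixes g :: "real \<Rightarrow> 'b::real_normed_vector"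
  assumes g: "path g" "path_image g \<subseteq> \<Union>\<C>" and f: "continuous_on {0..1} f" "\<And>t. t \<in> {0..1} \<Longrightarrow> f t \<ge> 0"
    and piece: "\<And>s t. 0 \<le> s \<Longrightarrow> s \<le> t \<Longrightarrow> t \<le> 1 \<Longrightarrow> integral {s..t} f \<le> 1/3 \<Longrightarrow> \<exists>C\<in>\<C>. g ` {s..t} \<subseteq> C"
  shows "\<exists>k. convex_chain \<C> k g \<and> real k \<le> 3 * integral {0..1} f + 1"
proof -
  have cont: "continuous_on {s..t} f" if "0 \<le> s" "t \<le> 1" for s t
    using f(1) by (rule continuous_on_subset) (use that in auto)
  have int: "f integrable_on {s..t}" if "0 \<le> s" "t \<le> 1" for s t
    using cont[OF that] by (rule integrable_continuous_interval)
  have *: "\<exists>k\<le>Suc n. convex_chain \<C> k (subpath s 1 g)"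
    if "0 \<le> s" "s \<le> 1" "integral {s..1} f \<le> real (Suc n) / 3" for n s
    using that
  proof (induction n arbitrary: s)
    case 0
    then obtain C where "C \<in> \<C>" "g ` {s..1} \<subseteq> C" using piece[of s 1] by auto
    then show ?case using 0 g convex_chain_subpath_piece[of g C \<C> s 1] by auto
  next
    case (Suc n)
    show ?case
    proof (cases "integral {s..1} f \<le> 1/3")
      case True
      then obtain C where "C \<in> \<C>" "g ` {s..1} \<subseteq> C" using piece[of s 1] Suc by auto
      then show ?thesis using Suc g convex_chain_subpath_piece[of g C \<C> s 1] by auto
    next
      case False
      have "continuous_on {s..1} (\<lambda>t. integral {s..t} f)"
        using Suc by (intro indefinite_integral_continuous_1 int) auto
      moreover have "integral {s..s} f \<le> 1/3" by simp
      ultimately obtain t where t: "s \<le> t" "t \<le> 1" "integral {s..t} f = 1/3"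
        using IVT'[of "\<lambda>t. integral {s..t} f" s "1/3" 1] False Suc by auto
      have "integral {s..t} f + integral {t..1} f = integral {s..1} f"
        using t Suc by (intro Henstock_Kurzweil_Integration.integral_combine int) auto
      then have "integral {t..1} f \<le> real (Suc n) / 3" using Suc t by (simp add: field_simps)
      then obtain k where k: "k \<le> Suc n" "convex_chain \<C> k (subpath t 1 g)"
        using Suc.IH[of t] Suc.prems t by (meson order_trans)
      obtain C where "C \<in> \<C>" "g ` {s..t} \<subseteq> C" using piece[of s t] t Suc by auto
      then have "convex_chain \<C> 1 (subpath s t g)"
        using Suc t g by (intro convex_chain_subpath_piece[of g C \<C>]) auto
      then have "convex_chain \<C> (1 + k) (subpath s 1 g)"
        using k g t Suc by (intro convex_chain_subpath_join[of _ _ s t 1]) auto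
      then show ?thesis using k by (intro exI[of _ "1 + k"]) auto
    qed
  qed
  let ?V = "integral {0..1} f"
  have V: "?V \<ge> 0" using f int by (intro integral_nonneg) auto
  obtain k where k: "k \<le> Suc (nat \<lfloor>3 * ?V\<rfloor>)" "convex_chain \<C> k (subpath 0 1 g)"
  proof -
    have "?V \<le> real (Suc (nat \<lfloor>3 * ?V\<rfloor>)) / 3" using V by simp linarith
    then show ?thesis using *[of 0 "nat \<lfloor>3 * ?V\<rfloor>"] that by auto
  qed
  have "real k \<le> real (Suc (nat \<lfloor>3 * ?V\<rfloor>))" using k(1) by (simp only: of_nat_le_iff)
  also have "\<dots> \<le> 3 * ?V + 1" using V by simp
  finally show ?thesis using k(2) by auto
qed

text \<open>
  The supremum M of the deviation satisfies \<open>M \<le> (cmod (w s) + M) / 3\<close>, so it can be absorbed.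
\<close>

lemma small_log_variation:
  fixes w w' :: "real \<Rightarrow> complex"
  assumes "s \<le> t" and w: "\<And>u. u \<in> {s..t} \<Longrightarrow> (w has_vector_derivative w' u) (at u within {s..t})"
    and f: "continuous_on {s..t} f" "\<And>u. u \<in> {s..t} \<Longrightarrow> 0 \<le> f u"
    and le: "\<And>u. u \<in> {s..t} \<Longrightarrow> cmod (w' u) \<le> f u * cmod (w u)"
    and small: "integral {s..t} f \<le> 1/3" and u: "u \<in> {s..t}"
  shows "cmod (w u - w s) \<le> cmod (w s) / 2"
proof -
  have cw: "continuous_on {s..t} w"
    using w by (meson continuous_on_eq_continuous_within has_vector_derivative_continuous)
  obtain v where v: "v \<in> {s..t}" "\<And>u. u \<in> {s..t} \<Longrightarrow> cmod (w u - w s) \<le> cmod (w v - w s)"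
    using continuous_attains_sup[of "{s..t}" "\<lambda>u. cmod (w u - w s)"] \<open>s \<le> t\<close>
      continuous_on_norm[OF continuous_on_diff[OF cw continuous_on_const[of _ "w s"]]]
    by (metis atLeastAtMost_iff compact_Icc empty_iff order_refl)
  define M where "M = cmod (w v - w s)"
  have sub: "{s..v} \<subseteq> {s..t}" using v by auto
  have fv: "continuous_on {s..v} f" using f(1) sub by (rule continuous_on_subset)
  have hi: "(w' has_integral (w v - w s)) {s..v}"
    using v(1) sub has_vector_derivative_within_subset[OF w sub]
    by (intro fundamental_theorem_of_calculus) auto
  have b: "cmod (w u) \<le> cmod (w s) + M" if "u \<in> {s..t}" for u
    using v(2)[OF that] norm_triangle_ineq[of "w s" "w u - w s"] by (simp add: M_def)
  have "M = cmod (integral {s..v} w')" using hi by (simp add: M_def integral_unique)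
  also have "\<dots> \<le> integral {s..v} (\<lambda>u. f u * (cmod (w s) + M))"
  proof (rule integral_norm_bound_integral)
    show "w' integrable_on {s..v}" using hi by blast
    show "(\<lambda>u. f u * (cmod (w s) + M)) integrable_on {s..v}"
      using fv by (intro integrable_continuous_interval continuous_intros)
    fix u assume "u \<in> {s..v}"
    then have "u \<in> {s..t}" using sub by auto
    then show "cmod (w' u) \<le> f u * (cmod (w s) + M)"
      using le[of u] f(2)[of u] mult_left_mono[OF b[of u], of "f u"] by linarith
  qed
  also have "\<dots> = integral {s..v} f * (cmod (w s) + M)" by simp
  also have "\<dots> \<le> 1/3 * (cmod (w s) + M)"
  proof (rule mult_right_mono)
    have "integral {s..v} f \<le> integral {s..t} f"
      using sub f fv by (intro integral_subset_le integrable_continuous_interval) auto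
    then show "integral {s..v} f \<le> 1/3" using small by simp
    show "0 \<le> cmod (w s) + M" by (simp add: M_def)
  qed
  finally have "M \<le> cmod (w s) / 2" by simp
  then show ?thesis using v(2)[OF u] by (simp add: M_def)
qed

lemma quarter_turn_stays:
  assumes "cmod (v - w) \<le> cmod w / 2" "cmod w / 2 < Re (quarter_turn d * w)"
  shows "0 < Re (quarter_turn d * v)"
proof -
  have "quarter_turn d * v = quarter_turn d * w + quarter_turn d * (v - w)" by (simp add: algebra_simps)
  then have "Re (quarter_turn d * v) = Re (quarter_turn d * w) + Re (quarter_turn d * (v - w))" by simp
  moreover have "\<bar>Re (quarter_turn d * (v - w))\<bar> \<le> cmod (quarter_turn d * (v - w))" by (rule abs_Re_le_cmod)
  moreover have "\<dots> = cmod (v - w)" by (simp add: norm_mult norm_quarter_turn)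
  ultimately show ?thesis using assms by linarith
qed

text \<open>\<open>f\<close> bounds the logarithmic speed of every difference. While its integral is
  at most 1/3, each difference moves by at most half of its initial length, so the half plane found
  at the initial time \<open>s\<close> still contains it throughout \<open>{s..t}\<close>.\<close>

lemma moving_points_convex_chain:
  fixes z :: "real \<Rightarrow> complex ^ 'n" and w' :: "'n \<Rightarrow> 'n \<Rightarrow> real \<Rightarrow> complex"
  assumes z: "path z" "\<And>t. t \<in> {0..1} \<Longrightarrow> inj (($) (z t))"
    and w': "\<And>i j t. t \<in> {0..1} \<Longrightarrow> i \<noteq> j \<Longrightarrow> ((\<lambda>t. z t $ i - z t $ j) has_vector_derivative w' i j t) (at t within {0..1})"
    and f: "continuous_on {0..1} f" "\<And>t. t \<in> {0..1} \<Longrightarrow> 0 \<le> f t"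
    and le: "\<And>i j t. t \<in> {0..1} \<Longrightarrow> i \<noteq> j \<Longrightarrow> cmod (w' i j t) \<le> f t * cmod (z t $ i - z t $ j)"
  shows "\<exists>k. convex_chain (range conf_cell) k z \<and> real k \<le> 3 * integral {0..1} f + 1"
proof (rule integral_cut_convex_chain[OF z(1) _ f])
  show "path_image z \<subseteq> \<Union>(range conf_cell)" unfolding Union_conf_cells using z(2) by (auto simp: path_image_def)
  fix s t :: real assume st: "0 \<le> s" "s \<le> t" "t \<le> 1" and small: "integral {s..t} f \<le> 1/3"
  have sub: "{s..t} \<subseteq> {0..1}" using st by auto
  have "\<exists>d. \<forall>x\<in>z ` {s..t}. 0 < Re (quarter_turn d * (x $ i - x $ j))" if "i \<noteq> j" for i j
  proof -
    have "z s $ i - z s $ j \<noteq> 0" using z(2)[of s] st that by (auto simp: inj_def)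
    from quarter_turn_large_Re[OF this] obtain d
      where d: "cmod (z s $ i - z s $ j) / 2 < Re (quarter_turn d * (z s $ i - z s $ j))" by blast
    have "cmod ((z u $ i - z u $ j) - (z s $ i - z s $ j)) \<le> cmod (z s $ i - z s $ j) / 2"
      if u: "u \<in> {s..t}" for u
      using small_log_variation[of s t "\<lambda>t. z t $ i - z t $ j" "w' i j" f u] st small u \<open>i \<noteq> j\<close> sub
        has_vector_derivative_within_subset[OF w' sub] le f(2) continuous_on_subset[OF f(1) sub]
      by blast
    then show ?thesis using quarter_turn_stays d by blast
  qed
  from conf_cell_pairwise[OF this] show "\<exists>C\<in>range conf_cell. z ` {s..t} \<subseteq> C" by blast
qed

section \<open>Integrals over the sphere in the affine chart\<close>

lemma nn_integral_even_le:
  fixes f :: "real \<Rightarrow> ennreal"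
  assumes [measurable]: "f \<in> borel_measurable borel"
  shows "(\<integral>\<^sup>+x. f \<bar>x\<bar> \<partial>lborel) \<le> 2 * (\<integral>\<^sup>+x. f x * indicator {0..} x \<partial>lborel)"
proof -
  have "(\<integral>\<^sup>+x. f \<bar>x\<bar> \<partial>lborel) \<le> (\<integral>\<^sup>+x. f x * indicator {0..} x + f (-x) * indicator {0..} (-x) \<partial>lborel)"
    by (intro nn_integral_mono) (auto simp: indicator_def)
  also have "\<dots> = (\<integral>\<^sup>+x. f x * indicator {0..} x \<partial>lborel) + (\<integral>\<^sup>+x. f (-x) * indicator {0..} (-x) \<partial>lborel)"
    by (intro nn_integral_add) auto
  also have "(\<integral>\<^sup>+x. f (-x) * indicator {0..} (-x) \<partial>lborel) = (\<integral>\<^sup>+x. f x * indicator {0..} x \<partial>lborel)"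
    using nn_integral_real_affine[of "\<lambda>x. f x * indicator {0..} x" "-1" 0] by simp
  finally show ?thesis by (simp add: mult_2)
qed

lemma nn_integral_complex_prod:
  fixes f :: "real \<Rightarrow> ennreal"
  assumes [measurable]: "f \<in> borel_measurable borel"
  shows "(\<integral>\<^sup>+z. f (Re z) * f (Im z) \<partial>lborel) = (\<integral>\<^sup>+x. f x \<partial>lborel) * (\<integral>\<^sup>+x. f x \<partial>lborel)"
proof -
  have "(1::complex) \<noteq> \<i>" by (simp add: complex_eq_iff)
  then show ?thesis
    using nn_integral_lborel_prod[where 'a=complex and f="\<lambda>_. f"]
    by (simp add: Basis_complex_def inner_complex_def)
qed

lemma nn_integral_powr_decay_real:
  assumes "a > 1" shows "(\<integral>\<^sup>+x. ennreal ((1 + \<bar>x::real\<bar>) powr (-a)) \<partial>lborel) < \<infinity>"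
proof -
  let ?F = "\<lambda>x::real. - ((1 + x) powr (1 - a) / (a - 1))"
  have "(\<integral>\<^sup>+x. ennreal ((1 + x) powr (-a)) * indicator {0..} x \<partial>lborel) = ennreal (0 - ?F 0)"
  proof (rule nn_integral_FTC_atLeast)
    fix x :: real assume "0 \<le> x"
    then show "(?F has_real_derivative (1 + x) powr (-a)) (at x)"
      using assms by (auto intro!: derivative_eq_intros simp: divide_simps) (simp add: algebra_simps)
  next
    have "filterlim (\<lambda>x::real. 1 + x) at_top at_top" by (rule filterlim_tendsto_add_at_top[OF tendsto_const filterlim_ident])
    then have "((\<lambda>x::real. (1 + x) powr (1 - a)) \<longlongrightarrow> 0) at_top"
      using assms by (intro tendsto_neg_powr) auto
    from tendsto_minus[OF tendsto_divide[OF this tendsto_const[of "a - 1"]]]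
    show "(?F \<longlongrightarrow> 0) at_top" using assms by simp
  qed auto
  then have fin: "2 * (\<integral>\<^sup>+x. ennreal ((1 + x) powr (-a)) * indicator {0..} x \<partial>lborel) < \<infinity>"
    by (simp add: ennreal_mult_less_top)
  have "(\<integral>\<^sup>+x. ennreal ((1 + \<bar>x::real\<bar>) powr (-a)) \<partial>lborel)
      \<le> 2 * (\<integral>\<^sup>+x. ennreal ((1 + x) powr (-a)) * indicator {0..} x \<partial>lborel)"
    by (rule nn_integral_even_le[of "\<lambda>x. ennreal ((1 + x) powr (-a))"]) simp
  with fin show ?thesis by (rule le_less_trans[rotated])
qed

text \<open>The square of \<open>1 + cmod z\<close> dominates
  \<open>(1 + \<bar>Re z\<bar>) * (1 + \<bar>Im z\<bar>)\<close>. The integral is thus bounded by a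
  product of two one-dimensional ones with exponent \<open>s/2 > 1\<close>, which takes the place of
  polar coordinates.\<close>

lemma nn_integral_powr_decay_complex:
  assumes "s > 2" shows "(\<integral>\<^sup>+z. ennreal ((1 + cmod z) powr (-s)) \<partial>lborel) < \<infinity>"
proof -
  let ?f = "\<lambda>x::real. ennreal ((1 + \<bar>x\<bar>) powr (-(s/2)))"
  have "(\<integral>\<^sup>+z. ennreal ((1 + cmod z) powr (-s)) \<partial>lborel) \<le> (\<integral>\<^sup>+z. ?f (Re z) * ?f (Im z) \<partial>lborel)"
  proof (rule nn_integral_mono)
    fix z :: complex
    have "(1 + \<bar>Re z\<bar>) * (1 + \<bar>Im z\<bar>) \<le> (1 + cmod z)\<^sup>2"
      unfolding power2_eq_square using abs_Re_le_cmod[of z] abs_Im_le_cmod[of z] by (intro mult_mono) auto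
    then have "((1 + cmod z)\<^sup>2) powr (-(s/2)) \<le> ((1 + \<bar>Re z\<bar>) * (1 + \<bar>Im z\<bar>)) powr (-(s/2))"
      using assms by (intro powr_mono2') (auto intro!: mult_pos_pos)
    moreover have "((1 + cmod z)\<^sup>2) powr (-(s/2)) = (1 + cmod z) powr (-s)"
    proof -
      have "1 + cmod z > 0" by (simp add: add_pos_nonneg)
      then have "(1 + cmod z)\<^sup>2 = (1 + cmod z) powr 2" by simp
      then show ?thesis by (simp only: powr_powr) simp
    qed
    ultimately show "ennreal ((1 + cmod z) powr (-s)) \<le> ?f (Re z) * ?f (Im z)"
      by (simp add: powr_mult ennreal_mult[symmetric])
  qed
  also have "\<dots> = (\<integral>\<^sup>+x. ?f x \<partial>lborel) * (\<integral>\<^sup>+x. ?f x \<partial>lborel)"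
    by (rule nn_integral_complex_prod) simp
  also have "\<dots> < \<infinity>"
    using nn_integral_powr_decay_real[of "s/2"] assms by (simp add: ennreal_mult_less_top)
  finally show ?thesis .
qed

text \<open>The infinite value at 0 leaves the integral unchanged, but it makes a product of two
  such functions dominate \<open>1 / cmod w\<close> on the coordinate axes as well.\<close>

lemma nn_integral_inverse_sqrt:
  assumes "R > 0"
  shows "(\<integral>\<^sup>+x. (if x = (0::real) then \<infinity> else ennreal (\<bar>x\<bar> powr (-1/2))) * indicator {-R..R} x \<partial>lborel)
    \<le> ennreal (4 * sqrt R)"
proof -
  have "(\<integral>\<^sup>+x. (if x = (0::real) then \<infinity> else ennreal (\<bar>x\<bar> powr (-1/2))) * indicator {-R..R} x \<partial>lborel)
      = (\<integral>\<^sup>+x. ennreal (\<bar>x\<bar> powr (-1/2)) * indicator {..R} \<bar>x\<bar> \<partial>lborel)"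
  proof (rule nn_integral_cong_AE)
    show "AE x in lborel. (if x = (0::real) then \<infinity> else ennreal (\<bar>x\<bar> powr (-1/2))) * indicator {-R..R} x
        = ennreal (\<bar>x\<bar> powr (-1/2)) * indicator {..R} \<bar>x\<bar>"
      using AE_lborel_singleton[of "0::real"] by eventually_elim (auto split: split_indicator)
  qed
  also have "\<dots> \<le> 2 * (\<integral>\<^sup>+x. (ennreal (x powr (-1/2)) * indicator {..R} x) * indicator {0..} x \<partial>lborel)"
    by (rule nn_integral_even_le[of "\<lambda>x. ennreal (x powr (-1/2)) * indicator {..R} x"]) simp
  also have "(\<integral>\<^sup>+x. (ennreal (x powr (-1/2)) * indicator {..R} x) * indicator {0..} x \<partial>lborel)
      = (\<integral>\<^sup>+x. ennreal (indicator {0..R} x * x powr (-1/2)) \<partial>lborel)"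
    by (intro nn_integral_cong) (auto simp: indicator_def)
  also have "\<dots> = ennreal (2 * sqrt R)"
  proof -
    have "((\<lambda>x. x powr (-1/2)) has_integral (R powr (-1/2 + 1) / (-1/2 + 1))) {0..R}"
      using assms by (intro has_integral_powr_from_0) auto
    then have "((\<lambda>x. x powr (-1/2)) has_integral (2 * sqrt R)) {0..R}"
      using assms by (simp add: powr_half_sqrt mult.commute)
    then show ?thesis
      by (intro nn_integral_has_integral_lebesgue) auto
  qed
  also have "2 * ennreal (2 * sqrt R) = ennreal (4 * sqrt R)"
    using assms by (simp add: ennreal_mult'[symmetric] flip: ennreal_numeral)
  finally show ?thesis .
qed

text \<open>The square of \<open>cmod w\<close> dominates
  \<open>\<bar>Re w\<bar> * \<bar>Im w\<bar>\<close>, so the kernel is at most a product of two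
  inverse square roots. The disc lies in the square of half side \<open>R\<close>, and each factor
  integrates to at most \<open>4 * sqrt R\<close>.\<close>

lemma nn_integral_inverse_norm:
  assumes "R > 0"
  shows "(\<integral>\<^sup>+w. ennreal (1 / cmod (z - w)) * indicator (cball z R) w \<partial>lborel) \<le> ennreal (16 * R)"
proof -
  let ?f = "\<lambda>x::real. (if x = 0 then \<infinity> else ennreal (\<bar>x\<bar> powr (-1/2))) * indicator {-R..R} x"
  have "(\<integral>\<^sup>+w. ennreal (1 / cmod (z - w)) * indicator (cball z R) w \<partial>lborel)
      = (\<integral>\<^sup>+w. ennreal (1 / cmod w) * indicator (cball 0 R) w \<partial>lborel)"
  proof -
    have "lborel = distr lborel borel (\<lambda>w::complex. z + w)" by (simp add: lborel_distr_plus)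
    then have "(\<integral>\<^sup>+w. ennreal (1 / cmod (z - w)) * indicator (cball z R) w \<partial>lborel) =
      (\<integral>\<^sup>+w. ennreal (1 / cmod (z - w)) * indicator (cball z R) w \<partial>distr lborel borel (\<lambda>w::complex. z + w))"
      by simp
    also have "\<dots> = (\<integral>\<^sup>+w. ennreal (1 / cmod w) * indicator (cball 0 R) w \<partial>lborel)"
      by (subst nn_integral_distr) (auto intro!: nn_integral_cong simp: indicator_def dist_norm)
    finally show ?thesis .
  qed
  also have "\<dots> \<le> (\<integral>\<^sup>+w. ?f (Re w) * ?f (Im w) \<partial>lborel)"
  proof (rule nn_integral_mono)
    fix w :: complex
    show "ennreal (1 / cmod w) * indicator (cball 0 R) w \<le> ?f (Re w) * ?f (Im w)"
    proof (cases "w \<in> cball 0 R")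
      case True
      then have R: "\<bar>Re w\<bar> \<le> R" "\<bar>Im w\<bar> \<le> R" using abs_Re_le_cmod[of w] abs_Im_le_cmod[of w] by auto
      show ?thesis
      proof (cases "Re w = 0 \<or> Im w = 0")
        case True
        then show ?thesis using R assms by (auto simp: indicator_def ennreal_mult_top ennreal_top_mult)
      next
        case False
        have "\<bar>Re w\<bar> * \<bar>Im w\<bar> \<le> cmod w * cmod w"
          using abs_Re_le_cmod[of w] abs_Im_le_cmod[of w] by (intro mult_mono) auto
        then have "(cmod w * cmod w) powr (-1/2) \<le> (\<bar>Re w\<bar> * \<bar>Im w\<bar>) powr (-1/2)"
          using False by (intro powr_mono2') auto
        moreover have "(cmod w * cmod w) powr (-1/2) = 1 / cmod w"
        proof -
          have "(cmod w * cmod w) powr (-1/2) = inverse ((cmod w * cmod w) powr (1/2))"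
            using powr_minus[of "cmod w * cmod w" "1/2"] by simp
          then show ?thesis by (simp add: powr_half_sqrt inverse_eq_divide)
        qed
        ultimately show ?thesis using False R
          by (auto simp: indicator_def powr_mult ennreal_mult[symmetric])
      qed
    qed simp
  qed
  also have "\<dots> = (\<integral>\<^sup>+x. ?f x \<partial>lborel) * (\<integral>\<^sup>+x. ?f x \<partial>lborel)"
    by (rule nn_integral_complex_prod) measurable
  also have "\<dots> \<le> ennreal (4 * sqrt R) * ennreal (4 * sqrt R)"
    using assms by (intro mult_mono nn_integral_inverse_sqrt) auto
  also have "\<dots> = ennreal (16 * R)" using assms by (simp add: ennreal_mult[symmetric])
  finally show ?thesis .
qed

section \<open>The area density against the kernel and against powers of the weight\<close>

abbreviation chart_density :: "complex \<Rightarrow> real" where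
  "chart_density z \<equiv> 2 / (1 + (cmod z)\<^sup>2)\<^sup>2"

text \<open>The factor 8 is the 2 of the density times the 4 obtained by squaring
  \<open>(1 + cmod z)^2 \<le> 2 * (1 + (cmod z)^2)\<close>.\<close>

lemma chart_density_le: "chart_density z \<le> 8 * (1 + cmod z) powr (-4)"
proof -
  have "(1 + cmod z)\<^sup>2 \<le> 2 * (1 + (cmod z)\<^sup>2)"
    using zero_le_power2[of "1 - cmod z"] by (simp add: power2_eq_square algebra_simps)
  then have "((1 + cmod z)\<^sup>2)\<^sup>2 \<le> (2 * (1 + (cmod z)\<^sup>2))\<^sup>2" by (intro power_mono) auto
  then have *: "(1 + cmod z) ^ 4 \<le> 4 * (1 + (cmod z)\<^sup>2)\<^sup>2"
    unfolding power_mult_distrib[of 2] power_mult[symmetric] by simp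
  have p: "1 + cmod z > 0" "1 + (cmod z)\<^sup>2 > 0" by (simp_all add: add_pos_nonneg)
  then have "(1 + cmod z) powr (-4) = 1 / (1 + cmod z) ^ 4"
    by (simp add: powr_minus powr_numeral inverse_eq_divide)
  moreover have "2 / (1 + (cmod z)\<^sup>2)\<^sup>2 \<le> 8 / (1 + cmod z) ^ 4"
    using * p by (simp add: field_simps)
  ultimately show ?thesis by simp
qed

lemma measurable_u0[measurable]: "u0 \<in> borel_measurable borel"
proof -
  have "1 + (cmod z)\<^sup>2 \<noteq> 0" for z :: complex by (simp add: add_nonneg_eq_0_iff)
  moreover have "complex_of_real (1 + (cmod z)\<^sup>2) \<noteq> 0" for z :: complex
    using calculation[of z] by (metis of_real_eq_0_iff)
  ultimately show ?thesis
    unfolding u0_eq[abs_def]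
    by (intro borel_measurable_continuous_onI continuous_intros) (auto simp del: of_real_add)
qed

lemma u0_in_CP1: "u0 z \<in> CP1" by (simp add: CP1_eq_insert)

lemma closed_CP1: "closed CP1" and compact_CP1: "compact CP1"
  unfolding CP1_eq_sphere by auto

lemma CP1_borel[measurable]: "CP1 \<in> sets borel" by (intro borel_closed closed_CP1)

lemma space_dV: "space dV = CP1" by (simp add: dV_def)

lemma sets_dV: "sets dV = sets (restrict_space borel CP1)"
  unfolding dV_def by (rule sets_restrict_space_cong) simp

lemma measurable_dV_iff: "f \<in> measurable dV N \<longleftrightarrow> f \<in> measurable (restrict_space borel CP1) N"
  using sets_dV by (rule measurable_cong_sets[THEN eqset_imp_iff]) simp

lemma continuous_on_measurable_dV: "continuous_on CP1 f \<Longrightarrow> f \<in> borel_measurable dV"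
  unfolding measurable_dV_iff by (rule borel_measurable_continuous_on_restrict)

text \<open>As a push-forward under \<open>u0\<close> the measure gives no mass to the point at
  infinity, so the chart computes every integral.\<close>

lemma nn_integral_dV:
  assumes f: "f \<in> borel_measurable dV"
  shows "(\<integral>\<^sup>+y. f y \<partial>dV) = (\<integral>\<^sup>+z. ennreal (chart_density z) * f (u0 z) \<partial>lborel)"
proof -
  have [measurable]: "(\<lambda>y. f y * indicator CP1 y) \<in> borel_measurable borel"
    using f unfolding measurable_dV_iff
    by (subst (asm) borel_measurable_restrict_space_iff_ennreal) (auto simp: mult.commute)
  have "(\<integral>\<^sup>+y. f y \<partial>dV)
      = (\<integral>\<^sup>+y. f y * indicator CP1 y \<partial>distr (density lborel (\<lambda>z. ennreal (chart_density z))) borel u0)"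
    unfolding dV_def by (rule nn_integral_restrict_space) simp
  also have "\<dots> = (\<integral>\<^sup>+z. f (u0 z) * indicator CP1 (u0 z) \<partial>density lborel (\<lambda>z. ennreal (chart_density z)))"
    by (rule nn_integral_distr) auto
  also have "\<dots> = (\<integral>\<^sup>+z. ennreal (chart_density z) * (f (u0 z) * indicator CP1 (u0 z)) \<partial>lborel)"
    by (rule nn_integral_density) (auto intro: measurable_compose[OF measurable_u0])
  finally show ?thesis by (simp add: u0_in_CP1)
qed

lemma one_le_one_plus_cmod: "1 \<le> 1 + cmod z" "0 < 1 + cmod z"
  by (simp_all add: add_pos_nonneg)

lemma chart_density_pos: "0 < chart_density z"
proof -
  have "0 < 1 + (cmod z)\<^sup>2" by (simp add: add_pos_nonneg)
  then show ?thesis by simp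
qed

text \<open>The plane is split at distance \<open>R\<close> from \<open>z\<close>, a quarter of
  \<open>1 + cmod z\<close>. Outside the disc the kernel is at most \<open>4 / (1 + cmod z)\<close>.
  Inside, \<open>1 + cmod w\<close> is at least three quarters of \<open>1 + cmod z\<close>, so the
  density is at most \<open>26 / (1 + cmod z)^4\<close>, because \<open>8 * (4/3)^4 < 26\<close>.
  Together with the disc integral \<open>16 * R\<close> this gives
  \<open>104 / (1 + cmod z)^3\<close>.\<close>

lemma kernel_bound:
  "(\<integral>\<^sup>+w. ennreal (chart_density w * (1 / cmod (z - w))) \<partial>lborel)
    \<le> (4 * (\<integral>\<^sup>+w. ennreal (chart_density w) \<partial>lborel) + 104) * ennreal (1 / (1 + cmod z))"
proof -
  define R where "R = (1 + cmod z) / 4"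
  have R: "R > 0" by (simp add: R_def add_pos_nonneg)
  define a where "a = (1 + cmod z)"
  have a: "a \<ge> 1" "a > 0" by (simp_all add: a_def add_pos_nonneg)
  have "(\<integral>\<^sup>+w. ennreal (chart_density w * (1 / cmod (z - w))) \<partial>lborel)
    \<le> (\<integral>\<^sup>+w. ennreal (1 / R) * ennreal (chart_density w)
        + ennreal (26 / a ^ 4) * (ennreal (1 / cmod (z - w)) * indicator (cball z R) w) \<partial>lborel)"
  proof (rule nn_integral_mono)
    fix w
    show "ennreal (chart_density w * (1 / cmod (z - w))) \<le> ennreal (1 / R) * ennreal (chart_density w)
        + ennreal (26 / a ^ 4) * (ennreal (1 / cmod (z - w)) * indicator (cball z R) w)"
    proof (cases "w \<in> cball z R")
      case True
      have "cmod z \<le> cmod w + cmod (z - w)" using norm_triangle_ineq[of w "z - w"] by simp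
      then have w: "3/4 * a \<le> 1 + cmod w" using True by (simp add: R_def a_def dist_norm)
      then have "(3/4 * a) ^ 4 \<le> (1 + cmod w) ^ 4" using a by (intro power_mono) auto
      then have "8 / (1 + cmod w) ^ 4 \<le> 8 / (3/4 * a) ^ 4"
        using a by (intro divide_left_mono) (auto intro!: mult_pos_pos simp: add_pos_nonneg)
      also have "\<dots> \<le> 26 / a ^ 4" using a by (simp add: power_mult_distrib power_divide divide_simps)
      finally have "8 * (1 + cmod w) powr (-4) \<le> 26 / a ^ 4"
        using one_le_one_plus_cmod(2)[of w] by (simp add: powr_minus inverse_eq_divide)
      then have "chart_density w \<le> 26 / a ^ 4" using chart_density_le[of w] by linarith
      then have "chart_density w * (1 / cmod (z - w)) \<le> 26 / a ^ 4 * (1 / cmod (z - w))"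
        by (intro mult_right_mono) auto
      then have "ennreal (chart_density w * (1 / cmod (z - w))) \<le> ennreal (26 / a ^ 4) * ennreal (1 / cmod (z - w))"
        using a by (subst ennreal_mult[symmetric]) (auto intro: ennreal_leI)
      then show ?thesis using True by (simp add: add_increasing)
    next
      case False
      then have "1 / cmod (z - w) \<le> 1 / R" using R by (intro divide_left_mono) (auto simp: dist_norm intro!: mult_pos_pos)
      then have "chart_density w * (1 / cmod (z - w)) \<le> 1 / R * chart_density w"
        using chart_density_pos[of w] by (metis mult.commute mult_left_mono less_imp_le)
      then show ?thesis using False R chart_density_pos[of w]
        by (simp add: ennreal_mult[symmetric] ennreal_leI)
    qed
  qed
  also have "\<dots> = ennreal (1 / R) * (\<integral>\<^sup>+w. ennreal (chart_density w) \<partial>lborel)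
      + ennreal (26 / a ^ 4) * (\<integral>\<^sup>+w. ennreal (1 / cmod (z - w)) * indicator (cball z R) w \<partial>lborel)"
  proof -
    have [measurable]: "cball z R \<in> sets borel" by (intro borel_closed closed_cball)
    show ?thesis by (subst nn_integral_add) (auto simp: nn_integral_cmult)
  qed
  also have "\<dots> \<le> ennreal (1 / R) * (\<integral>\<^sup>+w. ennreal (chart_density w) \<partial>lborel)
      + ennreal (26 / a ^ 4) * ennreal (16 * R)"
    by (intro add_mono mult_left_mono nn_integral_inverse_norm R) auto
  also have "ennreal (26 / a ^ 4) * ennreal (16 * R) \<le> 104 * ennreal (1 / a)"
  proof -
    have "1 * 1 \<le> a * a" using a by (intro mult_mono) auto
    then have "26 / a ^ 4 * (16 * R) \<le> 104 * (1 / a)"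
      using a unfolding R_def a_def[symmetric] by (simp add: field_simps power4_eq_xxxx power3_eq_cube)
    then show ?thesis using R a
      by (simp add: ennreal_mult[symmetric] ennreal_leI flip: ennreal_numeral)
  qed
  also have "ennreal (1 / R) = 4 * ennreal (1 / a)"
    using a by (simp add: R_def a_def ennreal_mult[symmetric] flip: ennreal_numeral)
  finally show ?thesis by (simp add: a_def algebra_simps)
qed

text \<open>The density decays with exponent 4, hence the integrand with exponent
  \<open>4 - q\<close>, and this exceeds the planar threshold 2 exactly when
  \<open>q < 2\<close>.\<close>

lemma nn_integral_chart_density_powr:
  assumes "0 \<le> q" "q < 2"
  shows "(\<integral>\<^sup>+z. ennreal (chart_density z * (1 + cmod z) powr q) \<partial>lborel) < \<infinity>"
proof -
  have "(\<integral>\<^sup>+z. ennreal (chart_density z * (1 + cmod z) powr q) \<partial>lborel)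
      \<le> (\<integral>\<^sup>+z. 8 * ennreal ((1 + cmod z) powr (-(4 - q))) \<partial>lborel)"
  proof (rule nn_integral_mono)
    fix z
    have "chart_density z * (1 + cmod z) powr q \<le> 8 * (1 + cmod z) powr (-4) * (1 + cmod z) powr q"
      by (intro mult_right_mono chart_density_le) auto
    also have "\<dots> = 8 * (1 + cmod z) powr (-(4 - q))" by (simp add: powr_add[symmetric] mult.assoc)
    finally show "ennreal (chart_density z * (1 + cmod z) powr q) \<le> 8 * ennreal ((1 + cmod z) powr (-(4 - q)))"
      by (simp add: ennreal_mult[symmetric] ennreal_leI flip: ennreal_numeral)
  qed
  also have "\<dots> < \<infinity>"
    using nn_integral_powr_decay_complex[of "4 - q"] assms
    by (subst nn_integral_cmult) (auto simp: ennreal_mult_less_top)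
  finally show ?thesis .
qed

section \<open>Kernel, weighted and cap estimates for the sphere measure\<close>

lemma emeasure_dV_finite: "emeasure dV CP1 < \<infinity>"
proof -
  have "emeasure dV CP1 = (\<integral>\<^sup>+y. indicator (space dV) y \<partial>dV)" by (simp add: space_dV[symmetric])
  also have "\<dots> = (\<integral>\<^sup>+y. 1 \<partial>dV)" by (intro nn_integral_cong) auto
  also have "\<dots> = (\<integral>\<^sup>+z. ennreal (chart_density z * (1 + cmod z) powr 0) \<partial>lborel)"
    by (subst nn_integral_dV) (auto intro!: nn_integral_cong simp: add_nonneg_eq_0_iff)
  also have "\<dots> < \<infinity>" by (intro nn_integral_chart_density_powr) auto
  finally show ?thesis .
qed

lemma finite_measure_dV: "finite_measure dV"
  using emeasure_dV_finite by (intro finite_measureI) (simp add: space_dV)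

lemma affine_coord_u0: "affine_coord (u0 z) = z"
  unfolding affine_coord_def by (rule the_inv_into_f_f[OF inj_u0]) simp

lemma affine_coord_eq: "y \<in> U0 \<Longrightarrow> affine_coord y = fst y / of_real (1 - snd y)"
  using bij_betw_u0 affine_coord_u0 u0_recover unfolding bij_betw_def by (metis imageE)

lemma u0_affine_coord: "y \<in> U0 \<Longrightarrow> u0 (affine_coord y) = y"
  using bij_betw_u0 affine_coord_u0 unfolding bij_betw_def by (metis imageE)

lemma U0_eq: "U0 = CP1 - {(0, 1)}" by (simp add: U0_def hpt_inf)

lemma snd_U0: assumes "y \<in> U0" shows "snd y \<noteq> 1"
proof -
  obtain z where "y = u0 z" using assms u0_affine_coord by metis
  moreover have "1 + (cmod z)\<^sup>2 \<noteq> 0" by (simp add: add_nonneg_eq_0_iff)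
  ultimately show ?thesis by (simp add: u0_eq divide_eq_eq)
qed

text \<open>A total version of the affine coordinate; at infinity it takes the junk value \<open>0\<close>.\<close>

definition chart :: "ambient \<Rightarrow> complex" where "chart y = fst y / of_real (1 - snd y)"

lemma measurable_chart[measurable]: "chart \<in> borel_measurable borel"
  unfolding chart_def[abs_def] borel_prod[symmetric] by measurable

lemma chart_u0: "chart (u0 z) = z" unfolding chart_def by (rule u0_recover)

lemma chart_eq_affine_coord: "y \<in> U0 \<Longrightarrow> chart y = affine_coord y"
  by (simp add: chart_def affine_coord_eq)

lemma measurable_from_dV: "f \<in> borel_measurable borel \<Longrightarrow> f \<in> borel_measurable dV"
  unfolding measurable_dV_iff by (rule measurable_restrict_space1)

lemma kernel_bound_dV:
  "\<exists>K<\<infinity>. \<forall>z. (\<integral>\<^sup>+y. ennreal (1 / cmod (z - chart y)) \<partial>dV) \<le> K * ennreal (1 / (1 + cmod z))"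
proof (intro exI conjI allI)
  let ?K = "4 * (\<integral>\<^sup>+w. ennreal (chart_density w) \<partial>lborel) + 104"
  have "(\<integral>\<^sup>+z. ennreal (chart_density z * (1 + cmod z) powr 0) \<partial>lborel) < \<infinity>"
    by (intro nn_integral_chart_density_powr) auto
  then have "(\<integral>\<^sup>+w. ennreal (chart_density w) \<partial>lborel) < \<infinity>"
    by (simp add: powr_zero_eq_one one_le_one_plus_cmod(2)[THEN less_imp_neq, symmetric])
  then show "?K < \<infinity>" by (simp add: ennreal_mult_less_top)
  fix z
  have "(\<integral>\<^sup>+y. ennreal (1 / cmod (z - chart y)) \<partial>dV)
      = (\<integral>\<^sup>+w. ennreal (chart_density w) * ennreal (1 / cmod (z - w)) \<partial>lborel)"
    by (subst nn_integral_dV) (auto simp: chart_u0 intro: measurable_from_dV)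
  also have "\<dots> = (\<integral>\<^sup>+w. ennreal (chart_density w * (1 / cmod (z - w))) \<partial>lborel)"
    by (intro nn_integral_cong, subst ennreal_mult) auto
  finally show "(\<integral>\<^sup>+y. ennreal (1 / cmod (z - chart y)) \<partial>dV) \<le> ?K * ennreal (1 / (1 + cmod z))"
    using kernel_bound[of z] by simp
qed

text \<open>Young's inequality is applied pointwise to \<open>h / N\<close> and the weight, in place
  of Hoelder's inequality for norms; after division by \<open>N\<close> the first term integrates to
  at most 1. Allowing every positive upper bound \<open>N\<close> of the norm covers fields of norm
  zero.\<close>

lemma weighted_Lp_bound:
  fixes p :: real
  assumes "p > 2"
  shows "\<exists>K<\<infinity>. \<forall>h N. h \<in> borel_measurable dV \<longrightarrow> (\<forall>y. 0 \<le> h y) \<longrightarrow> N > 0 \<longrightarrow>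
    (\<integral>\<^sup>+y. ennreal (h y powr p) \<partial>dV) \<le> ennreal (N powr p) \<longrightarrow>
    (\<integral>\<^sup>+y. ennreal ((1 + cmod (chart y)) * h y) \<partial>dV) \<le> K * ennreal N"
proof (intro exI conjI allI impI)
  define q where "q = p / (p - 1)"
  have q: "q > 1" "q < 2" "1/p + 1/q = 1" using assms by (auto simp: q_def field_simps)
  let ?Q = "\<integral>\<^sup>+y. ennreal ((1 + cmod (chart y)) powr q) \<partial>dV"
  have "?Q = (\<integral>\<^sup>+z. ennreal (chart_density z * (1 + cmod z) powr q) \<partial>lborel)"
    by (subst nn_integral_dV)
      (auto simp: chart_u0 ennreal_mult[symmetric] simp del: times_divide_eq_left intro!: measurable_from_dV nn_integral_cong)
  also have "\<dots> < \<infinity>" using q by (intro nn_integral_chart_density_powr) auto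
  finally show "?Q + 1 < \<infinity>" by simp
  fix h :: "ambient \<Rightarrow> real" and N :: real
  assume h: "h \<in> borel_measurable dV" "\<forall>y. 0 \<le> h y" and N: "N > 0"
    and le: "(\<integral>\<^sup>+y. ennreal (h y powr p) \<partial>dV) \<le> ennreal (N powr p)"
  note [measurable] = h(1)
  have [measurable]: "chart \<in> borel_measurable dV" by (rule measurable_from_dV) simp
  have "(\<integral>\<^sup>+y. ennreal ((1 + cmod (chart y)) * h y) \<partial>dV)
    \<le> (\<integral>\<^sup>+y. ennreal N * (ennreal ((1 + cmod (chart y)) powr q) + ennreal (1 / N powr p) * ennreal (h y powr p)) \<partial>dV)"
  proof (rule nn_integral_mono)
    fix y
    have hy: "0 \<le> h y" using h(2) by blast
    have "h y / N * (1 + cmod (chart y)) \<le> (h y / N) powr p / p + (1 + cmod (chart y)) powr q / q"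
      using assms q N hy one_le_one_plus_cmod by (intro Youngs_inequality) (auto simp: add.commute)
    also have "\<dots> \<le> (h y / N) powr p + (1 + cmod (chart y)) powr q"
      using assms q by (intro add_mono) (auto simp: divide_le_eq mult_ge1_I intro!: mult_right_le_one_le simp: mult_le_cancel_left1)
    finally have "N * (h y / N * (1 + cmod (chart y))) \<le> N * ((h y / N) powr p + (1 + cmod (chart y)) powr q)"
      using N by (intro mult_left_mono) auto
    then have "(1 + cmod (chart y)) * h y \<le> N * ((1 + cmod (chart y)) powr q + (1 / N powr p) * h y powr p)"
      using N hy by (simp add: powr_divide add.commute mult.commute)
    then have "ennreal ((1 + cmod (chart y)) * h y) \<le> ennreal (N * ((1 + cmod (chart y)) powr q + (1 / N powr p) * h y powr p))"
      by (rule ennreal_leI)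
    also have "\<dots> = ennreal N * (ennreal ((1 + cmod (chart y)) powr q) + ennreal (1 / N powr p) * ennreal (h y powr p))"
      using N by (simp only: ennreal_mult' ennreal_plus ennreal_mult powr_ge_zero mult_nonneg_nonneg divide_nonneg_nonneg zero_le_one less_imp_le)
    finally show "ennreal ((1 + cmod (chart y)) * h y) \<le> \<dots>" .
  qed
  also have "\<dots> = ennreal N * (?Q + ennreal (1 / N powr p) * (\<integral>\<^sup>+y. ennreal (h y powr p) \<partial>dV))"
    by (simp add: nn_integral_cmult nn_integral_add)
  also have "\<dots> \<le> ennreal N * (?Q + ennreal (1 / N powr p) * ennreal (N powr p))"
    by (intro mult_left_mono add_left_mono le) auto
  also have "ennreal (1 / N powr p) * ennreal (N powr p) = 1"
    using N by (simp add: ennreal_mult[symmetric])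
  finally show "(\<integral>\<^sup>+y. ennreal ((1 + cmod (chart y)) * h y) \<partial>dV) \<le> (?Q + 1) * ennreal N"
    by (simp add: mult.commute)
qed

lemma dist_u0_infinity: "dist (u0 z) (0, 1) = 1 / sqrt (1 + (cmod z)\<^sup>2)"
proof -
  define a where "a = 1 + (cmod z)\<^sup>2"
  have a: "a > 0" "(cmod z)\<^sup>2 = a - 1" by (simp_all add: a_def add_pos_nonneg)
  have 1: "cmod (z / complex_of_real a) = cmod z / a" using a by (simp add: norm_divide)
  have "dist (u0 z) (0, 1) = sqrt ((cmod z / a)\<^sup>2 + ((a - 1) / a - 1)\<^sup>2)"
    unfolding u0_eq a_def[symmetric] a(2) dist_Pair_Pair by (simp add: dist_norm 1)
  also have "(cmod z / a)\<^sup>2 + ((a - 1) / a - 1)\<^sup>2 = 1 / a"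
  proof -
    have "(a - 1) / a - 1 = - 1 / a" using a by (simp add: field_simps)
    then show ?thesis using a by (simp add: power_divide a(2) power2_eq_square add_divide_distrib[symmetric])
  qed
  finally show ?thesis by (simp add: a_def real_sqrt_divide)
qed

text \<open>The true area is of order \<open>e^2\<close>; the rate 3/2 is weaker but still above 1,
  so that many small caps have small total area. On the cap \<open>1 / (1 + cmod z) \<le> e\<close>,
  so of the decay exponent 4 a part 3/2 is traded for \<open>e powr (3/2)\<close> and the remaining
  5/2 is still integrable.\<close>

lemma cap_bound:
  "\<exists>K<\<infinity>. \<forall>e>0. emeasure dV (CP1 \<inter> cball (0, 1) e) \<le> K * ennreal (e powr (3/2))"
proof (intro exI conjI allI impI)
  let ?I = "\<integral>\<^sup>+z. ennreal ((1 + cmod z) powr (-(5/2))) \<partial>lborel"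
  have "?I < \<infinity>" using nn_integral_powr_decay_complex[of "5/2"] by simp
  then show "ennreal 32 * ?I < \<infinity>" by (simp add: ennreal_mult_less_top)
  fix e :: real assume e: "e > 0"
  have m: "CP1 \<inter> cball (0,1) e \<in> sets dV"
    unfolding sets_dV sets_restrict_space by (intro imageI) auto
  have "emeasure dV (CP1 \<inter> cball (0, 1) e) = (\<integral>\<^sup>+y. indicator (CP1 \<inter> cball (0, 1) e) y \<partial>dV)"
    using m by simp
  also have "\<dots> = (\<integral>\<^sup>+z. ennreal (chart_density z) * indicator (CP1 \<inter> cball (0, 1) e) (u0 z) \<partial>lborel)"
    using m by (intro nn_integral_dV) auto
  also have "\<dots> \<le> (\<integral>\<^sup>+z. ennreal (32 * e powr (3/2)) * ennreal ((1 + cmod z) powr (-(5/2))) \<partial>lborel)"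
  proof (rule nn_integral_mono)
    fix z :: complex
    define b where "b = 1 + cmod z"
    have b: "b > 0" by (simp add: b_def add_pos_nonneg)
    show "ennreal (chart_density z) * indicator (CP1 \<inter> cball (0, 1) e) (u0 z)
        \<le> ennreal (32 * e powr (3/2)) * ennreal ((1 + cmod z) powr (-(5/2)))"
    proof (cases "u0 z \<in> cball (0,1) e")
      case True
      then have "1 / sqrt (1 + (cmod z)\<^sup>2) \<le> e" by (simp add: dist_u0_infinity[symmetric] dist_commute)
      moreover have "sqrt (1 + (cmod z)\<^sup>2) \<le> b"
        unfolding b_def by (intro real_le_lsqrt) (auto simp: power2_eq_square algebra_simps)
      moreover have "sqrt (1 + (cmod z)\<^sup>2) > 0" by (simp add: add_pos_nonneg)
      ultimately have "1 / b \<le> e"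
        by (meson divide_left_mono order_trans zero_le_one mult_pos_pos b)
      then have "(1 / b) powr (3/2) \<le> e powr (3/2)" using b by (intro powr_mono2) auto
      then have "8 * (b powr (-(5/2)) * (1 / b) powr (3/2)) \<le> 32 * (b powr (-(5/2)) * e powr (3/2))"
        using b by (intro mult_mono) auto
      moreover have "b powr (-(5/2)) * (1 / b) powr (3/2) = b powr (-4)"
      proof -
        have "(1 / b) powr (3/2) = b powr (-(3/2))" using b by (simp add: powr_divide powr_minus inverse_eq_divide)
        then show ?thesis by (simp add: powr_add[symmetric])
      qed
      ultimately have "chart_density z \<le> 32 * e powr (3/2) * (b powr (-(5/2)))"
        using chart_density_le[of z] by (simp add: b_def mult_ac)
      then show ?thesis using True u0_in_CP1
        by (simp add: ennreal_mult[symmetric] b_def ennreal_leI)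
    qed auto
  qed
  also have "\<dots> = ennreal (32 * e powr (3/2)) * ?I" by (rule nn_integral_cmult) simp
  finally show "emeasure dV (CP1 \<inter> cball (0, 1) e) \<le> ennreal 32 * ?I * ennreal (e powr (3/2))"
    by (simp add: ennreal_mult mult_ac)
qed

lemma AE_dV_chart:
  assumes "AE z in lborel. P z" and "{y\<in>CP1. P (chart y)} \<in> sets dV"
  shows "AE y in dV. P (chart y)"
proof -
  have m: "CP1 - {y\<in>CP1. P (chart y)} \<in> sets dV" using sets.compl_sets[OF assms(2)] by (simp add: space_dV)
  have "emeasure dV (CP1 - {y\<in>CP1. P (chart y)}) = (\<integral>\<^sup>+y. indicator (CP1 - {y\<in>CP1. P (chart y)}) y \<partial>dV)"
    using m by simp
  also have "\<dots> = (\<integral>\<^sup>+z. ennreal (chart_density z) * indicator (CP1 - {y\<in>CP1. P (chart y)}) (u0 z) \<partial>lborel)"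
    using m by (intro nn_integral_dV) auto
  also have "\<dots> = (\<integral>\<^sup>+(z::complex). 0 \<partial>lborel)"
    using assms(1) by (intro nn_integral_cong_AE) (auto simp: chart_u0 u0_in_CP1 elim!: eventually_mono split: split_indicator)
  finally show ?thesis
    using m by (intro AE_I[of _ _ "CP1 - {y\<in>CP1. P (chart y)}"]) (auto simp: space_dV)
qed

text \<open>The excluded set is the real line through \<open>a\<close> in direction
  \<open>v\<close>, seen as a hyperplane with normal \<open>\<i> * v\<close>. Staying off such lines
  is what \<open>segment_avoids_collisions\<close> asks of the differences of an end
  configuration.\<close>

lemma AE_not_on_line:
  fixes v :: complex
  assumes "v \<noteq> 0"
  shows "AE y in dV. Im ((chart y - a) * cnj v) \<noteq> 0"
proof -
  let ?H = "{z. (\<i> * v) \<bullet> z = (\<i> * v) \<bullet> a}"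
  have H: "z \<in> ?H \<longleftrightarrow> Im ((z - a) * cnj v) = 0" for z
    by (auto simp: inner_complex_def algebra_simps)
  have "negligible ?H" using assms by (intro negligible_hyperplane) auto
  moreover have "closed ?H" by (rule closed_hyperplane)
  ultimately have "?H \<in> null_sets lborel"
    by (simp add: negligible_iff_null_sets null_sets_completion_iff borel_closed)
  then have "AE z in lborel. z \<notin> ?H" by (rule AE_not_in)
  then have 1: "AE z in lborel. Im ((z - a) * cnj v) \<noteq> 0" unfolding H .
  have "{y \<in> CP1. Im ((chart y - a) * cnj v) \<noteq> 0} = CP1 \<inter> (chart -` (- ?H) \<inter> space borel)"
    using H by auto
  also have "\<dots> \<in> sets dV" unfolding sets_dV sets_restrict_space
    by (intro imageI measurable_sets[OF measurable_chart]) (use \<open>closed ?H\<close> in auto)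
  finally show ?thesis by (intro AE_dV_chart 1)
qed

section \<open>Area-preserving isotopies\<close>

lemma continuous_on_locally_eq:
  fixes f :: "'a::real_normed_vector \<Rightarrow> 'b::real_normed_vector"
  assumes "\<And>x. x \<in> A \<Longrightarrow> \<exists>U g. open U \<and> x \<in> U \<and> continuous_on U g \<and> (\<forall>y\<in>A \<inter> U. f y = g y)"
  shows "continuous_on A f"
  unfolding continuous_on_eq_continuous_within
proof
  fix x assume x: "x \<in> A"
  then obtain U g where U: "open U" "x \<in> U" "continuous_on U g" "\<forall>y\<in>A \<inter> U. f y = g y"
    using assms by blast
  then have "(g \<longlongrightarrow> g x) (at x)"
    using continuous_on_eq_continuous_at continuous_at by blast
  then have "(g \<longlongrightarrow> g x) (at x within A)" by (rule tendsto_within_subset) simp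
  moreover have "eventually (\<lambda>y. g y = f y) (at x within A)"
    using U unfolding eventually_at_topological by (intro exI[of _ U]) auto
  ultimately have "(f \<longlongrightarrow> g x) (at x within A)"
    by (rule Lim_transform_eventually)
  then show "continuous (at x within A) f" using U x by (simp add: continuous_within)
qed

lemma smooth_map_on_continuous_on:
  assumes "smooth_map_on A f" shows "continuous_on A f"
proof (rule continuous_on_locally_eq)
  fix x assume "x \<in> A"
  then obtain U g where "open U" "x \<in> U" "\<forall>k. Ck_on k U g" "\<forall>y\<in>A \<inter> U. f y = g y"
    using assms unfolding smooth_map_on_def by blast
  then show "\<exists>U g. open U \<and> x \<in> U \<and> continuous_on U g \<and> (\<forall>y\<in>A \<inter> U. f y = g y)"
    using Ck_on.simps(1) by blast
qed

text \<open>The generating field in Lagrangian form, indexed by the starting point instead of the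
  current position. This avoids the inverse map and is jointly continuous in time and point. At
  times 0 and 1 the derivative is one-sided.\<close>

definition velocity :: "(real \<Rightarrow> ambient \<Rightarrow> ambient) \<Rightarrow> real \<Rightarrow> ambient \<Rightarrow> ambient" where
  "velocity \<phi> t x = vector_derivative (\<lambda>s. \<phi> s x) (at t within {0..1})"

text \<open>Smoothness supplies only local extensions to open subsets of the ambient space. Near
  each point the time derivative is the Frechet derivative of such an extension in direction
  \<open>(1, 0)\<close>; joint continuity of \<open>velocity\<close> follows from this.\<close>

lemma velocity_local:
  assumes "smooth_map_on ({0..1} \<times> CP1) (\<lambda>(t, x). \<phi> t x)" "t \<in> {0..1}" "x \<in> CP1"
  shows "\<exists>U h. open U \<and> (t, x) \<in> U \<and> continuous_on U h \<and> (\<forall>(s, y)\<in>({0..1} \<times> CP1) \<inter> U.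
    ((\<lambda>s. \<phi> s y) has_vector_derivative h (s, y)) (at s within {0..1}))"
proof -
  have "(t, x) \<in> {0..1} \<times> CP1" using assms by auto
  then obtain U g where U: "open U" "(t, x) \<in> U" "\<forall>k. Ck_on k U g"
    and g: "\<forall>y\<in>({0..1} \<times> CP1) \<inter> U. (case y of (t, x) \<Rightarrow> \<phi> t x) = g y"
    using assms(1) unfolding smooth_map_on_def by blast
  let ?h = "\<lambda>y. frechet_derivative g (at y) (1, 0)"
  have "Ck_on (Suc 0) U g" using U by blast
  then have d: "\<forall>y\<in>U. g differentiable (at y)" and "Ck_on 0 U ?h"
    unfolding Ck_on.simps(2) by blast+
  then have c: "continuous_on U ?h" by (simp only: Ck_on.simps(1))
  have "((\<lambda>s. \<phi> s y) has_vector_derivative ?h (s, y)) (at s within {0..1})"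
    if sy: "s \<in> {0..1}" "y \<in> CP1" "(s, y) \<in> U" for s y
  proof -
    have "(g has_derivative frechet_derivative g (at (s, y))) (at (s, y))"
      using d sy frechet_derivative_works by blast
    moreover have "((\<lambda>s. (s, y)) has_derivative (\<lambda>k. (k, 0))) (at s within {0..1})"
      by (auto intro!: derivative_eq_intros)
    ultimately have D: "((\<lambda>s. g (s, y)) has_derivative (\<lambda>k. frechet_derivative g (at (s, y)) (k, 0))) (at s within {0..1})"
      by (rule has_derivative_compose[rotated])
    have lin: "linear (frechet_derivative g (at (s, y)))"
      using d sy by (intro linear_frechet_derivative) auto
    have h: "(\<lambda>k. frechet_derivative g (at (s, y)) (k, 0)) = (\<lambda>k. k *\<^sub>R ?h (s, y))"
    proof
      fix k :: real
      have "(k, 0 :: ambient) = k *\<^sub>R (1, 0)" by simp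
      then show "frechet_derivative g (at (s, y)) (k, 0) = k *\<^sub>R ?h (s, y)"
        using linear_cmul[OF lin] by metis
    qed
    have V: "((\<lambda>s. g (s, y)) has_vector_derivative ?h (s, y)) (at s within {0..1})"
      using D unfolding h has_vector_derivative_def .
    obtain e where e: "e > 0" "ball (s, y) e \<subseteq> U" using U(1) sy open_contains_ball by blast
    show ?thesis
    proof (rule has_vector_derivative_transform_within[OF V e(1) sy(1)])
      fix s' assume s': "s' \<in> {0..1}" "dist s' s < e"
      then have "(s', y) \<in> U" using e(2) by (auto simp: subset_eq dist_Pair_Pair dist_commute)
      then show "g (s', y) = \<phi> s' y" using bspec[OF g, of "(s', y)"] s' sy by auto
    qed
  qed
  then show ?thesis using U c by (intro exI[of _ U] exI[of _ ?h]) auto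
qed

locale area_isotopy =
  fixes \<phi> :: "real \<Rightarrow> ambient \<Rightarrow> ambient"
  assumes path: "diffeo_path \<phi>"
begin

lemma diffeo: assumes "t \<in> {0..1}"
  shows "bij_betw (\<phi> t) CP1 CP1" "continuous_on CP1 (\<phi> t)" "continuous_on CP1 (inv_into CP1 (\<phi> t))"
    "distr dV dV (\<phi> t) = dV"
  using path assms smooth_map_on_continuous_on unfolding diffeo_path_def area_diffeos_def by blast+

lemma smooth: "smooth_map_on ({0..1} \<times> CP1) (\<lambda>(t, x). \<phi> t x)"
  using path by (simp add: diffeo_path_def)

lemma start: "x \<in> CP1 \<Longrightarrow> \<phi> 0 x = x" using path by (simp add: diffeo_path_def)

lemma maps_to: "t \<in> {0..1} \<Longrightarrow> x \<in> CP1 \<Longrightarrow> \<phi> t x \<in> CP1"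
  using diffeo(1) bij_betwE by blast

lemma continuous: "continuous_on ({0..1} \<times> CP1) (\<lambda>(t, x). \<phi> t x)"
  by (rule smooth_map_on_continuous_on[OF smooth])

lemma has_velocity:
  assumes "t \<in> {0..1}" "x \<in> CP1"
  shows "((\<lambda>s. \<phi> s x) has_vector_derivative velocity \<phi> t x) (at t within {0..1})"
proof -
  obtain v where "((\<lambda>s. \<phi> s x) has_vector_derivative v) (at t within {0..1})"
    using velocity_local[OF smooth assms] assms by blast
  then show ?thesis
    unfolding velocity_def using vector_derivative_works differentiableI_vector by blast
qed

lemma continuous_velocity: "continuous_on ({0..1} \<times> CP1) (\<lambda>(t, x). velocity \<phi> t x)"
proof (rule continuous_on_locally_eq)
  fix q :: "real \<times> ambient" assume q: "q \<in> {0..1} \<times> CP1"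
  then obtain U h where U: "open U" "q \<in> U" "continuous_on U h"
    and h: "\<forall>(s, y)\<in>({0..1} \<times> CP1) \<inter> U. ((\<lambda>s. \<phi> s y) has_vector_derivative h (s, y)) (at s within {0..1})"
    using velocity_local[OF smooth, of "fst q" "snd q"] by auto
  have "velocity \<phi> s y = h (s, y)" if "s \<in> {0..1}" "y \<in> CP1" "(s, y) \<in> U" for s y
    
  proof -
    have "((\<lambda>s. \<phi> s y) has_vector_derivative h (s, y)) (at s within {0..1})"
      using bspec[OF h, of "(s, y)"] that by auto
    then show ?thesis
      unfolding velocity_def using that by (intro vector_derivative_within_closed_interval) auto
  qed
  then show "\<exists>U g. open U \<and> q \<in> U \<and> continuous_on U g \<and>
      (\<forall>y\<in>({0..1} \<times> CP1) \<inter> U. (case y of (t, x) \<Rightarrow> velocity \<phi> t x) = g y)"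
    using U by (intro exI[of _ U] exI[of _ h]) auto
qed

lemma generating_field_eq:
  assumes "t \<in> {0..1}" "x \<in> CP1"
  shows "generating_field \<phi> t (\<phi> t x) = velocity \<phi> t x"
  unfolding generating_field_def velocity_def
  using diffeo(1)[OF assms(1)] assms(2) by (simp add: bij_betw_def inv_into_f_f)

lemma velocity_bounded: "\<exists>L>0. \<forall>t\<in>{0..1}. \<forall>x\<in>CP1. norm (velocity \<phi> t x) \<le> L"
proof -
  have "compact ((\<lambda>(t, x). velocity \<phi> t x) ` ({0..1} \<times> CP1))"
    by (intro compact_continuous_image continuous_velocity compact_Times compact_CP1) auto
  then have "bounded ((\<lambda>(t, x). velocity \<phi> t x) ` ({0..1} \<times> CP1))" by (rule compact_imp_bounded)
  then obtain L where "L > 0" "\<forall>v\<in>(\<lambda>(t, x). velocity \<phi> t x) ` ({0..1} \<times> CP1). norm v \<le> L"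
    unfolding bounded_pos by blast
  then show ?thesis by (intro exI[of _ L]) auto
qed

lemma measurable_map: assumes "t \<in> {0..1}" shows "\<phi> t \<in> measurable dV dV"
proof -
  have "\<phi> t \<in> borel_measurable dV" by (intro continuous_on_measurable_dV diffeo assms)
  then have "\<phi> t \<in> measurable dV (restrict_space borel CP1)"
    using maps_to[OF assms] by (intro measurable_restrict_space2) (auto simp: space_dV)
  then show ?thesis using sets_dV by (metis measurable_cong_sets)
qed

lemma nn_integral_preserved:
  assumes "t \<in> {0..1}" "f \<in> borel_measurable dV"
  shows "(\<integral>\<^sup>+y. f (\<phi> t y) \<partial>dV) = (\<integral>\<^sup>+y. f y \<partial>dV)"
  using nn_integral_distr[OF measurable_map[OF assms(1)], of f] assms(2) diffeo(4)[OF assms(1)] by simp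

lemma AE_preserved:
  assumes "t \<in> {0..1}" "AE y in dV. P y"
  shows "AE y in dV. P (\<phi> t y)"
proof -
  have "AE y in distr dV dV (\<phi> t). P y" unfolding diffeo(4)[OF assms(1)] by (rule assms(2))
  then show ?thesis by (rule AE_distrD[OF measurable_map[OF assms(1)]])
qed

text \<open>
  The set of points whose trajectory meets infinity is covered, for each \<open>n\<close>, by \<open>n\<close> preimages of a cap of
  radius \<open>O(1/n)\<close>, of total area \<open>O(n * n powr (-3/2))\<close>.
\<close>

lemma AE_avoids_infinity: "AE y in dV. \<forall>t\<in>{0..1}. \<phi> t y \<noteq> (0, 1)"
proof -
  obtain L where L: "L > 0" "\<And>t x. t \<in> {0..1} \<Longrightarrow> x \<in> CP1 \<Longrightarrow> norm (velocity \<phi> t x) \<le> L"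
    using velocity_bounded by blast
  obtain K where K: "K < \<infinity>" "\<And>e. e > 0 \<Longrightarrow> emeasure dV (CP1 \<inter> cball (0, 1) e) \<le> K * ennreal (e powr (3/2))"
    using cap_bound by blast
  define S where "S n = (\<Union>k<Suc n. \<phi> (real k / real (Suc n)) -` (CP1 \<inter> cball (0, 1) (L / real (Suc n))) \<inter> space dV)" for n
  have t: "real k / real (Suc n) \<in> {0..1}" if "k < Suc n" for k n using that by (auto simp: divide_le_eq)
  have cap: "CP1 \<inter> cball (0, 1) e \<in> sets dV" for e
    unfolding sets_dV sets_restrict_space by (intro imageI) auto
  have S: "S n \<in> sets dV" for n
    unfolding S_def using t by (intro sets.finite_UN measurable_sets[OF measurable_map cap]) auto
  have cover: "y \<in> S n" if y: "y \<in> CP1" "s \<in> {0..1}" "\<phi> s y = (0, 1)" for y s n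
  proof -
    \<comment> \<open>At \<open>s = 1\<close> the floor would give \<open>Suc n\<close>, outside the
      index range. The last sample time \<open>n / Suc n\<close> is still within
      \<open>1 / Suc n\<close> of it.\<close>
    define k where "k = (if s = 1 then n else nat \<lfloor>s * real (Suc n)\<rfloor>)"
    define u where "u = real k / real (Suc n)"
    have k: "k < Suc n" "\<bar>s - u\<bar> \<le> 1 / real (Suc n)"
    proof -
      consider "s = 1" | "s < 1" using y by force
      then have "k < Suc n \<and> real k \<le> s * real (Suc n) \<and> s * real (Suc n) \<le> real k + 1"
      proof cases
        case 1 then show ?thesis by (simp add: k_def)
      next
        case 2
        have "0 \<le> s * real (Suc n)" "s * real (Suc n) < real (Suc n)" using y 2 by auto
        then show ?thesis using 2 by (simp only: k_def) (auto simp: nat_less_iff floor_less_iff)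
      qed
      note * = this
      have "s - u = (s * real (Suc n) - real k) / real (Suc n)"
        unfolding u_def by (simp add: diff_divide_distrib del: of_nat_Suc)
      then have "\<bar>s - u\<bar> = \<bar>s * real (Suc n) - real k\<bar> / real (Suc n)"
        by (simp add: abs_divide del: of_nat_Suc)
      also have "\<dots> \<le> 1 / real (Suc n)" using * by (intro divide_right_mono) auto
      finally show "k < Suc n" "\<bar>s - u\<bar> \<le> 1 / real (Suc n)" using * by auto
    qed
    have u: "u \<in> {0..1}" unfolding u_def by (rule t[OF k(1)])
    have "norm (\<phi> s y - \<phi> u y) \<le> L * norm (s - u)"
    proof (rule differentiable_bound[of "{0..1}" "\<lambda>t. \<phi> t y" "\<lambda>t h. h *\<^sub>R velocity \<phi> t y"])
      show "((\<lambda>t. \<phi> t y) has_derivative (\<lambda>h. h *\<^sub>R velocity \<phi> x y)) (at x within {0..1})" if "x \<in> {0..1}" for x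
        using has_velocity[OF that y(1)] by (simp add: has_vector_derivative_def)
      show "onorm (\<lambda>h. h *\<^sub>R velocity \<phi> x y) \<le> L" if "x \<in> {0..1}" for x
        using L(2)[OF that y(1)] by (intro onorm_le) (simp add: mult_left_mono mult.commute[of L])
    qed (use u y in auto)
    also have "\<dots> \<le> L * (1 / real (Suc n))" using k L by (intro mult_left_mono) auto
    finally have "dist (0, 1) (\<phi> u y) \<le> L / real (Suc n)" using y by (simp add: dist_norm)
    then have "\<phi> u y \<in> CP1 \<inter> cball (0, 1) (L / real (Suc n))" using maps_to[OF u y(1)] by simp
    then show ?thesis unfolding S_def using k(1) y(1) by (auto simp: u_def space_dV)
  qed
  have measure: "emeasure dV (S n) \<le> K * ennreal (L powr (3/2) * (1 / sqrt (real (Suc n))))" for n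
  proof -
    let ?N = "real (Suc n)"
    have "emeasure dV (S n) \<le> (\<Sum>k<Suc n. emeasure dV (\<phi> (real k / ?N) -` (CP1 \<inter> cball (0, 1) (L / ?N)) \<inter> space dV))"
      unfolding S_def 
    proof (intro emeasure_subadditive_finite image_subsetI)
      fix k assume "k \<in> {..<Suc n}"
      then show "\<phi> (real k / ?N) -` (CP1 \<inter> cball (0, 1) (L / ?N)) \<inter> space dV \<in> sets dV"
        by (intro measurable_sets[OF measurable_map cap] t) simp
    qed simp
    also have "\<dots> = (\<Sum>k<Suc n. emeasure dV (CP1 \<inter> cball (0, 1) (L / ?N)))"
    proof (rule sum.cong[OF refl])
      fix k assume "k \<in> {..<Suc n}"
      then have k: "real k / ?N \<in> {0..1}" by (intro t) simp
      show "emeasure dV (\<phi> (real k / ?N) -` (CP1 \<inter> cball (0, 1) (L / ?N)) \<inter> space dV)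
          = emeasure dV (CP1 \<inter> cball (0, 1) (L / ?N))"
        using emeasure_distr[OF measurable_map[OF k] cap] diffeo(4)[OF k] by simp
    qed
    also have "\<dots> = ennreal ?N * emeasure dV (CP1 \<inter> cball (0, 1) (L / ?N))"
      by (simp only: sum_constant card_lessThan ennreal_of_nat_eq_real_of_nat)
    also have "\<dots> \<le> ennreal ?N * (K * ennreal ((L / ?N) powr (3/2)))"
      using L by (intro mult_left_mono K) auto
    also have "\<dots> = K * ennreal (?N * (L / ?N) powr (3/2))"
      by (simp add: ennreal_mult mult_ac)
    also have "?N * (L / ?N) powr (3/2) = L powr (3/2) * (1 / sqrt ?N)"
    proof -
      have N: "?N > 0" by simp
      have "?N powr (3/2) = ?N powr (1 + 1/2)" by simp
      also have "\<dots> = ?N * sqrt ?N" using N by (simp only: powr_add powr_half_sqrt powr_one less_imp_le)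
      finally show ?thesis using L N by (simp add: powr_divide)
    qed
    finally show ?thesis .
  qed
  have lim: "(\<lambda>n. K * ennreal (L powr (3/2) * (1 / sqrt (real (Suc n))))) \<longlonglongrightarrow> K * ennreal 0"
  proof (intro ennreal_tendsto_cmult tendsto_ennrealI)
    have "(\<lambda>n. 1 / sqrt (real (Suc n))) \<longlonglongrightarrow> 0"
      using filterlim_compose[OF tendsto_inverse_0_at_top[OF filterlim_compose[OF sqrt_at_top filterlim_real_sequentially]] filterlim_Suc]
      by (simp add: inverse_eq_divide)
    from tendsto_mult_left[OF this] show "(\<lambda>n. L powr (3/2) * (1 / sqrt (real (Suc n)))) \<longlonglongrightarrow> 0" by simp
    show "K < top_class.top" using K by simp
  qed
  have "emeasure dV (\<Inter>n. S n) \<le> K * ennreal 0"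
  proof (rule LIMSEQ_le_const[OF lim], intro exI allI impI)
    fix n
    have "emeasure dV (\<Inter>n. S n) \<le> emeasure dV (S n)" using S by (intro emeasure_mono) auto
    then show "emeasure dV (\<Inter>n. S n) \<le> K * ennreal (L powr (3/2) * (1 / sqrt (real (Suc n))))"
      using measure[of n] by (rule order_trans)
  qed
  then have "emeasure dV (\<Inter>n. S n) = 0" by simp
  then show ?thesis
    using S cover by (intro AE_I[of _ _ "\<Inter>n. S n"]) (auto simp: space_dV)
qed

end

section \<open>The measure on the configuration space\<close>

lemma product_sigma_finite_dV: "product_sigma_finite (\<lambda>_. dV)"
proof -
  interpret finite_measure dV by (rule finite_measure_dV)
  show ?thesis by (intro product_sigma_finite.intro sigma_finite_measure_axioms)
qed

lemma emeasure_PiM_dV_finite: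
  fixes I :: "'n::finite set"
  shows "emeasure (Pi\<^sub>M I (\<lambda>_. dV)) (space (Pi\<^sub>M I (\<lambda>_. dV))) < \<infinity>"
proof -
  interpret product_sigma_finite "\<lambda>_::'n. dV" by (rule product_sigma_finite_dV)
  have "emeasure (Pi\<^sub>M I (\<lambda>_. dV)) (PiE I (\<lambda>_. space dV)) = (\<Prod>i\<in>I. emeasure dV (space dV))"
    by (rule emeasure_PiM) auto
  moreover have "\<dots> < \<infinity>" using emeasure_dV_finite
    by (simp add: space_dV power_less_top_ennreal)
  ultimately show ?thesis by (simp only: space_PiM)
qed

lemma nn_integral_PiM_dV_component:
  "\<exists>c<\<infinity>. \<forall>f. f \<in> borel_measurable dV \<longrightarrow>
    (\<integral>\<^sup>+g. f (g i) \<partial>Pi\<^sub>M (UNIV :: 'n::finite set) (\<lambda>_. dV)) = c * (\<integral>\<^sup>+y. f y \<partial>dV)"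
proof (intro exI conjI allI impI)
  interpret product_sigma_finite "\<lambda>_::'n. dV" by (rule product_sigma_finite_dV)
  let ?P = "Pi\<^sub>M (-{i}) (\<lambda>_. dV)"
  show "emeasure ?P (space ?P) < \<infinity>" by (rule emeasure_PiM_dV_finite)
  fix f :: "ambient \<Rightarrow> ennreal" assume [measurable]: "f \<in> borel_measurable dV"
  have U: "insert i (-{i}) = UNIV" by auto
  have "(\<integral>\<^sup>+g. f (g i) \<partial>Pi\<^sub>M (insert i (-{i})) (\<lambda>_. dV)) = (\<integral>\<^sup>+x. (\<integral>\<^sup>+y. f ((x(i := y)) i) \<partial>dV) \<partial>?P)"
    by (intro product_nn_integral_insert) (auto intro!: measurable_compose[OF measurable_component_singleton])
  also have "\<dots> = (\<integral>\<^sup>+y. f y \<partial>dV) * emeasure ?P (space ?P)" by simp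
  finally show "(\<integral>\<^sup>+g. f (g i) \<partial>Pi\<^sub>M UNIV (\<lambda>_. dV)) = emeasure ?P (space ?P) * (\<integral>\<^sup>+y. f y \<partial>dV)"
    unfolding U by (simp add: mult.commute)
qed

lemma nn_integral_PiM_dV_pair:
  assumes "i \<noteq> j"
  shows "\<exists>c<\<infinity>. \<forall>f. case_prod f \<in> borel_measurable (dV \<Otimes>\<^sub>M dV) \<longrightarrow>
    (\<integral>\<^sup>+g. f (g i) (g j) \<partial>Pi\<^sub>M (UNIV :: 'n::finite set) (\<lambda>_. dV)) = c * (\<integral>\<^sup>+y. \<integral>\<^sup>+y'. f y y' \<partial>dV \<partial>dV)"
proof (intro exI conjI allI impI)
  interpret product_sigma_finite "\<lambda>_::'n. dV" by (rule product_sigma_finite_dV)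
  interpret dV: finite_measure dV by (rule finite_measure_dV)
  let ?P = "Pi\<^sub>M (-{i, j}) (\<lambda>_. dV)"
  let ?Q = "Pi\<^sub>M (insert i (-{i, j})) (\<lambda>_. dV)"
  show "emeasure ?P (space ?P) < \<infinity>" by (rule emeasure_PiM_dV_finite)
  fix f :: "ambient \<Rightarrow> ambient \<Rightarrow> ennreal" assume f[measurable]: "case_prod f \<in> borel_measurable (dV \<Otimes>\<^sub>M dV)"
  have U: "insert j (insert i (-{i, j})) = UNIV" by auto
  have m: "(\<lambda>g. f (g i) (g j)) \<in> borel_measurable (Pi\<^sub>M (insert j (insert i (-{i, j}))) (\<lambda>_. dV))"
    by measurable
  have "(\<integral>\<^sup>+g. f (g i) (g j) \<partial>Pi\<^sub>M (insert j (insert i (-{i, j}))) (\<lambda>_. dV))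
      = (\<integral>\<^sup>+x. (\<integral>\<^sup>+y'. f ((x(j := y')) i) ((x(j := y')) j) \<partial>dV) \<partial>?Q)"
    using assms m by (intro product_nn_integral_insert) auto
  also have "\<dots> = (\<integral>\<^sup>+x. (\<integral>\<^sup>+y'. f (x i) y' \<partial>dV) \<partial>?Q)" using assms by simp
  also have "\<dots> = (\<integral>\<^sup>+x. (\<integral>\<^sup>+y. \<integral>\<^sup>+y'. f ((x(i := y)) i) y' \<partial>dV \<partial>dV) \<partial>?P)"
    by (intro product_nn_integral_insert) auto
  also have "\<dots> = (\<integral>\<^sup>+y. \<integral>\<^sup>+y'. f y y' \<partial>dV \<partial>dV) * emeasure ?P (space ?P)" by simp
  finally show "(\<integral>\<^sup>+g. f (g i) (g j) \<partial>Pi\<^sub>M UNIV (\<lambda>_. dV))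
      = emeasure ?P (space ?P) * (\<integral>\<^sup>+y. \<integral>\<^sup>+y'. f y y' \<partial>dV \<partial>dV)"
    unfolding U by (simp add: mult.commute)
qed

lemma conf_space_borel[measurable]: "(conf_space :: (ambient ^ 'n::finite) set) \<in> sets borel"
proof -
  have A: "closed (\<Inter>i. {x :: ambient ^ 'n. x $ i \<in> CP1})"
    by (intro closed_INT ballI closed_vimage[unfolded vimage_def] closed_CP1 continuous_intros)
  have B: "open (\<Inter>i. \<Inter>j\<in>-{i}. {x :: ambient ^ 'n. x $ i \<noteq> x $ j})"
    by (intro open_INT finite_class.finite ballI finite_subset[OF subset_UNIV] open_Collect_neq continuous_intros)
  have E: "conf_space = (\<Inter>i. {x :: ambient ^ 'n. x $ i \<in> CP1}) \<inter> (\<Inter>i. \<Inter>j\<in>-{i}. {x. x $ i \<noteq> x $ j})"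
    by (auto simp: conf_space_def inj_def)
  show ?thesis unfolding E by (intro sets.Int borel_closed[OF A] borel_open[OF B])
qed

lemma space_conf_measure: "space conf_measure = (conf_space :: (ambient ^ 'n::finite) set)"
  by (simp add: conf_measure_def)

lemma nn_integral_conf_measure_le:
  fixes h :: "ambient ^ 'n::finite \<Rightarrow> ennreal"
  assumes [measurable]: "h \<in> borel_measurable borel"
  shows "(\<integral>\<^sup>+x. h x \<partial>conf_measure) \<le> (\<integral>\<^sup>+g. h (\<chi> i. g i) \<partial>Pi\<^sub>M UNIV (\<lambda>_. dV))"
proof -
  have "(\<integral>\<^sup>+x. h x \<partial>conf_measure)
      = (\<integral>\<^sup>+x. h x * indicator conf_space x \<partial>distr (Pi\<^sub>M UNIV (\<lambda>_. dV)) borel (\<lambda>f. \<chi> i. f i))"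
    unfolding conf_measure_def by (rule nn_integral_restrict_space) simp
  also have "\<dots> = (\<integral>\<^sup>+g. h (\<chi> i. g i) * indicator conf_space (\<chi> i. g i) \<partial>Pi\<^sub>M UNIV (\<lambda>_. dV))"
    by (rule nn_integral_distr) (auto intro: measurable_vec_dV)
  also have "\<dots> \<le> (\<integral>\<^sup>+g. h (\<chi> i. g i) \<partial>Pi\<^sub>M UNIV (\<lambda>_. dV))"
    by (intro nn_integral_mono) (auto simp: indicator_def)
  finally show ?thesis .
qed

lemma measurable_conf_measure: "h \<in> borel_measurable borel \<Longrightarrow> h \<in> borel_measurable conf_measure"
  unfolding conf_measure_def by (intro measurable_restrict_space1) simp

lemma measurable_vec_nth[measurable]: "(\<lambda>x :: 'b::euclidean_space ^ 'n::finite. x $ i) \<in> borel_measurable borel"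
  by (intro borel_measurable_continuous_onI continuous_intros)

lemma AE_conf_component:
  fixes i :: "'n::finite"
  assumes "AE y in dV. Q y" shows "AE x in conf_measure. Q (x $ i)"
proof -
  obtain N where N: "{y\<in>space dV. \<not> Q y} \<subseteq> N" "emeasure dV N = 0" "N \<in> sets dV"
    using assms by (rule AE_E)
  have NB[measurable]: "N \<in> sets borel"
    using N(3) unfolding sets_dV by (simp add: sets_restrict_space_iff)
  obtain c where c: "\<And>f. f \<in> borel_measurable dV \<Longrightarrow>
    (\<integral>\<^sup>+g. f (g i) \<partial>Pi\<^sub>M (UNIV :: 'n set) (\<lambda>_. dV)) = c * (\<integral>\<^sup>+y. f y \<partial>dV)"
    using nn_integral_PiM_dV_component[of i] by blast
  have "(\<integral>\<^sup>+(x :: ambient ^ 'n). indicator N (x $ i) \<partial>conf_measure)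
      \<le> (\<integral>\<^sup>+g. indicator N (((\<chi> k. g k) :: ambient ^ 'n) $ i) \<partial>Pi\<^sub>M UNIV (\<lambda>_. dV))"
    by (rule nn_integral_conf_measure_le) measurable
  also have "\<dots> = c * (\<integral>\<^sup>+y. indicator N y \<partial>dV)" using N(3) by (simp add: c)
  also have "\<dots> = 0" using N by simp
  finally have "(\<integral>\<^sup>+(x :: ambient ^ 'n). indicator N (x $ i) \<partial>conf_measure) = 0" by simp
  then have "AE (x :: ambient ^ 'n) in conf_measure. (indicator N (x $ i) :: ennreal) = 0"
    by (subst (asm) nn_integral_0_iff_AE) (auto intro!: measurable_conf_measure)
  then show ?thesis
  proof (rule AE_mp[OF _ AE_I2], intro impI)
    fix x :: "ambient ^ 'n" assume "x \<in> space conf_measure" "(indicator N (x $ i) :: ennreal) = 0"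
    then have "x $ i \<in> CP1" "x $ i \<notin> N"
      by (auto simp: space_conf_measure conf_space_def indicator_eq_0_iff)
    then show "Q (x $ i)" using N(1) by (auto simp: space_dV)
  qed
qed

text \<open>Tonelli in the two coordinates: every slice of the bad set is null, and the remaining
  coordinates only contribute a constant factor.\<close>

lemma AE_conf_pair:
  fixes i :: "'n::finite"
  assumes "i \<noteq> j" and P: "{(y, y'). P y y'} \<in> sets borel" and AE: "\<And>y. AE y' in dV. P y y'"
  shows "AE x in conf_measure. P (x $ i) (x $ j)"
proof -
  let ?N = "- {(y, y'). P y y'}"
  have N[measurable]: "?N \<in> sets borel" using P by (metis borel_comp)
  let ?f = "\<lambda>y y'. indicator ?N (y, y') :: ennreal"
  obtain c where c: "\<And>f. case_prod f \<in> borel_measurable (dV \<Otimes>\<^sub>M dV) \<Longrightarrow>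
    (\<integral>\<^sup>+g. f (g i) (g j) \<partial>Pi\<^sub>M (UNIV :: 'n set) (\<lambda>_. dV)) = c * (\<integral>\<^sup>+y. \<integral>\<^sup>+y'. f y y' \<partial>dV \<partial>dV)"
    using nn_integral_PiM_dV_pair[OF assms(1)] by blast
  have id: "(\<lambda>y. y) \<in> borel_measurable dV" by (rule measurable_from_dV) simp
  have "(\<lambda>z. (fst z, snd z)) \<in> measurable (dV \<Otimes>\<^sub>M dV) ((borel :: ambient measure) \<Otimes>\<^sub>M (borel :: ambient measure))"
    by (intro measurable_Pair measurable_compose[OF measurable_fst id] measurable_compose[OF measurable_snd id])
  then have pm: "(\<lambda>z. (fst z, snd z)) \<in> measurable (dV \<Otimes>\<^sub>M dV) (borel :: (ambient \<times> ambient) measure)"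
    unfolding borel_prod .
  have "(\<integral>\<^sup>+(x :: ambient ^ 'n). ?f (x $ i) (x $ j) \<partial>conf_measure)
      \<le> (\<integral>\<^sup>+g. ?f (((\<chi> k. g k) :: ambient ^ 'n) $ i) (((\<chi> k. g k) :: ambient ^ 'n) $ j) \<partial>Pi\<^sub>M UNIV (\<lambda>_. dV))"
    by (rule nn_integral_conf_measure_le) measurable
  also have "\<dots> = (\<integral>\<^sup>+g. ?f (g i) (g j) \<partial>Pi\<^sub>M UNIV (\<lambda>_. dV))" by simp
  also have "\<dots> = c * (\<integral>\<^sup>+y. \<integral>\<^sup>+y'. ?f y y' \<partial>dV \<partial>dV)"
  proof (rule c)
    have "(\<lambda>z. indicator ?N (fst z, snd z) :: ennreal) \<in> borel_measurable (dV \<Otimes>\<^sub>M dV)"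
      by (rule measurable_compose[OF pm borel_measurable_indicator[OF N]])
    then show "case_prod ?f \<in> borel_measurable (dV \<Otimes>\<^sub>M dV)" by (simp add: case_prod_beta')
  qed
  also have "\<dots> = c * (\<integral>\<^sup>+(y::ambient). 0 \<partial>dV)"
  proof -
    have "(\<integral>\<^sup>+y'. ?f y y' \<partial>dV) = 0" for y
    proof -
      have "(\<integral>\<^sup>+y'. ?f y y' \<partial>dV) = (\<integral>\<^sup>+(y'::ambient). 0 \<partial>dV)"
        using AE[of y] by (intro nn_integral_cong_AE) (auto elim!: eventually_mono)
      then show ?thesis by simp
    qed
    then show ?thesis by simp
  qed
  finally have "(\<integral>\<^sup>+(x :: ambient ^ 'n). ?f (x $ i) (x $ j) \<partial>conf_measure) = 0" by simp
  then have "AE (x :: ambient ^ 'n) in conf_measure. ?f (x $ i) (x $ j) = 0"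
    by (subst (asm) nn_integral_0_iff_AE) (auto intro!: measurable_conf_measure)
  then show ?thesis by eventually_elim (auto simp: indicator_eq_0_iff)
qed

text \<open>For a non-integrable \<open>f\<close> the integral has the default value 0, which
  satisfies the bound because \<open>B\<close> is nonnegative. The braid integrand can therefore be
  controlled through its majorant alone.\<close>

lemma integral_bound_nonneg:
  fixes f :: "'a \<Rightarrow> real" and H :: "'a \<Rightarrow> ennreal"
  assumes "AE x in M. ennreal \<bar>f x\<bar> \<le> H x" and "(\<integral>\<^sup>+x. H x \<partial>M) \<le> ennreal B" and "0 \<le> B"
  shows "\<bar>LINT x|M. f x\<bar> \<le> B"
proof (cases "integrable M f")
  case True
  have "ennreal \<bar>LINT x|M. f x\<bar> \<le> (\<integral>\<^sup>+x. ennreal \<bar>f x\<bar> \<partial>M)"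
    using integral_norm_bound_ennreal[OF True] by simp
  also have "\<dots> \<le> (\<integral>\<^sup>+x. H x \<partial>M)" by (rule nn_integral_mono_AE[OF assms(1)])
  also have "\<dots> \<le> ennreal B" by (rule assms(2))
  finally show ?thesis using assms(3) by simp
qed (simp add: not_integrable_integral_eq assms(3))

section \<open>The averaged rate of rotation\<close>

context area_isotopy
begin

text \<open>Constant values off \<open>{0..1} \<times> CP1\<close> make \<open>flow\<close> and
  \<open>speed\<close> Borel on the whole space, so that \<open>rate\<close> can be integrated over
  time and configurations in either order.\<close>

definition flow :: "real \<times> ambient \<Rightarrow> ambient" where
  "flow q = (if q \<in> {0..1} \<times> CP1 then \<phi> (fst q) (snd q) else (0, 1))"

definition speed :: "real \<times> ambient \<Rightarrow> real" where
  "speed q = (if q \<in> {0..1} \<times> CP1 then norm (velocity \<phi> (fst q) (snd q)) else 0)"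

text \<open>The chart speed of the first point divided by the distance to the second;
  \<open>1 + (cmod z)^2\<close> converts the Fubini-Study norm into the Euclidean one. Only the
  first point contributes a velocity, so the second can be averaged against the bare kernel.\<close>

definition rate :: "real \<Rightarrow> ambient \<Rightarrow> ambient \<Rightarrow> real" where
  "rate t y y' = (1 + (cmod (chart (flow (t, y))))\<^sup>2) * speed (t, y)
      * (1 / cmod (chart (flow (t, y)) - chart (flow (t, y'))))"

lemma domain_borel: "{0..1::real} \<times> CP1 \<in> sets borel"
  by (intro borel_closed closed_Times closed_CP1) auto

lemma measurable_flow[measurable]: "flow \<in> borel_measurable borel"
  unfolding flow_def[abs_def] using continuous
  by (intro borel_measurable_continuous_on_if domain_borel) (auto simp: case_prod_beta')

lemma measurable_speed[measurable]: "speed \<in> borel_measurable borel"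
  unfolding speed_def[abs_def] using continuous_velocity
  by (intro borel_measurable_continuous_on_if domain_borel continuous_on_norm) (auto simp: case_prod_beta')

lemma speed_nonneg: "0 \<le> speed q" by (simp add: speed_def)

lemma rate_nonneg: "0 \<le> rate t y y'" by (simp add: rate_def speed_nonneg)

lemma measurable_Pair_borel[measurable (raw)]:
  fixes f :: "'a \<Rightarrow> 'b::second_countable_topology" and g :: "'a \<Rightarrow> 'c::second_countable_topology"
  assumes "f \<in> borel_measurable M" "g \<in> borel_measurable M"
  shows "(\<lambda>x. (f x, g x)) \<in> borel_measurable M"
  using assms by (rule borel_measurable_Pair)

lemma measurable_rate[measurable (raw)]:
  assumes [measurable]: "f \<in> borel_measurable M" "g \<in> borel_measurable M" "h \<in> borel_measurable M"
  shows "(\<lambda>x. rate (f x) (g x) (h x)) \<in> borel_measurable M"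
proof -
  have [measurable]: "(\<lambda>x. flow (f x, g x)) \<in> borel_measurable M" "(\<lambda>x. flow (f x, h x)) \<in> borel_measurable M"
    "(\<lambda>x. speed (f x, g x)) \<in> borel_measurable M"
    by (rule measurable_compose[OF measurable_Pair_borel[OF assms(1,2)] measurable_flow]
      measurable_compose[OF measurable_Pair_borel[OF assms(1,3)] measurable_flow]
      measurable_compose[OF measurable_Pair_borel[OF assms(1,2)] measurable_speed])+
  show ?thesis unfolding rate_def by measurable
qed

lemma flow_eq: "t \<in> {0..1} \<Longrightarrow> y \<in> CP1 \<Longrightarrow> flow (t, y) = \<phi> t y"
  by (simp add: flow_def)

lemma speed_eq: "t \<in> {0..1} \<Longrightarrow> y \<in> CP1 \<Longrightarrow> speed (t, y) = norm (generating_field \<phi> t (\<phi> t y))"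
  by (simp add: speed_def generating_field_eq)

lemma id_measurable_dV[measurable]: "(\<lambda>y. y) \<in> borel_measurable dV" "(\<lambda>y. (t :: real, y)) \<in> borel_measurable dV"
  using measurable_Pair_borel[of "\<lambda>_. t" borel "\<lambda>y :: ambient. y"]
  by (simp_all add: measurable_from_dV)

text \<open>At time \<open>t\<close> the field is \<open>velocity\<close> composed with the inverse
  diffeomorphism, hence continuous on the sphere.\<close>

lemma measurable_generating_field:
  assumes t: "t \<in> {0..1}"
  shows "(\<lambda>x. norm (generating_field \<phi> t x)) \<in> borel_measurable dV"
proof (intro continuous_on_measurable_dV continuous_on_norm)
  have inv: "inv_into CP1 (\<phi> t) x \<in> CP1" "\<phi> t (inv_into CP1 (\<phi> t) x) = x" if "x \<in> CP1" for x
    using diffeo(1)[OF t] that by (metis bij_betw_def inv_into_into, metis bij_betw_inv_into_right)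
  have "continuous_on CP1 (\<lambda>x. velocity \<phi> t (inv_into CP1 (\<phi> t) x))"
  proof -
    have "(\<lambda>x. (t, inv_into CP1 (\<phi> t) x)) ` CP1 \<subseteq> {0..1} \<times> CP1" using inv(1) t by blast
    from continuous_on_compose2[OF continuous_velocity continuous_on_Pair[OF continuous_on_const diffeo(3)[OF t]] this]
    show ?thesis by simp
  qed
  then show "continuous_on CP1 (\<lambda>x. generating_field \<phi> t x)"
    using generating_field_eq[OF t inv(1)] inv(2) by (subst continuous_on_cong) auto
qed

text \<open>The \<open>p\<close>-th power of the \<open>L^p\<close> norm of the field at time
  \<open>t\<close>, integrated over starting points. Area preservation identifies it with the
  integral over current positions in \<open>Lp_length_eq\<close>.\<close>

definition energy :: "real \<Rightarrow> real \<Rightarrow> real" where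
  "energy p t = (LINT y|dV. speed (t, y) powr p)"

lemma nn_energy:
  assumes "t \<in> {0..1}" "p > 0"
  shows "(\<integral>\<^sup>+y. ennreal (speed (t, y) powr p) \<partial>dV) = ennreal (energy p t)" (is ?A)
    and "0 \<le> energy p t"
proof -
  obtain L where L: "L > 0" "\<And>t x. t \<in> {0..1} \<Longrightarrow> x \<in> CP1 \<Longrightarrow> norm (velocity \<phi> t x) \<le> L"
    using velocity_bounded by blast
  interpret finite_measure dV by (rule finite_measure_dV)
  have "speed (t, y) powr p \<le> L powr p" for y
    using L assms by (intro powr_mono2 speed_nonneg) (auto simp: speed_def)
  then have "integrable dV (\<lambda>y. speed (t, y) powr p)"
    by (intro integrable_const_bound[where B = "L powr p"]) auto
  then show ?A unfolding energy_def by (intro nn_integral_eq_integral) auto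
  show "0 \<le> energy p t" unfolding energy_def by (intro integral_nonneg_AE) auto
qed

lemma energy_bounded: assumes "p > 0" shows "\<exists>B. \<forall>t\<in>{0..1}. energy p t \<le> B"
proof -
  obtain L where L: "L > 0" "\<And>t x. t \<in> {0..1} \<Longrightarrow> x \<in> CP1 \<Longrightarrow> norm (velocity \<phi> t x) \<le> L"
    using velocity_bounded by blast
  interpret finite_measure dV by (rule finite_measure_dV)
  have "energy p t \<le> L powr p * measure dV (space dV)" if t: "t \<in> {0..1}" for t
  proof -
    have "ennreal (energy p t) \<le> (\<integral>\<^sup>+y. ennreal (L powr p) \<partial>dV)"
      unfolding nn_energy(1)[OF t assms, symmetric]
      using L assms t by (intro nn_integral_mono ennreal_leI powr_mono2 speed_nonneg) (auto simp: speed_def)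
    also have "\<dots> = ennreal (L powr p * measure dV (space dV))"
      by (simp add: emeasure_eq_measure ennreal_mult)
    finally show ?thesis by simp
  qed
  then show ?thesis by blast
qed

lemma Lp_length_eq: "Lp_length p \<phi> = integral {0..1} (\<lambda>t. energy p t powr (1 / p))"
  unfolding Lp_length_def
proof (rule Henstock_Kurzweil_Integration.integral_cong)
  fix t :: real assume t: "t \<in> {0..1}"
  note [measurable] = measurable_generating_field[OF t] measurable_map[OF t]
  have "(LINT x|dV. norm (generating_field \<phi> t x) powr p)
      = (LINT x|distr dV dV (\<phi> t). norm (generating_field \<phi> t x) powr p)"
    by (simp add: diffeo(4)[OF t])
  also have "\<dots> = (LINT y|dV. norm (generating_field \<phi> t (\<phi> t y)) powr p)"
    by (rule integral_distr) measurable
  also have "\<dots> = energy p t"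
    unfolding energy_def using t by (intro Bochner_Integration.integral_cong) (auto simp: speed_eq space_dV)
  finally show "(LINT x|dV. norm (generating_field \<phi> t x) powr p) powr (1 / p) = energy p t powr (1 / p)"
    by simp
qed

lemma measurable_energy[measurable]: "energy p \<in> borel_measurable borel"
proof -
  interpret finite_measure dV by (rule finite_measure_dV)
  have "(\<lambda>q. (fst q, snd q)) \<in> borel_measurable ((borel :: real measure) \<Otimes>\<^sub>M dV)"
    by (intro borel_measurable_Pair measurable_compose[OF measurable_snd id_measurable_dV(1)]) auto
  then have "(\<lambda>q. speed (fst q, snd q) powr p) \<in> borel_measurable (borel \<Otimes>\<^sub>M dV)"
    by (intro powr_real_measurable measurable_compose[OF _ measurable_speed]) auto
  then show ?thesis unfolding energy_def
    by (intro borel_measurable_lebesgue_integral) (simp add: case_prod_beta')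
qed

text \<open>The speed is bounded, so the integrand is integrable over the unit interval. The 1 added
  to it keeps the normaliser \<open>N\<close> in \<open>rate_space_bound\<close> positive and
  integrates to the 1 next to the length.\<close>

lemma nn_integral_energy:
  assumes "p > 0"
  shows "(\<integral>\<^sup>+t. ennreal (energy p t powr (1 / p) + 1) * indicator {0..1} t \<partial>lborel) = ennreal (Lp_length p \<phi> + 1)"
    and "0 \<le> Lp_length p \<phi>"
proof -
  obtain B where B: "\<And>t. t \<in> {0..1} \<Longrightarrow> energy p t \<le> B" using energy_bounded[OF assms] by blast
  let ?g = "\<lambda>t. energy p t powr (1 / p)"
  have b: "?g t \<le> B powr (1 / p)" if "t \<in> {0..1}" for t
    using B[OF that] nn_energy(2)[OF that assms] assms by (intro powr_mono2) auto
  have "set_integrable lborel {0..1} ?g"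
    unfolding set_integrable_def
  proof (rule Bochner_Integration.integrable_bound)
    show "integrable lborel (\<lambda>t::real. indicator {0..1} t *\<^sub>R B powr (1 / p))"
      by (intro integrable_scaleR_left integrable_real_indicator) auto
    show "AE t in lborel. norm (indicator {0..1} t *\<^sub>R ?g t) \<le> norm (indicator {0..1} t *\<^sub>R B powr (1 / p))"
      using b by (intro AE_I2) (simp split: split_indicator)
  qed simp
  then have int: "?g integrable_on {0..1}" by (rule set_borel_integral_eq_integral(1))
  then show "0 \<le> Lp_length p \<phi>" unfolding Lp_length_eq by (intro integral_nonneg) auto
  have "((\<lambda>t. ?g t + 1) has_integral (Lp_length p \<phi> + 1)) {0..1}"
    unfolding Lp_length_eq using has_integral_add[OF integrable_integral[OF int] has_integral_const_real[of 1 0 1]] by simp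
  then show "(\<integral>\<^sup>+t. ennreal (?g t + 1) * indicator {0..1} t \<partial>lborel) = ennreal (Lp_length p \<phi> + 1)"
    by (intro nn_integral_has_integral_lebesgue') auto
qed

end

section \<open>Averages of the rotation rate over pairs of points and over time\<close>

text \<open>With \<open>y\<close> fixed, area preservation turns the image of \<open>y'\<close> into
  a free point of the sphere, and the kernel bound lowers the factor \<open>1 + (cmod z)^2\<close>
  to a multiple of \<open>1 + cmod z\<close>. Area preservation in \<open>y\<close> then reduces the
  rest to \<open>weighted_Lp_bound\<close>. Both constants are fixed before the isotopy.\<close>

lemma rate_space_bound:
  assumes "p > 2"
  shows "\<exists>K<\<infinity>. \<forall>\<phi>. diffeo_path \<phi> \<longrightarrow> (\<forall>t\<in>{0..1}.
    (\<integral>\<^sup>+y. \<integral>\<^sup>+y'. ennreal (area_isotopy.rate \<phi> t y y') \<partial>dV \<partial>dV)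
      \<le> K * ennreal (area_isotopy.energy \<phi> p t powr (1 / p) + 1))"
proof -
  obtain K1 where K1: "K1 < \<infinity>"
    "\<And>z. (\<integral>\<^sup>+y. ennreal (1 / cmod (z - chart y)) \<partial>dV) \<le> K1 * ennreal (1 / (1 + cmod z))"
    using kernel_bound_dV by blast
  obtain K2 where K2: "K2 < \<infinity>" "\<And>h N. h \<in> borel_measurable dV \<Longrightarrow> (\<forall>y. 0 \<le> h y) \<Longrightarrow> N > 0 \<Longrightarrow>
    (\<integral>\<^sup>+y. ennreal (h y powr p) \<partial>dV) \<le> ennreal (N powr p) \<Longrightarrow>
    (\<integral>\<^sup>+y. ennreal ((1 + cmod (chart y)) * h y) \<partial>dV) \<le> K2 * ennreal N"
    using weighted_Lp_bound[OF assms] by blast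
  have "(\<integral>\<^sup>+y. \<integral>\<^sup>+y'. ennreal (area_isotopy.rate \<phi> t y y') \<partial>dV \<partial>dV)
      \<le> K1 * K2 * ennreal (area_isotopy.energy \<phi> p t powr (1 / p) + 1)"
    if phi: "diffeo_path \<phi>" and t: "t \<in> {0..1}" for \<phi> t
  proof -
    interpret area_isotopy \<phi> by (rule area_isotopy.intro[OF phi])
    let ?h = "\<lambda>x. norm (generating_field \<phi> t x)"
    define N where "N = energy p t powr (1 / p) + 1"
    have N: "N > 0" unfolding N_def by (simp add: add_nonneg_pos)
    have p: "p > 0" using assms by simp
    note [measurable] = measurable_generating_field[OF t]
    have chart_dV[measurable]: "chart \<in> borel_measurable dV" by (rule measurable_from_dV) simp
    have inner: "(\<integral>\<^sup>+y'. ennreal (rate t y y') \<partial>dV)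
        \<le> K1 * ennreal ((1 + cmod (chart (\<phi> t y))) * ?h (\<phi> t y))" if y: "y \<in> CP1" for y
    proof -
      define z where "z = chart (\<phi> t y)"
      define w where "w = (1 + (cmod z)\<^sup>2) * ?h (\<phi> t y)"
      have w: "w \<ge> 0" by (simp add: w_def)
      have "(\<integral>\<^sup>+y'. ennreal (rate t y y') \<partial>dV) = (\<integral>\<^sup>+y'. ennreal w * ennreal (1 / cmod (z - chart (\<phi> t y'))) \<partial>dV)"
        using w t y by (intro nn_integral_cong)
          (simp add: rate_def flow_eq speed_eq space_dV w_def z_def ennreal_mult[symmetric])
      also have "\<dots> = (\<integral>\<^sup>+y'. ennreal w * ennreal (1 / cmod (z - chart y')) \<partial>dV)"
        by (rule nn_integral_preserved[OF t, of "\<lambda>y'. ennreal w * ennreal (1 / cmod (z - chart y'))"]) measurable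
      also have "\<dots> = ennreal w * (\<integral>\<^sup>+y'. ennreal (1 / cmod (z - chart y')) \<partial>dV)"
        by (rule nn_integral_cmult) measurable
      also have "\<dots> \<le> ennreal w * (K1 * ennreal (1 / (1 + cmod z)))"
        by (intro mult_left_mono K1) auto
      also have "\<dots> = K1 * ennreal (w * (1 / (1 + cmod z)))"
      proof -
        have "ennreal (w * (1 / (1 + cmod z))) = ennreal w * ennreal (1 / (1 + cmod z))"
          using w by (intro ennreal_mult) auto
        then show ?thesis by (simp only: mult.left_commute)
      qed
      also have "\<dots> \<le> K1 * ennreal ((1 + cmod z) * ?h (\<phi> t y))"
      proof (intro mult_left_mono ennreal_leI)
        have "1 + (cmod z)\<^sup>2 \<le> (1 + cmod z) * (1 + cmod z)" by (simp add: power2_eq_square algebra_simps)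
        then have "w \<le> (1 + cmod z) * (1 + cmod z) * ?h (\<phi> t y)"
          unfolding w_def by (intro mult_right_mono) auto
        then show "w * (1 / (1 + cmod z)) \<le> (1 + cmod z) * ?h (\<phi> t y)"
          using one_le_one_plus_cmod(2)[of z] by (simp add: pos_divide_le_eq mult_ac)
      qed simp
      finally show ?thesis by (simp add: z_def)
    qed
    have "(\<integral>\<^sup>+y. \<integral>\<^sup>+y'. ennreal (rate t y y') \<partial>dV \<partial>dV)
        \<le> (\<integral>\<^sup>+y. K1 * ennreal ((1 + cmod (chart (\<phi> t y))) * ?h (\<phi> t y)) \<partial>dV)"
      by (intro nn_integral_mono inner) (simp add: space_dV)
    also have "\<dots> = (\<integral>\<^sup>+x. K1 * ennreal ((1 + cmod (chart x)) * ?h x) \<partial>dV)"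
      by (rule nn_integral_preserved[OF t, of "\<lambda>x. K1 * ennreal ((1 + cmod (chart x)) * ?h x)"]) measurable
    also have "\<dots> = K1 * (\<integral>\<^sup>+x. ennreal ((1 + cmod (chart x)) * ?h x) \<partial>dV)"
      by (rule nn_integral_cmult) measurable
    also have "(\<integral>\<^sup>+x. ennreal ((1 + cmod (chart x)) * ?h x) \<partial>dV) \<le> K2 * ennreal N"
    proof (rule K2(2)[OF measurable_generating_field[OF t] _ N])
      have "(\<integral>\<^sup>+x. ennreal (?h x powr p) \<partial>dV) = (\<integral>\<^sup>+y. ennreal (?h (\<phi> t y) powr p) \<partial>dV)"
        by (rule nn_integral_preserved[OF t, of "\<lambda>x. ennreal (?h x powr p)", symmetric]) measurable
      also have "\<dots> = (\<integral>\<^sup>+y. ennreal (speed (t, y) powr p) \<partial>dV)"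
        using t by (intro nn_integral_cong) (simp add: speed_eq space_dV)
      also have "\<dots> = ennreal (energy p t)" by (rule nn_energy(1)[OF t p])
      also have "\<dots> \<le> ennreal (N powr p)"
      proof (rule ennreal_leI)
        have "energy p t = (energy p t powr (1 / p)) powr p"
          using p nn_energy(2)[OF t p] by (simp add: powr_powr)
        also have "\<dots> \<le> N powr p" using p by (intro powr_mono2) (auto simp: N_def)
        finally show "energy p t \<le> N powr p" .
      qed
      finally show "(\<integral>\<^sup>+x. ennreal (?h x powr p) \<partial>dV) \<le> ennreal (N powr p)" .
    qed simp
    finally show ?thesis by (simp add: N_def mult.assoc mult_left_mono)
  qed
  moreover have "K1 * K2 < \<infinity>" using K1 K2 by (simp add: ennreal_mult_less_top)
  ultimately show ?thesis by blast
qed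

text \<open>Tonelli twice: the time integral is first moved past \<open>y'\<close>, then past
  \<open>y\<close>.\<close>

lemma (in area_isotopy) nn_integral_rate_swap:
  "(\<integral>\<^sup>+y. \<integral>\<^sup>+y'. (\<integral>\<^sup>+t. ennreal (rate t y y') * indicator {0..1} t \<partial>lborel) \<partial>dV \<partial>dV)
    = (\<integral>\<^sup>+t. (\<integral>\<^sup>+y. \<integral>\<^sup>+y'. ennreal (rate t y y') \<partial>dV \<partial>dV) * indicator {0..1::real} t \<partial>lborel)"
proof -
  interpret dV: finite_measure dV by (rule finite_measure_dV)
  interpret L: pair_sigma_finite lborel dV
    by (intro pair_sigma_finite.intro sigma_finite_lborel dV.sigma_finite_measure_axioms)
  note id = id_measurable_dV(1)
  have m1: "(\<lambda>(t, y'). ennreal (rate t y y') * indicator {0..1} t) \<in> borel_measurable (lborel \<Otimes>\<^sub>M dV)" for y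
    unfolding case_prod_beta'
    by (intro borel_measurable_times_ennreal measurable_compose[OF _ measurable_ennreal] measurable_rate
        measurable_compose[OF measurable_fst] measurable_compose[OF measurable_snd id]) auto
  have m3: "(\<lambda>(q, y'). ennreal (rate (fst q) (snd q) y') * indicator {0..1} (fst q)) \<in> borel_measurable ((lborel \<Otimes>\<^sub>M dV) \<Otimes>\<^sub>M dV)"
    unfolding case_prod_beta'
    by (intro borel_measurable_times_ennreal measurable_compose[OF _ measurable_ennreal] measurable_rate
        measurable_compose[OF measurable_fst measurable_compose[OF measurable_fst]]
        measurable_compose[OF measurable_fst measurable_compose[OF measurable_snd id]]
        measurable_compose[OF measurable_snd id]) auto
  have m2: "(\<lambda>(t, y). \<integral>\<^sup>+y'. ennreal (rate t y y') * indicator {0..1} t \<partial>dV) \<in> borel_measurable (lborel \<Otimes>\<^sub>M dV)"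
    using dV.borel_measurable_nn_integral[OF m3] by (simp add: case_prod_beta')
  have "(\<integral>\<^sup>+y. \<integral>\<^sup>+y'. (\<integral>\<^sup>+t. ennreal (rate t y y') * indicator {0..1} t \<partial>lborel) \<partial>dV \<partial>dV)
      = (\<integral>\<^sup>+y. \<integral>\<^sup>+t. (\<integral>\<^sup>+y'. ennreal (rate t y y') * indicator {0..1} t \<partial>dV) \<partial>lborel \<partial>dV)"
    by (intro nn_integral_cong L.Fubini' m1)
  also have "\<dots> = (\<integral>\<^sup>+t. \<integral>\<^sup>+y. (\<integral>\<^sup>+y'. ennreal (rate t y y') * indicator {0..1} t \<partial>dV) \<partial>dV \<partial>lborel)"
    by (intro L.Fubini' m2)
  also have "\<dots> = (\<integral>\<^sup>+t. (\<integral>\<^sup>+y. \<integral>\<^sup>+y'. ennreal (rate t y y') \<partial>dV \<partial>dV) * indicator {0..1} t \<partial>lborel)"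
    by (intro nn_integral_cong) (auto split: split_indicator)
  finally show ?thesis .
qed

lemma (in area_isotopy) measurable_rate_integral:
  "(\<lambda>x :: ambient ^ 'n::finite. \<integral>\<^sup>+t. ennreal (rate t (x $ i) (x $ j)) * indicator {0..1} t \<partial>lborel)
    \<in> borel_measurable borel"
proof -
  have "(\<lambda>q. ennreal (rate (snd q) (fst q $ i) (fst q $ j)) * indicator {0..1} (snd q))
      \<in> borel_measurable ((borel :: (ambient ^ 'n) measure) \<Otimes>\<^sub>M lborel)"
    by (intro borel_measurable_times_ennreal measurable_compose[OF _ measurable_ennreal] measurable_rate
        measurable_compose[OF measurable_fst measurable_vec_nth] measurable_compose[OF measurable_snd]) auto
  then show ?thesis
    by (intro lborel.borel_measurable_nn_integral) (simp add: case_prod_beta')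
qed

lemma rate_average_bound:
  assumes "p > 2" and "i \<noteq> (j :: 'n::finite)"
  shows "\<exists>K<\<infinity>. \<forall>\<phi>. diffeo_path \<phi> \<longrightarrow>
    (\<integral>\<^sup>+(x :: ambient ^ 'n). (\<integral>\<^sup>+t. ennreal (area_isotopy.rate \<phi> t (x $ i) (x $ j)) * indicator {0..1} t \<partial>lborel) \<partial>conf_measure)
      \<le> K * ennreal (Lp_length p \<phi> + 1)"
proof -
  obtain K where K: "K < \<infinity>" "\<And>\<phi> t. diffeo_path \<phi> \<Longrightarrow> t \<in> {0..1} \<Longrightarrow>
    (\<integral>\<^sup>+y. \<integral>\<^sup>+y'. ennreal (area_isotopy.rate \<phi> t y y') \<partial>dV \<partial>dV)
      \<le> K * ennreal (area_isotopy.energy \<phi> p t powr (1 / p) + 1)"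
    using rate_space_bound[OF assms(1)] by blast
  obtain c where c: "c < \<infinity>" "\<And>f. case_prod f \<in> borel_measurable (dV \<Otimes>\<^sub>M dV) \<Longrightarrow>
    (\<integral>\<^sup>+g. f (g i) (g j) \<partial>Pi\<^sub>M (UNIV :: 'n set) (\<lambda>_. dV)) = c * (\<integral>\<^sup>+y. \<integral>\<^sup>+y'. f y y' \<partial>dV \<partial>dV)"
    using nn_integral_PiM_dV_pair[OF assms(2)] by blast
  have "(\<integral>\<^sup>+(x :: ambient ^ 'n). (\<integral>\<^sup>+t. ennreal (area_isotopy.rate \<phi> t (x $ i) (x $ j)) * indicator {0..1} t \<partial>lborel) \<partial>conf_measure)
      \<le> c * K * ennreal (Lp_length p \<phi> + 1)" if phi: "diffeo_path \<phi>" for \<phi>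
  proof -
    interpret area_isotopy \<phi> by (rule area_isotopy.intro[OF phi])
    let ?f = "\<lambda>y y'. \<integral>\<^sup>+t. ennreal (rate t y y') * indicator {0..1} t \<partial>lborel"
    have p: "p > 0" using assms by simp
    have "(\<integral>\<^sup>+(x :: ambient ^ 'n). ?f (x $ i) (x $ j) \<partial>conf_measure)
        \<le> (\<integral>\<^sup>+g. ?f (((\<chi> k. g k) :: ambient ^ 'n) $ i) (((\<chi> k. g k) :: ambient ^ 'n) $ j) \<partial>Pi\<^sub>M UNIV (\<lambda>_. dV))"
      by (rule nn_integral_conf_measure_le[OF measurable_rate_integral])
    also have "\<dots> = (\<integral>\<^sup>+g. ?f (g i) (g j) \<partial>Pi\<^sub>M (UNIV :: 'n set) (\<lambda>_. dV))" by simp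
    also have "\<dots> = c * (\<integral>\<^sup>+y. \<integral>\<^sup>+y'. ?f y y' \<partial>dV \<partial>dV)"
    proof (rule c(2))
      have "(\<lambda>q. ennreal (rate (snd q) (fst (fst q)) (snd (fst q))) * indicator {0..1} (snd q))
          \<in> borel_measurable ((dV \<Otimes>\<^sub>M dV) \<Otimes>\<^sub>M lborel)"
        by (intro borel_measurable_times_ennreal measurable_compose[OF _ measurable_ennreal] measurable_rate
            measurable_compose[OF measurable_fst measurable_compose[OF measurable_fst id_measurable_dV(1)]]
            measurable_compose[OF measurable_fst measurable_compose[OF measurable_snd id_measurable_dV(1)]]
            measurable_compose[OF measurable_snd]) auto
      then have "(\<lambda>q. ?f (fst q) (snd q)) \<in> borel_measurable (dV \<Otimes>\<^sub>M dV)"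
        by (intro lborel.borel_measurable_nn_integral) (simp add: case_prod_beta')
      then show "case_prod ?f \<in> borel_measurable (dV \<Otimes>\<^sub>M dV)" by (simp add: case_prod_beta')
    qed
    also have "(\<integral>\<^sup>+y. \<integral>\<^sup>+y'. ?f y y' \<partial>dV \<partial>dV)
        = (\<integral>\<^sup>+t. (\<integral>\<^sup>+y. \<integral>\<^sup>+y'. ennreal (rate t y y') \<partial>dV \<partial>dV) * indicator {0..1} t \<partial>lborel)"
      by (rule nn_integral_rate_swap)
    also have "\<dots> \<le> (\<integral>\<^sup>+t. K * (ennreal (energy p t powr (1 / p) + 1) * indicator {0..1} t) \<partial>lborel)"
      using K(2)[OF phi] by (intro nn_integral_mono) (auto split: split_indicator)
    also have "\<dots> = K * ennreal (Lp_length p \<phi> + 1)"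
      by (subst nn_integral_cmult) (auto simp: nn_integral_energy(1)[OF p] simp del: ennreal_plus)
    finally show ?thesis by (simp add: mult.assoc mult_left_mono)
  qed
  moreover have "c * K < \<infinity>" using c K by (simp add: ennreal_mult_less_top)
  ultimately show ?thesis by blast
qed

section \<open>The braid of a generic configuration\<close>

lemma continuous_on_u0: "continuous_on S u0"
proof -
  have "1 + (cmod z)\<^sup>2 \<noteq> 0" for z :: complex by (simp add: add_nonneg_eq_0_iff)
  moreover have "complex_of_real (1 + (cmod z)\<^sup>2) \<noteq> 0" for z :: complex
    using calculation[of z] by (metis of_real_eq_0_iff)
  ultimately show ?thesis
    unfolding u0_eq[abs_def] by (intro continuous_intros) (auto simp del: of_real_add)
qed

lemma continuous_on_basepoint: "continuous_on S basepoint"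
  unfolding basepoint_def[abs_def]
  by (intro continuous_on_vec_lambda continuous_on_compose2[OF continuous_on_u0[of UNIV]] continuous_intros) auto

lemma basepoint_conf_space: "inj (($) z) \<Longrightarrow> basepoint z \<in> conf_space"
  using inj_u0 by (auto simp: basepoint_def conf_space_def u0_in_CP1 inj_def)

text \<open>A collision of \<open>i\<close> and \<open>j\<close> at time \<open>t\<close> means
  \<open>(1 - t) * (m $ i - m $ j) = t * (z $ j - z $ i)\<close>. For \<open>t > 0\<close> this
  makes \<open>z $ j - z $ i\<close> a real multiple of \<open>m $ i - m $ j\<close>, which the
  second assumption forbids; at \<open>t = 0\<close> the points of \<open>m\<close> are
  distinct.\<close>

lemma segment_avoids_collisions:
  fixes m z :: "complex ^ 'n::finite"
  assumes "inj (($) m)" and "\<And>i j. i \<noteq> j \<Longrightarrow> Im ((z $ j - z $ i) * cnj (m $ i - m $ j)) \<noteq> 0"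
    and "t \<in> {0..1}"
  shows "inj (($) (linepath m z t))"
proof (rule injI, rule ccontr)
  fix i j assume eq: "linepath m z t $ i = linepath m z t $ j" and "i \<noteq> j"
  let ?v = "m $ i - m $ j" and ?w = "z $ j - z $ i"
  have v: "?v \<noteq> 0" using assms(1) \<open>i \<noteq> j\<close> by (auto simp: inj_def)
  have "(1 - t) *\<^sub>R ?v = t *\<^sub>R ?w"
    using eq by (simp add: linepath_def algebra_simps)
  then have *: "((1 - t) *\<^sub>R ?v) * cnj ?v = (t *\<^sub>R ?w) * cnj ?v" by simp
  have "Im (((1 - t) *\<^sub>R ?v) * cnj ?v) = 0" by (simp add: algebra_simps)
  then have "t * Im (?w * cnj ?v) = 0" unfolding * by (simp only: mult_scaleR_left scaleR_complex.sel(2))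
  then have "t = 0" using assms(2)[OF \<open>i \<noteq> j\<close>] by simp
  then show False using \<open>(1 - t) *\<^sub>R ?v = t *\<^sub>R ?w\<close> v by simp
qed

lemma straight_chain:
  fixes m z :: "complex ^ 'n::finite"
  assumes "\<And>t. t \<in> {0..1} \<Longrightarrow> inj (($) (linepath m z t))"
  shows "\<exists>k\<le>card (range (conf_cell :: ('n \<Rightarrow> 'n \<Rightarrow> bool \<times> bool) \<Rightarrow> _)).
    convex_chain (range conf_cell) k (linepath m z)"
proof -
  let ?C = "range (conf_cell :: ('n \<Rightarrow> 'n \<Rightarrow> bool \<times> bool) \<Rightarrow> _)"
  have im: "linepath m z ` {0..1} \<subseteq> \<Union>?C" unfolding Union_conf_cells using assms by blast
  then have "closed_segment m z \<subseteq> \<Union>?C" by (simp add: linepath_image_01)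
  then have "\<exists>k\<le>card ?C. convex_chain ?C k (subpath 0 1 (linepath m z))"
    using im by (intro linepath_convex_chain) (auto simp: open_conf_cell convex_conf_cell)
  then show ?thesis by simp
qed

context area_isotopy
begin

text \<open>The quotient formula for \<open>chart\<close> gives differentiability only. The norm
  comes from differentiating the identity \<open>u0 (chart (\<phi> s y)) = \<phi> s y\<close>:
  uniqueness of the derivative on an interval identifies both sides, and the conformal factor of
  \<open>u0\<close> is known.\<close>

lemma chart_velocity:
  assumes t: "t \<in> {0..1}" and y: "y \<in> CP1" and avoid: "\<And>s. s \<in> {0..1} \<Longrightarrow> \<phi> s y \<noteq> (0, 1)"
  shows "\<exists>w. ((\<lambda>s. chart (\<phi> s y)) has_vector_derivative w) (at t within {0..1}) \<and>
    cmod w = (1 + (cmod (chart (\<phi> t y)))\<^sup>2) * norm (velocity \<phi> t y)"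
proof -
  have U0: "\<phi> s y \<in> U0" if "s \<in> {0..1}" for s using maps_to[OF that y] avoid[OF that] by (simp add: U0_eq)
  obtain f' where f': "((\<lambda>s. \<phi> s y) has_derivative f') (at t within {0..1})"
    using has_velocity[OF t y] unfolding has_vector_derivative_def by blast
  have n: "complex_of_real (1 - snd (\<phi> t y)) \<noteq> 0" using snd_U0[OF U0[OF t]] by (simp del: of_real_diff)
  have "(\<lambda>s. chart (\<phi> s y)) differentiable (at t within {0..1})"
    unfolding chart_def
  proof (rule differentiable_divide)
    show "(\<lambda>s. fst (\<phi> s y)) differentiable (at t within {0..1})"
      using has_derivative_fst[OF f'] by (rule differentiableI)
    have "((\<lambda>s. complex_of_real (1 - snd (\<phi> s y))) has_derivative (\<lambda>h. of_real (0 - snd (f' h)))) (at t within {0..1})"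
      by (intro has_derivative_of_real has_derivative_diff has_derivative_const has_derivative_snd f')
    then show "(\<lambda>s. complex_of_real (1 - snd (\<phi> s y))) differentiable (at t within {0..1})"
      by (rule differentiableI)
  qed (rule n)
  then obtain w where w: "((\<lambda>s. chart (\<phi> s y)) has_vector_derivative w) (at t within {0..1})"
    using vector_derivative_works by blast
  obtain v where v: "((\<lambda>s. u0 (chart (\<phi> s y))) has_vector_derivative v) (at t within {0..1})"
    "norm v = cmod w / (1 + (cmod (chart (\<phi> t y)))\<^sup>2)"
    using u0_has_vector_derivative_norm[OF w] by blast
  have "((\<lambda>s. \<phi> s y) has_vector_derivative v) (at t within {0..1})"
    by (rule has_vector_derivative_transform[OF t _ v(1)])
      (use U0 u0_affine_coord in \<open>simp add: chart_eq_affine_coord\<close>)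
  then have "velocity \<phi> t y = v"
    unfolding velocity_def using t by (intro vector_derivative_within_closed_interval) auto
  moreover have "1 + (cmod (chart (\<phi> t y)))\<^sup>2 \<noteq> 0" by (simp add: add_nonneg_eq_0_iff)
  ultimately have "cmod w = (1 + (cmod (chart (\<phi> t y)))\<^sup>2) * norm (velocity \<phi> t y)"
    using v(2) by simp
  with w show ?thesis by blast
qed

definition trajectory :: "ambient ^ 'n::finite \<Rightarrow> real \<Rightarrow> complex ^ 'n" where
  "trajectory x t = (\<chi> i. chart (\<phi> t (x $ i)))"

text \<open>The quantity V of the overview as an extended nonnegative number. Ordered pairs occur
  because \<open>rate\<close> records the motion of one point only.\<close>

definition rotation :: "ambient ^ 'n::finite \<Rightarrow> ennreal" where
  "rotation x = (\<Sum>(i, j)\<in>{(i, j). i \<noteq> j}.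
    \<integral>\<^sup>+t. ennreal (rate t (x $ i) (x $ j)) * indicator {0..1} t \<partial>lborel)"

context
  fixes x :: "ambient ^ 'n::finite"
  assumes x: "x \<in> conf_space" and avoid: "\<And>i t. t \<in> {0..1} \<Longrightarrow> \<phi> t (x $ i) \<noteq> (0, 1)"
begin

lemma x_in_CP1: "x $ i \<in> CP1" using x by (simp add: conf_space_def)

lemma moved_in_U0: "t \<in> {0..1} \<Longrightarrow> \<phi> t (x $ i) \<in> U0"
  using maps_to x_in_CP1 avoid by (simp add: U0_eq)

lemma u0_trajectory: "t \<in> {0..1} \<Longrightarrow> u0 (trajectory x t $ i) = \<phi> t (x $ i)"
  using moved_in_U0 by (simp add: trajectory_def chart_eq_affine_coord u0_affine_coord)

lemma inj_trajectory: assumes "t \<in> {0..1}" shows "inj (($) (trajectory x t))"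
proof (rule injI)
  fix i j assume "trajectory x t $ i = trajectory x t $ j"
  then have "\<phi> t (x $ i) = \<phi> t (x $ j)" using u0_trajectory[OF assms] by metis
  then have "x $ i = x $ j"
    using diffeo(1)[OF assms] x_in_CP1 by (auto simp: bij_betw_def inj_on_def)
  then show "i = j" using x by (auto simp: conf_space_def inj_def)
qed

lemma continuous_orbit: "y \<in> CP1 \<Longrightarrow> continuous_on {0..1} (\<lambda>t. \<phi> t y)"
  "y \<in> CP1 \<Longrightarrow> continuous_on {0..1} (\<lambda>t. velocity \<phi> t y)"
proof -
  assume y: "y \<in> CP1"
  have "(\<lambda>t. (t, y)) ` {0..1} \<subseteq> {0..1} \<times> CP1" using y by blast
  note * = continuous_on_Pair[OF continuous_on_id continuous_on_const] this
  from continuous_on_compose2[OF continuous *] show "continuous_on {0..1} (\<lambda>t. \<phi> t y)" by simp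
  from continuous_on_compose2[OF continuous_velocity *] show "continuous_on {0..1} (\<lambda>t. velocity \<phi> t y)" by simp
qed

lemma continuous_trajectory: "continuous_on {0..1} (\<lambda>t. chart (\<phi> t (x $ i)))"
  unfolding chart_def using snd_U0[OF moved_in_U0]
  by (intro continuous_intros continuous_orbit x_in_CP1) (auto simp del: of_real_diff)

lemma path_trajectory: "path (trajectory x)"
  unfolding path_def trajectory_def[abs_def] by (intro continuous_on_vec_lambda continuous_trajectory)

text \<open>The relative speed of two points is at most the sum of their chart speeds. These are
  \<open>g i j t\<close> and \<open>g j i t\<close> times their distance, and both ordered pairs are
  among the summands of \<open>f\<close>. Hence \<open>f\<close> bounds the logarithmic speed of
  every difference.\<close>

lemma trajectory_chain:
  "\<exists>k. convex_chain (range conf_cell) k (trajectory x) \<and> ennreal (real k) \<le> 3 * rotation x + 1"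
proof -
  let ?O = "{(i, j). i \<noteq> j} :: ('n \<times> 'n) set"
  let ?z = "\<lambda>i t. chart (\<phi> t (x $ i))"
  define g where "g i j t = rate t (x $ i) (x $ j)" for i j t
  have geq: "g i j t = (1 + (cmod (?z i t))\<^sup>2) * norm (velocity \<phi> t (x $ i)) * (1 / cmod (?z i t - ?z j t))"
    if "t \<in> {0..1}" for i j t
    using that x_in_CP1 by (simp add: g_def rate_def speed_def flow_eq)
  have ne: "?z i t - ?z j t \<noteq> 0" if "t \<in> {0..1}" "i \<noteq> j" for i j t
    using inj_trajectory[OF that(1)] that(2) by (auto simp: inj_def trajectory_def)
  have gnn: "0 \<le> g i j t" for i j t by (simp add: g_def rate_nonneg)
  have gcont: "continuous_on {0..1} (g i j)" if "i \<noteq> j" for i j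
  proof -
    have "continuous_on {0..1} (\<lambda>t. (1 + (cmod (?z i t))\<^sup>2) * norm (velocity \<phi> t (x $ i)) * (1 / cmod (?z i t - ?z j t)))"
      using ne[OF _ that] by (intro continuous_intros continuous_trajectory continuous_orbit x_in_CP1) auto
    then show ?thesis using geq by (subst continuous_on_cong[OF refl]) auto
  qed
  define f where "f t = (\<Sum>(i, j)\<in>?O. g i j t)" for t
  have fcont: "continuous_on {0..1} f"
    unfolding f_def[abs_def] case_prod_beta' by (intro continuous_on_sum gcont) auto
  have f0: "0 \<le> f t" for t unfolding f_def by (intro sum_nonneg) (auto simp: gnn)
  have "\<exists>w. \<forall>i t. t \<in> {0..1} \<longrightarrow> (?z i has_vector_derivative w i t) (at t within {0..1}) \<and>
      cmod (w i t) = (1 + (cmod (?z i t))\<^sup>2) * norm (velocity \<phi> t (x $ i))"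
    using chart_velocity[OF _ x_in_CP1 avoid] by (intro choice allI) (metis)
  then obtain w where w: "\<And>i t. t \<in> {0..1} \<Longrightarrow> (?z i has_vector_derivative w i t) (at t within {0..1})"
    "\<And>i t. t \<in> {0..1} \<Longrightarrow> cmod (w i t) = (1 + (cmod (?z i t))\<^sup>2) * norm (velocity \<phi> t (x $ i))"
    by blast
  have "\<exists>k. convex_chain (range conf_cell) k (trajectory x) \<and> real k \<le> 3 * integral {0..1} f + 1"
  proof (rule moving_points_convex_chain[OF path_trajectory inj_trajectory _ fcont f0])
    fix i j t assume t: "t \<in> {0..1::real}" and ij: "i \<noteq> (j :: 'n)"
    show "((\<lambda>t. trajectory x t $ i - trajectory x t $ j) has_vector_derivative (w i t - w j t)) (at t within {0..1})"
      unfolding trajectory_def using w(1)[OF t] by (auto intro!: has_vector_derivative_diff)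
    have "g i j t + g j i t = (\<Sum>(i, j)\<in>{(i, j), (j, i)}. g i j t)" using ij by simp
    also have "\<dots> \<le> f t"
      unfolding f_def using ij by (intro sum_mono2) (auto simp: gnn)
    finally have "(g i j t + g j i t) * cmod (?z i t - ?z j t) \<le> f t * cmod (?z i t - ?z j t)"
      by (intro mult_right_mono) auto
    moreover have "g i j t * cmod (?z i t - ?z j t) = cmod (w i t)"
      using ne[OF t ij] by (simp add: geq[OF t] w(2)[OF t])
    moreover have "g j i t * cmod (?z i t - ?z j t) = cmod (w j t)"
      using ne[OF t ij] by (simp add: geq[OF t] w(2)[OF t] norm_minus_commute[of "?z j t"])
    moreover have "cmod (w i t - w j t) \<le> cmod (w i t) + cmod (w j t)" by (rule norm_triangle_ineq4)
    ultimately show "cmod (w i t - w j t) \<le> f t * cmod (trajectory x t $ i - trajectory x t $ j)"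
      unfolding trajectory_def by (simp add: distrib_right)
  qed
  then obtain k where k: "convex_chain (range conf_cell) k (trajectory x)" "real k \<le> 3 * integral {0..1} f + 1"
    by blast
  \<comment> \<open>The rates are continuous along a trajectory that avoids infinity, so the
    nonnegative integrals in \<open>rotation\<close> are finite and agree with the integral of
    \<open>f\<close>.\<close>
  have "rotation x = (\<Sum>(i, j)\<in>?O. ennreal (integral {0..1} (g i j)))"
    unfolding rotation_def
  proof (intro sum.cong refl, clarify)
    fix i j :: 'n assume "i \<noteq> j"
    then have "(g i j has_integral integral {0..1} (g i j)) {0..1}"
      by (intro integrable_integral integrable_continuous_interval gcont)
    then show "(\<integral>\<^sup>+t. ennreal (rate t (x $ i) (x $ j)) * indicator {0..1} t \<partial>lborel) = ennreal (integral {0..1} (g i j))"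
      unfolding g_def[symmetric] by (intro nn_integral_has_integral_lebesgue') (simp_all add: gnn)
  qed
  also have "\<dots> = ennreal (\<Sum>(i, j)\<in>?O. integral {0..1} (g i j))"
    unfolding case_prod_beta'
    by (intro sum_ennreal integral_nonneg integrable_continuous_interval gcont) (auto simp: gnn)
  also have "(\<Sum>(i, j)\<in>?O. integral {0..1} (g i j)) = integral {0..1} f"
    unfolding f_def[abs_def] case_prod_beta'
    by (intro integral_sum[symmetric] integrable_continuous_interval gcont) auto
  finally have rot: "rotation x = ennreal (integral {0..1} f)" .
  have I: "0 \<le> integral {0..1} f"
    by (intro integral_nonneg integrable_continuous_interval fcont f0)
  have "ennreal (real k) \<le> ennreal (3 * integral {0..1} f + 1)" using k(2) by (rule ennreal_leI)
  also have "\<dots> = 3 * rotation x + 1"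
    using I by (simp add: rot ennreal_mult flip: ennreal_numeral)
  finally show ?thesis using k(1) by blast
qed

text \<open>Genericity at times 0 and 1 places both end configurations in
  \<open>straight_set m\<close>, where \<open>\<gamma>\<close> is the affine path. The braid loop is
  then pointwise the image under \<open>basepoint\<close> of a planar loop \<open>P\<close>. The two
  straight legs contribute at most one piece per cell each, and the trajectory the rest.\<close>

lemma braid_loop_chain:
  fixes m :: "complex ^ 'n" and \<gamma> :: "ambient ^ 'n \<Rightarrow> real \<Rightarrow> ambient ^ 'n"
  assumes m: "inj (($) m)" and \<gamma>: "short_paths m \<gamma>"
    and generic: "\<And>t i j. t \<in> {0, 1} \<Longrightarrow> i \<noteq> j \<Longrightarrow>
      Im ((trajectory x t $ j - trajectory x t $ i) * cnj (m $ i - m $ j)) \<noteq> 0"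
  shows "\<exists>k P. convex_chain (range conf_cell) k P \<and> pathstart P = m \<and> pathfinish P = m \<and>
    path_class conf_space (braid_loop \<gamma> \<phi> x) = path_class conf_space (basepoint \<circ> P) \<and>
    ennreal (real k) \<le> 3 * rotation x
      + ennreal (1 + 2 * real (card (range (conf_cell :: ('n \<Rightarrow> 'n \<Rightarrow> bool \<times> bool) \<Rightarrow> _))))"
proof -
  let ?C = "range (conf_cell :: ('n \<Rightarrow> 'n \<Rightarrow> bool \<times> bool) \<Rightarrow> _)"
  let ?l = "\<lambda>t. linepath m (trajectory x t)"
  let ?y = "\<lambda>t. diag_action (\<phi> t) x"
  have seg: "inj (($) (?l t s))" if "t \<in> {0, 1}" "s \<in> {0..1}" for t s
    using segment_avoids_collisions[OF m generic[OF that(1)] that(2)] by blast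
  have affine: "affine_path m (?y t) s = basepoint (?l t s)" if "t \<in> {0..1}" for t s
    using moved_in_U0[OF that]
    by (simp add: affine_path_def basepoint_def linepath_def diag_action_def trajectory_def vec_eq_iff
        chart_eq_affine_coord scaleR_conv_of_real[where 'a = complex] algebra_simps)
  have short: "\<gamma> (?y t) s = basepoint (?l t s)" if t: "t \<in> {0, 1}" and s: "s \<in> {0..1}" for t s
  proof -
    have t': "t \<in> {0..1}" using t by auto
    have "?y t = basepoint (trajectory x t)"
      using u0_trajectory[OF t'] by (simp add: basepoint_def diag_action_def)
    then have "?y t \<in> conf_space" using basepoint_conf_space[OF inj_trajectory[OF t']] by simp
    then have "?y t \<in> straight_set m"
      unfolding straight_set_def conf_space_U0_def using moved_in_U0[OF t'] basepoint_conf_space[OF seg[OF t]]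
      by (auto simp: affine[OF t']) (simp add: diag_action_def)
    then have "\<gamma> (?y t) s = affine_path m (?y t) s" using \<gamma> s by (simp add: short_paths_def)
    then show ?thesis by (simp add: affine[OF t'])
  qed
  have y0: "?y 0 = x" using start x_in_CP1 by (simp add: diag_action_def vec_eq_iff)
  obtain k0 where k0: "k0 \<le> card ?C" "convex_chain ?C k0 (?l 0)"
    using straight_chain[of m "trajectory x 0"] seg[of 0] by blast
  obtain k1 where k1: "k1 \<le> card ?C" "convex_chain ?C k1 (?l 1)"
    using straight_chain[of m "trajectory x 1"] seg[of 1] by blast
  obtain k where k: "convex_chain ?C k (trajectory x)" "ennreal (real k) \<le> 3 * rotation x + 1"
    using trajectory_chain by blast
  define P where "P = (?l 0 +++ trajectory x) +++ reversepath (?l 1)"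
  have ends: "pathstart (trajectory x) = trajectory x 0" "pathfinish (trajectory x) = trajectory x 1"
    by (simp_all add: pathstart_def pathfinish_def)
  have chain: "convex_chain ?C ((k0 + k) + k1) P"
    unfolding P_def by (intro convex_chain.join convex_chain_reversepath k0 k k1)
      (simp_all add: ends)
  note P = convex_chain_path[OF chain]
  have "homotopic_paths conf_space (basepoint \<circ> P) (braid_loop \<gamma> \<phi> x)"
  proof (rule homotopic_paths_eq)
    show "path (basepoint \<circ> P)" using P(1) continuous_on_basepoint by (rule path_continuous_image)
    show "path_image (basepoint \<circ> P) \<subseteq> conf_space"
      using P(2) basepoint_conf_space unfolding path_image_compose Union_conf_cells by blast
    show "(basepoint \<circ> P) t = braid_loop \<gamma> \<phi> x t" if t: "t \<in> {0..1}" for t :: real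
    proof -
      have "\<gamma> x s = basepoint (?l 0 s)" if "s \<in> {0..1}" for s using short[of 0 s] that by (simp add: y0)
      moreover have "\<gamma> (?y 1) s = basepoint (?l 1 s)" if "s \<in> {0..1}" for s using short[of 1 s] that by simp
      moreover have "?y s = basepoint (trajectory x s)" if "s \<in> {0..1}" for s
        using u0_trajectory[OF that] by (simp add: basepoint_def diag_action_def)
      ultimately show ?thesis
        using t by (auto simp: braid_loop_def P_def joinpaths_def reversepath_def)
    qed
  qed
  then have "path_class conf_space (braid_loop \<gamma> \<phi> x) = path_class conf_space (basepoint \<circ> P)"
    by (metis path_class_eq)
  moreover have "pathstart P = m" "pathfinish P = m" by (simp_all add: P_def)
  moreover have "ennreal (real ((k0 + k) + k1)) \<le> 3 * rotation x + ennreal (1 + 2 * real (card ?C))"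
  proof -
    have "ennreal (real ((k0 + k) + k1)) = ennreal (real k + (real k0 + real k1))" by (simp add: algebra_simps)
    also have "\<dots> = ennreal (real k) + ennreal (real k0 + real k1)" by (rule ennreal_plus) auto
    also have "\<dots> \<le> (3 * rotation x + 1) + ennreal (2 * real (card ?C))"
      using k0 k1 by (intro add_mono k(2) ennreal_leI) simp
    finally show ?thesis by (simp add: add.assoc)
  qed
  ultimately show ?thesis using chain by blast
qed

end

text \<open>For a fixed first point and a fixed time, the second point must keep its image off one
  line in the chart. Area preservation pulls this null set back to time 0, and there are only
  finitely many pairs and two times.\<close>

lemma AE_generic:
  fixes m :: "complex ^ 'n::finite"
  assumes m: "inj (($) m)"
  shows "AE x in conf_measure. (\<forall>i. \<forall>t\<in>{0..1}. \<phi> t (x $ i) \<noteq> (0, 1)) \<and>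
    (\<forall>t\<in>{0, 1}. \<forall>i j. i \<noteq> j \<longrightarrow> Im ((trajectory x t $ j - trajectory x t $ i) * cnj (m $ i - m $ j)) \<noteq> 0)"
proof -
  have 1: "AE x :: ambient ^ 'n in conf_measure. \<forall>i. \<forall>t\<in>{0..1}. \<phi> t (x $ i) \<noteq> (0, 1)"
    by (subst AE_all_countable, intro allI AE_conf_component AE_avoids_infinity)
  have pair: "AE x :: ambient ^ 'n in conf_measure. i \<noteq> j \<longrightarrow>
      Im ((trajectory x t $ j - trajectory x t $ i) * cnj (m $ i - m $ j)) \<noteq> 0" if t: "t \<in> {0..1}" for i j t
  proof (cases "i = j")
    case False
    let ?v = "m $ i - m $ j"
    \<comment> \<open>Phrased with \<open>flow\<close> so that the set of good pairs is Borel in the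
      whole ambient product.\<close>
    define Q where "Q y y' \<longleftrightarrow> Im ((chart (flow (t, y')) - chart (flow (t, y))) * cnj ?v) \<noteq> 0" for y y'
    have "?v \<noteq> 0" using m False by (auto simp: inj_def)
    have fl[measurable]: "(\<lambda>q :: ambient \<times> ambient. chart (flow (t, snd q))) \<in> borel_measurable borel"
      "(\<lambda>q :: ambient \<times> ambient. chart (flow (t, fst q))) \<in> borel_measurable borel"
      by (intro measurable_compose[OF _ measurable_chart] measurable_compose[OF _ measurable_flow]
          borel_measurable_Pair borel_measurable_continuous_onI continuous_intros)+
    have "(\<lambda>q :: ambient \<times> ambient. Im ((chart (flow (t, snd q)) - chart (flow (t, fst q))) * cnj ?v)) \<in> borel_measurable borel"
      by (intro measurable_compose[OF _ borel_measurable_continuous_onI[OF continuous_on_Im[OF continuous_on_id]]]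
          borel_measurable_times borel_measurable_diff fl borel_measurable_const)
    then have "(\<lambda>q :: ambient \<times> ambient. Im ((chart (flow (t, snd q)) - chart (flow (t, fst q))) * cnj ?v)) -` (-{0}) \<inter> space borel \<in> sets borel"
      by (rule measurable_sets) (intro borel_open, auto)
    then have "{(y, y'). Q y y'} \<in> sets borel"
      by (simp add: Q_def case_prod_beta' vimage_def)
    moreover have "AE y' in dV. Q y y'" for y
    proof -
      have "AE y' in dV. Im ((chart (\<phi> t y') - chart (flow (t, y))) * cnj ?v) \<noteq> 0"
        by (rule AE_preserved[OF t AE_not_on_line[OF \<open>?v \<noteq> 0\<close>]])
      then show ?thesis
        by (rule AE_mp) (auto intro!: AE_I2 simp: Q_def flow_eq[OF t] space_dV)
    qed
    ultimately have "AE x in conf_measure. Q (x $ i) (x $ j)" by (intro AE_conf_pair False)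
    then show ?thesis
    proof (rule AE_mp[OF _ AE_I2], intro impI)
      fix x :: "ambient ^ 'n" assume "x \<in> space conf_measure" and Q: "Q (x $ i) (x $ j)"
      then have "x $ i \<in> CP1" "x $ j \<in> CP1" by (auto simp: space_conf_measure conf_space_def)
      then show "Im ((trajectory x t $ j - trajectory x t $ i) * cnj ?v) \<noteq> 0"
        using Q by (simp add: Q_def trajectory_def flow_eq[OF t])
    qed
  qed simp
  have 2: "AE x :: ambient ^ 'n in conf_measure. \<forall>t\<in>{0, 1}. \<forall>i j. i \<noteq> j \<longrightarrow>
      Im ((trajectory x t $ j - trajectory x t $ i) * cnj (m $ i - m $ j)) \<noteq> 0"
    by (subst AE_ball_countable, simp, intro ballI, subst AE_all_countable, intro allI,
        subst AE_all_countable, intro allI pair) auto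
  from 1 2 show ?thesis by eventually_elim simp
qed

end

section \<open>The class of an isotopy\<close>

lemma Ck_on_cong:
  fixes f f' :: "'a::real_normed_vector \<Rightarrow> 'b::real_normed_vector"
  assumes "Ck_on k V f" "open V" "\<And>x. x \<in> V \<Longrightarrow> f x = f' x"
  shows "Ck_on k V f'"
  using assms(1,3)
proof (induction k arbitrary: f f')
  case 0
  then show ?case by (simp only: Ck_on.simps) (metis continuous_on_eq)
next
  case (Suc k)
  have d: "f differentiable (at x)" and C: "Ck_on k V (\<lambda>x. frechet_derivative f (at x) v)" if "x \<in> V" for x v
    using Suc.prems(1) that unfolding Ck_on.simps(2) by blast+
  have "f' differentiable (at x)" if x: "x \<in> V" for x
  proof -
    have "(f has_derivative frechet_derivative f (at x)) (at x)" using d[OF x] frechet_derivative_works by blast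
    then have "(f' has_derivative frechet_derivative f (at x)) (at x)"
      by (rule has_derivative_transform_within_open[OF _ assms(2) x]) (rule Suc.prems(2))
    then show ?thesis by (rule differentiableI)
  qed
  moreover have "Ck_on k V (\<lambda>x. frechet_derivative f' (at x) v)" for v
  proof (rule Suc.IH)
    show "Ck_on k V (\<lambda>x. frechet_derivative f (at x) v)" using Suc.prems(1) unfolding Ck_on.simps(2) by blast
    fix x assume x: "x \<in> V"
    show "frechet_derivative f (at x) v = frechet_derivative f' (at x) v"
      using frechet_derivative_transform_within_open[OF d[OF x] assms(2) x Suc.prems(2)] by simp
  qed
  ultimately show ?case unfolding Ck_on.simps(2) by blast
qed

text \<open>The derivative of \<open>g\<close> composed with \<open>snd\<close>, in direction
  \<open>v\<close>, is again of this form: the derivative of \<open>g\<close> in direction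
  \<open>snd v\<close>, composed with \<open>snd\<close>. The recursion defining
  \<open>Ck_on\<close> therefore closes up.\<close>

lemma Ck_on_snd:
  fixes g :: "'a::real_normed_vector \<Rightarrow> 'b::real_normed_vector"
  assumes "Ck_on k U g" "open U"
  shows "Ck_on k (snd -` U) (\<lambda>q :: 'c::real_normed_vector \<times> 'a. g (snd q))"
  using assms(1)
proof (induction k arbitrary: g)
  case 0
  then have "continuous_on U g" by (simp only: Ck_on.simps)
  then have "continuous_on (snd -` U) (\<lambda>q :: 'c \<times> 'a. g (snd q))"
    by (rule continuous_on_compose2) (auto intro: continuous_intros)
  then show ?case by (simp only: Ck_on.simps)
next
  case (Suc k)
  have opn: "open (snd -` U :: ('c \<times> 'a) set)"
    by (intro open_vimage assms(2) continuous_intros)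
  have d: "((\<lambda>q :: 'c \<times> 'a. g (snd q)) has_derivative (\<lambda>h. frechet_derivative g (at (snd q)) (snd h))) (at q)"
    if "snd q \<in> U" for q :: "'c \<times> 'a"
  proof -
    have "g differentiable (at (snd q))" using Suc.prems that unfolding Ck_on.simps(2) by blast
    then have "(g has_derivative frechet_derivative g (at (snd q))) (at (snd q))"
      using frechet_derivative_works by blast
    from has_derivative_compose[OF has_derivative_snd[OF has_derivative_ident] this]
    show ?thesis by simp
  qed
  have "Ck_on k (snd -` U) (\<lambda>q :: 'c \<times> 'a. frechet_derivative (\<lambda>q. g (snd q)) (at q) v)" for v
  proof (rule Ck_on_cong[OF _ opn])
    show "Ck_on k (snd -` U) (\<lambda>q :: 'c \<times> 'a. frechet_derivative g (at (snd q)) (snd v))"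
      using Suc.prems unfolding Ck_on.simps(2) by (intro Suc.IH) blast
    fix q :: "'c \<times> 'a" assume "q \<in> snd -` U"
    then show "frechet_derivative g (at (snd q)) (snd v) = frechet_derivative (\<lambda>q. g (snd q)) (at q) v"
      using frechet_derivative_at[OF d[of q]] by (metis vimageD)
  qed
  moreover have "(\<lambda>q :: 'c \<times> 'a. g (snd q)) differentiable (at q)" if "q \<in> snd -` U" for q
    using d[of q] that by (intro differentiableI) auto
  ultimately show ?case unfolding Ck_on.simps(2) by blast
qed

lemma smooth_map_on_snd:
  assumes "smooth_map_on A f"
  shows "smooth_map_on (B \<times> A) (\<lambda>q. f (snd q))"
  unfolding smooth_map_on_def
proof
  fix q assume "q \<in> B \<times> A"
  then obtain U g where U: "open U" "snd q \<in> U" "\<forall>k. Ck_on k U g" "\<forall>y\<in>A \<inter> U. f y = g y"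
    using assms unfolding smooth_map_on_def by (metis mem_Times_iff)
  have "open (snd -` U)" using U(1) by (intro open_vimage continuous_intros)
  then show "\<exists>V h. open V \<and> q \<in> V \<and> (\<forall>k. Ck_on k V h) \<and> (\<forall>y\<in>(B \<times> A) \<inter> V. f (snd y) = h y)"
    using U Ck_on_snd[OF _ U(1)]
    by (intro exI[of _ "snd -` U"] exI[of _ "\<lambda>q. g (snd q)"]) auto
qed

text \<open>Witnessed by the homotopy that ignores its parameter. The value of
  \<open>induced_on_path\<close> at \<open>\<phi>\<close> is thereby one of the values on its
  class.\<close>

lemma (in area_isotopy) in_own_class: "\<phi> \<in> diffeo_path_class \<phi>"
proof -
  have "smooth_map_on ({0..1} \<times> {0..1} \<times> CP1) (\<lambda>(s :: real, t, x). \<phi> t x)"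
    using smooth_map_on_snd[OF smooth, of "{0..1 :: real}"] by (simp add: case_prod_beta')
  then have "diffeo_path_homotopic \<phi> \<phi>"
    unfolding diffeo_path_homotopic_def using path start
    by (intro exI[of _ "\<lambda>_. \<phi>"]) (auto simp: diffeo_path_def)
  then show ?thesis using path by (simp add: diffeo_path_class_def)
qed

section \<open>The estimate for the induced quasimorphism\<close>

text \<open>\<open>basepoint\<close> is continuous and sends planar configurations to spherical
  ones, so it carries homotopies and concatenations of planar loops to spherical ones. The defect of
  \<open>r\<close> bounds the defect of the pulled back functional.\<close>

lemma loop_functional_quasimorphism:
  fixes m :: "complex ^ 'n::finite"
  assumes m: "inj (($) m)" and r: "quasimorphism (pure_braid_group m) r"
  shows "\<exists>D. loop_functional (range conf_cell) m (\<lambda>p. r (path_class conf_space (basepoint \<circ> p))) D"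
proof -
  obtain D where D: "\<And>a b. a \<in> carrier (pure_braid_group m) \<Longrightarrow> b \<in> carrier (pure_braid_group m) \<Longrightarrow>
      \<bar>r (a \<otimes>\<^bsub>pure_braid_group m\<^esub> b) - r a - r b\<bar> \<le> D"
    using r unfolding quasimorphism_def by blast
  have bp: "path (basepoint \<circ> p)" "path_image (basepoint \<circ> p) \<subseteq> conf_space"
    if "path p" "path_image p \<subseteq> \<Union>(range conf_cell)" for p :: "real \<Rightarrow> complex ^ 'n"
    using that basepoint_conf_space path_continuous_image[OF that(1) continuous_on_basepoint]
    unfolding path_image_compose Union_conf_cells by blast+
  have carrier: "path_class conf_space (basepoint \<circ> p) \<in> carrier (pure_braid_group m)"
    if "path p" "path_image p \<subseteq> \<Union>(range conf_cell)" "pathstart p = m" "pathfinish p = m" for p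
    using bp[OF that(1,2)] that(3,4)
    by (auto simp: pure_braid_group_def fundamental_group_def pathstart_compose pathfinish_compose)
  have "loop_functional (range conf_cell) m (\<lambda>p. r (path_class conf_space (basepoint \<circ> p))) D"
  proof
    show "finite (range (conf_cell :: ('n \<Rightarrow> 'n \<Rightarrow> bool \<times> bool) \<Rightarrow> _))" by simp
    show "convex C" if "C \<in> range conf_cell" for C :: "(complex ^ 'n) set" using that convex_conf_cell by blast
    show "m \<in> \<Union>(range conf_cell)" unfolding Union_conf_cells using m by simp
    fix p q :: "real \<Rightarrow> complex ^ 'n"
    show "r (path_class conf_space (basepoint \<circ> p)) = r (path_class conf_space (basepoint \<circ> q))"
      if "homotopic_paths (\<Union>(range conf_cell)) p q"
    proof -
      have "homotopic_paths conf_space (basepoint \<circ> p) (basepoint \<circ> q)"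
        using that continuous_on_basepoint basepoint_conf_space
        by (intro homotopic_paths_continuous_image[OF that]) (auto simp: Union_conf_cells)
      then show ?thesis by (simp add: path_class_eq)
    qed
    assume p: "path p" "path_image p \<subseteq> \<Union>(range conf_cell)" "pathstart p = m" "pathfinish p = m"
      and q: "path q" "path_image q \<subseteq> \<Union>(range conf_cell)" "pathstart q = m" "pathfinish q = m"
    have "path_class conf_space (basepoint \<circ> p) \<otimes>\<^bsub>pure_braid_group m\<^esub> path_class conf_space (basepoint \<circ> q)
        = path_class conf_space (basepoint \<circ> (p +++ q))"
      unfolding pure_braid_group_def path_compose_join using bp[OF p(1,2)] bp[OF q(1,2)] p q
      by (intro fundamental_group_mult) (auto simp: pathstart_compose pathfinish_compose)
    then show "\<bar>r (path_class conf_space (basepoint \<circ> (p +++ q))) - r (path_class conf_space (basepoint \<circ> p))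
        - r (path_class conf_space (basepoint \<circ> q))\<bar> \<le> D"
      using D[OF carrier[OF p] carrier[OF q]] by simp
  qed
  then show ?thesis by blast
qed

lemma conf_measure_finite: "emeasure (conf_measure :: (ambient ^ 'n::finite) measure) conf_space < \<infinity>"
proof -
  let ?P = "Pi\<^sub>M (UNIV :: 'n set) (\<lambda>_. dV)"
  have "emeasure (conf_measure :: (ambient ^ 'n) measure) conf_space = (\<integral>\<^sup>+(x :: ambient ^ 'n). 1 \<partial>conf_measure)"
    by (simp add: space_conf_measure)
  also have "\<dots> \<le> (\<integral>\<^sup>+g. 1 \<partial>?P)" using nn_integral_conf_measure_le[where h = "\<lambda>_ :: ambient ^ 'n. 1"] by simp
  also have "\<dots> = emeasure ?P (space ?P)" by simp
  also have "\<dots> < \<infinity>" by (rule emeasure_PiM_dV_finite)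
  finally show ?thesis .
qed

lemma rotation_average_bound:
  assumes "p > 2"
  shows "\<exists>K<\<infinity>. \<forall>\<phi>. diffeo_path \<phi> \<longrightarrow>
    (\<integral>\<^sup>+(x :: ambient ^ 'n::finite). area_isotopy.rotation \<phi> x \<partial>conf_measure) \<le> K * ennreal (Lp_length p \<phi> + 1)"
proof -
  let ?O = "{(i, j). i \<noteq> j} :: ('n \<times> 'n) set"
  let ?I = "\<lambda>\<phi> i j. \<integral>\<^sup>+(x :: ambient ^ 'n). (\<integral>\<^sup>+t. ennreal (area_isotopy.rate \<phi> t (x $ i) (x $ j)) * indicator {0..1} t \<partial>lborel) \<partial>conf_measure"
  define P where "P K i j \<longleftrightarrow> K < \<infinity> \<and> (\<forall>\<phi>. diffeo_path \<phi> \<longrightarrow> ?I \<phi> i j \<le> K * ennreal (Lp_length p \<phi> + 1))" for K i j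
  \<comment> \<open>One constant per pair, chosen before any isotopy is fixed; this keeps the final
    sum uniform in the isotopy.\<close>
  define K where "K i j = (SOME K. P K i j)" for i j
  have "P (K i j) i j" if "i \<noteq> j" for i j
    unfolding K_def by (rule someI_ex) (use rate_average_bound[OF assms that] in \<open>unfold P_def\<close>)
  then have K: "\<And>i j. i \<noteq> j \<Longrightarrow> K i j < \<infinity>"
    "\<And>i j \<phi>. i \<noteq> j \<Longrightarrow> diffeo_path \<phi> \<Longrightarrow> ?I \<phi> i j \<le> K i j * ennreal (Lp_length p \<phi> + 1)"
    unfolding P_def by blast+
  have "(\<integral>\<^sup>+(x :: ambient ^ 'n). area_isotopy.rotation \<phi> x \<partial>conf_measure)
      \<le> (\<Sum>(i, j)\<in>?O. K i j) * ennreal (Lp_length p \<phi> + 1)" if phi: "diffeo_path \<phi>" for \<phi>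
  proof -
    interpret area_isotopy \<phi> by (rule area_isotopy.intro[OF phi])
    note m = measurable_conf_measure[OF measurable_rate_integral]
    have "(\<integral>\<^sup>+(x :: ambient ^ 'n). rotation x \<partial>conf_measure) = (\<Sum>(i, j)\<in>?O. ?I \<phi> i j)"
      unfolding rotation_def case_prod_beta' by (rule nn_integral_sum) (rule m)
    also have "\<dots> \<le> (\<Sum>(i, j)\<in>?O. K i j * ennreal (Lp_length p \<phi> + 1))"
      using K(2)[OF _ phi] by (intro sum_mono) auto
    also have "\<dots> = (\<Sum>(i, j)\<in>?O. K i j) * ennreal (Lp_length p \<phi> + 1)"
      by (simp add: sum_distrib_right case_prod_beta')
    finally show ?thesis .
  qed
  moreover have "(\<Sum>(i, j)\<in>?O. K i j) < \<infinity>" using K(1) by (auto simp: case_prod_beta')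
  ultimately show ?thesis by blast
qed

lemma induced_on_path_bound:
  fixes m :: "complex ^ 'n::finite"
  assumes m: "inj (($) m)" and r: "quasimorphism (pure_braid_group m) r"
    and \<gamma>: "short_paths m \<gamma>" and p: "p > 2"
  shows "\<exists>C\<ge>0. \<forall>\<phi>. diffeo_path \<phi> \<longrightarrow> \<bar>induced_on_path r \<gamma> \<phi>\<bar> \<le> C * (Lp_length p \<phi> + 1)"
proof -
  obtain D where "loop_functional (range conf_cell) m (\<lambda>p. r (path_class conf_space (basepoint \<circ> p))) D"
    using loop_functional_quasimorphism[OF m r] by blast
  from loop_functional.chain_bound[OF this] obtain A where A: "A \<ge> 0"
    "\<And>k P. convex_chain (range conf_cell) k P \<Longrightarrow> pathstart P = m \<Longrightarrow> pathfinish P = m \<Longrightarrow>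
      \<bar>r (path_class conf_space (basepoint \<circ> P))\<bar> \<le> A * real k" by blast
  obtain K where K: "K < \<infinity>" "\<And>\<phi>. diffeo_path \<phi> \<Longrightarrow>
    (\<integral>\<^sup>+(x :: ambient ^ 'n). area_isotopy.rotation \<phi> x \<partial>conf_measure) \<le> K * ennreal (Lp_length p \<phi> + 1)"
    using rotation_average_bound[OF p, where 'n = 'n] by blast
  define B where "B = 1 + 2 * real (card (range (conf_cell :: ('n \<Rightarrow> 'n \<Rightarrow> bool \<times> bool) \<Rightarrow> _)))"
  have B: "B \<ge> 0" by (simp add: B_def)
  define V where "V = emeasure (conf_measure :: (ambient ^ 'n) measure) conf_space"
  \<comment> \<open>For a generic configuration the integrand is at most
    \<open>A * (3 * rotation x + B)\<close>. Averaging \<open>rotation\<close> contributes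
    \<open>K\<close> times the length plus 1, and the constant \<open>B\<close> contributes
    \<open>B * V\<close>, with \<open>V\<close> the finite total mass.\<close>
  define C where "C = ennreal A * (3 * K + ennreal B * V)"
  have C: "C < \<infinity>"
    unfolding C_def V_def using K(1) conf_measure_finite[where 'n = 'n] by (simp add: ennreal_mult_less_top)
  have "\<bar>induced_on_path r \<gamma> \<phi>\<bar> \<le> enn2real C * (Lp_length p \<phi> + 1)" if phi: "diffeo_path \<phi>" for \<phi>
  proof -
    interpret area_isotopy \<phi> by (rule area_isotopy.intro[OF phi])
    have L: "0 \<le> Lp_length p \<phi>" using p by (intro nn_integral_energy(2)) simp
    let ?H = "\<lambda>x :: ambient ^ 'n. ennreal A * (3 * rotation x + ennreal B)"
    have pointwise: "ennreal \<bar>r (path_class conf_space (braid_loop \<gamma> \<phi> x))\<bar> \<le> ?H x"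
      if x: "x \<in> conf_space" and "\<forall>i. \<forall>t\<in>{0..1}. \<phi> t (x $ i) \<noteq> (0, 1)"
        and "\<forall>t\<in>{0, 1}. \<forall>i j. i \<noteq> j \<longrightarrow> Im ((trajectory x t $ j - trajectory x t $ i) * cnj (m $ i - m $ j)) \<noteq> 0"
      for x
    proof -
      have "\<exists>k P. convex_chain (range conf_cell) k P \<and> pathstart P = m \<and> pathfinish P = m \<and>
          path_class conf_space (braid_loop \<gamma> \<phi> x) = path_class conf_space (basepoint \<circ> P) \<and>
          ennreal (real k) \<le> 3 * rotation x + ennreal B"
        unfolding B_def by (rule braid_loop_chain[OF x _ m \<gamma>]) (use that in auto)
      then obtain k P where k: "convex_chain (range conf_cell) k P" "pathstart P = m" "pathfinish P = m"
        "path_class conf_space (braid_loop \<gamma> \<phi> x) = path_class conf_space (basepoint \<circ> P)"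
        "ennreal (real k) \<le> 3 * rotation x + ennreal B" by blast
      have "ennreal \<bar>r (path_class conf_space (braid_loop \<gamma> \<phi> x))\<bar> \<le> ennreal (A * real k)"
        unfolding k(4) by (intro ennreal_leI A(2) k)
      also have "\<dots> = ennreal A * ennreal (real k)" using A by (simp add: ennreal_mult)
      also have "\<dots> \<le> ?H x" by (intro mult_left_mono k(5)) simp
      finally show ?thesis .
    qed
    have "AE x in conf_measure. ennreal \<bar>r (path_class conf_space (braid_loop \<gamma> \<phi> x))\<bar> \<le> ?H x"
      using AE_generic[OF m] AE_space by eventually_elim (use pointwise in \<open>simp add: space_conf_measure\<close>)
    then have ae: "AE x in completion conf_measure. ennreal \<bar>r (path_class conf_space (braid_loop \<gamma> \<phi> x))\<bar> \<le> ?H x"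
      by (rule AE_completion)
    have rot: "rotation \<in> borel_measurable (conf_measure :: (ambient ^ 'n) measure)"
      unfolding rotation_def[abs_def] case_prod_beta'
      by (intro borel_measurable_sum measurable_conf_measure measurable_rate_integral)
    have "(\<integral>\<^sup>+x. ?H x \<partial>completion conf_measure) = (\<integral>\<^sup>+x. ?H x \<partial>conf_measure)"
      by (rule nn_integral_completion)
    also have "\<dots> = ennreal A * (3 * (\<integral>\<^sup>+(x :: ambient ^ 'n). rotation x \<partial>conf_measure) + ennreal B * V)"
      using rot by (simp add: nn_integral_cmult nn_integral_add V_def space_conf_measure)
    \<comment> \<open>The term without a length is absorbed because
      \<open>Lp_length p \<phi> + 1\<close> is at least 1.\<close>
    also have "\<dots> \<le> ennreal A * (3 * (K * ennreal (Lp_length p \<phi> + 1)) + ennreal B * V * ennreal (Lp_length p \<phi> + 1))"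
    proof (intro mult_left_mono add_mono K(2)[OF phi])
      show "ennreal B * V \<le> ennreal B * V * ennreal (Lp_length p \<phi> + 1)"
      proof -
        have "ennreal 1 \<le> ennreal (Lp_length p \<phi> + 1)" using L by (intro ennreal_leI) simp
        then have "ennreal B * V * ennreal 1 \<le> ennreal B * V * ennreal (Lp_length p \<phi> + 1)"
          by (intro mult_left_mono) simp_all
        then show ?thesis by (simp only: ennreal_1 mult_1_right)
      qed
    qed auto
    also have "\<dots> = C * ennreal (Lp_length p \<phi> + 1)" by (simp add: C_def algebra_simps)
    also have "\<dots> = ennreal (enn2real C * (Lp_length p \<phi> + 1))"
      using C L by (simp add: ennreal_mult ennreal_enn2real_if del: ennreal_plus)
    finally show ?thesis
      unfolding induced_on_path_def using L by (intro integral_bound_nonneg[OF ae]) auto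
  qed
  then show ?thesis by (intro exI[of _ "enn2real C"]) auto
qed

theorem theorem1:
  fixes m :: "complex ^ 'n"
    and r :: "(real \<Rightarrow> ambient ^ 'n) set \<Rightarrow> real"
    and \<gamma> :: "ambient ^ 'n \<Rightarrow> real \<Rightarrow> ambient ^ 'n"
    and p :: real
  assumes "inj (($) m)"
    and "quasimorphism (pure_braid_group m) r"
    and "short_paths m \<gamma>"
    and "p > 2"
  shows "\<exists>C>0. \<forall>\<phi>. diffeo_path \<phi> \<longrightarrow>
           \<bar>induced_qm r \<gamma> (diffeo_path_class \<phi>)\<bar> \<le> C * (Lp_length p \<phi> + 1)"
proof -
  obtain C where C: "C \<ge> 0" "\<And>\<phi>. diffeo_path \<phi> \<Longrightarrow> \<bar>induced_on_path r \<gamma> \<phi>\<bar> \<le> C * (Lp_length p \<phi> + 1)"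
    using induced_on_path_bound[OF assms] by blast
  \<comment> \<open>If \<open>induced_on_path\<close> took several values on a class, \<open>the_elem\<close> would return one junk value that
      does not depend on the class.  Absorbing it into the constant spares a proof of well-definedness.\<close>
  define c0 :: real where "c0 = (THE v. False)"
  have "\<bar>induced_qm r \<gamma> (diffeo_path_class \<phi>)\<bar> \<le> (C + \<bar>c0\<bar> + 1) * (Lp_length p \<phi> + 1)"
    if phi: "diffeo_path \<phi>" for \<phi>
  proof -
    interpret area_isotopy \<phi> by (rule area_isotopy.intro[OF phi])
    have L: "0 \<le> Lp_length p \<phi>" using assms(4) by (intro nn_integral_energy(2)) simp
    let ?S = "induced_on_path r \<gamma> ` diffeo_path_class \<phi>"
    show ?thesis
    proof (cases "\<exists>v. ?S = {v}")
      case True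
      then obtain v where v: "?S = {v}" by blast
      then have "induced_on_path r \<gamma> \<phi> = v" using in_own_class by blast
      then have "induced_qm r \<gamma> (diffeo_path_class \<phi>) = induced_on_path r \<gamma> \<phi>"
        by (simp add: induced_qm_def v)
      then have "\<bar>induced_qm r \<gamma> (diffeo_path_class \<phi>)\<bar> \<le> C * (Lp_length p \<phi> + 1)" using C(2)[OF phi] by simp
      also have "\<dots> \<le> (C + \<bar>c0\<bar> + 1) * (Lp_length p \<phi> + 1)" using L by (intro mult_right_mono) auto
      finally show ?thesis .
    next
      case False
      then have "induced_qm r \<gamma> (diffeo_path_class \<phi>) = c0"
        by (simp add: induced_qm_def the_elem_def c0_def)
      then have "\<bar>induced_qm r \<gamma> (diffeo_path_class \<phi>)\<bar> \<le> (C + \<bar>c0\<bar> + 1) * 1" using C(1) by simp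
      also have "\<dots> \<le> (C + \<bar>c0\<bar> + 1) * (Lp_length p \<phi> + 1)" using C(1) L by (intro mult_left_mono) auto
      finally show ?thesis .
    qed
  qed
  then show ?thesis using C(1) by (intro exI[of _ "C + \<bar>c0\<bar> + 1"]) auto
qed

end
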